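(* Let (A1)--(A3) (stated in the context) hold. Then the initial boundary value problem $$\partial_t p+\partial_x u=0,\qquad \partial_t u+\partial_x p+a(u)=0,\qquad x\in(0,1),\ 0<t\le T,$$ $$u(0,t)=g_0(t),\quad u(1,t)=g_1(t),\qquad p(x,0)=p_0(x),\quad u(x,0)=u_0(x),$$ has a unique classical solution $$(p,u)\in C^1([0,T];L^2(0,1)\times L^2(0,1))\cap C([0,T];H^1(0,1)\times H^1(0,1)),$$ and $$\|(p,u)\|_{C([0,T];H^1\times H^1)}+\|(p,u)\|_{C^1([0,T];L^2\times L^2)}\le C'$$ with a constant $C'$ depending only on the bounds for the coefficient and the data and on the time horizon $T$. Moreover, for any $0\le\gamma<1/2$, the function $\triangle p(t):=p(0,t)-p(1,t)$ belongs to $C^\gamma([0,T])$ and $$\|\triangle p\|_{C^\gamma([0,T])}\le C'(\gamma),$$ where $C'(\gamma)$ depends only on $\gamma$, the bounds for the coefficient and the data, and $T$.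
   Context: Assumptions, with $T>0$: (A1) $a\in W^{3,\infty}_{loc}(\mathbb R)$ with $a(0)=0$, $a_0\le a'(\cdot)\le a_1$, $|a''(\cdot)|\le a_2$, $|a'''(\cdot)|\le a_3$ for some positive constants $a_0,a_1,a_2,a_3>0$. (A2) $u_0=0$ and $p_0=c$ (constant function) with $c\in\mathbb R$. (A3) $g_0,g_1\in C^4([0,T])$, $g_0(0)=g_1(0)=0$ and $g_0'(0)=g_1'(0)=0$. "Bounds for the coefficient and the data" means $a_0,a_1,a_2,a_3$ and bounds for $|c|$ and $\|g_0\|_{C^4([0,T])},\|g_1\|_{C^4([0,T])}$. A classical solution is a pair in the stated space that satisfies the differential equations in $L^2(0,1)$ for every $t$, the boundary conditions for every $t$ in the sense of traces, and the initial conditions. $C^\gamma$ is the Hölder space of exponent $\gamma$ (with $C^0$ the continuous functions). *)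

theory Defs
  imports "HOL-Analysis.Analysis"
begin

text \<open>Elements of Lebesgue and Sobolev spaces are represented by functions \<open>real \<Rightarrow> real\<close>; equality of
  elements is equality almost everywhere on the domain, and values off the domain are irrelevant.\<close>

section \<open>Weak derivatives and local Sobolev spaces\<close>

definition test_fun :: "real set \<Rightarrow> (real \<Rightarrow> real) \<Rightarrow> bool" where
  "test_fun S \<phi> \<longleftrightarrow> (\<forall>k x. ((deriv ^^ k) \<phi>) field_differentiable (at x)) \<and>
     compact (closure {x. \<phi> x \<noteq> 0}) \<and> closure {x. \<phi> x \<noteq> 0} \<subseteq> S"

definition L1_loc :: "real set \<Rightarrow> (real \<Rightarrow> real) \<Rightarrow> bool" where
  "L1_loc S f \<longleftrightarrow> (\<forall>K. compact K \<and> K \<subseteq> S \<longrightarrow> integrable (lebesgue_on K) f)"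

definition Linf_loc :: "real set \<Rightarrow> (real \<Rightarrow> real) \<Rightarrow> bool" where
  "Linf_loc S f \<longleftrightarrow> f \<in> borel_measurable (lebesgue_on S) \<and>
     (\<forall>K. compact K \<and> K \<subseteq> S \<longrightarrow> (\<exists>B. AE x in lebesgue_on K. \<bar>f x\<bar> \<le> B))"

definition has_weak_deriv :: "nat \<Rightarrow> real set \<Rightarrow> (real \<Rightarrow> real) \<Rightarrow> (real \<Rightarrow> real) \<Rightarrow> bool" where
  "has_weak_deriv k S f g \<longleftrightarrow> L1_loc S f \<and> L1_loc S g \<and>
     (\<forall>\<phi>. test_fun S \<phi> \<longrightarrow>
        (LINT x|lebesgue_on S. f x * (deriv ^^ k) \<phi> x) = (-1) ^ k * (LINT x|lebesgue_on S. g x * \<phi> x))"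

text \<open>Some representative of the \<open>k\<close>-th weak derivative, which is unique up to null sets.\<close>

definition weak_deriv :: "nat \<Rightarrow> real set \<Rightarrow> (real \<Rightarrow> real) \<Rightarrow> real \<Rightarrow> real" where
  "weak_deriv k S f = (SOME g. has_weak_deriv k S f g)"

definition W_inf_loc :: "nat \<Rightarrow> real set \<Rightarrow> (real \<Rightarrow> real) \<Rightarrow> bool" where
  "W_inf_loc m S f \<longleftrightarrow> (\<forall>k\<le>m. \<exists>g. has_weak_deriv k S f g \<and> Linf_loc S g)"

section \<open>The spaces \<open>L\<^sup>2(0,1)\<close> and \<open>H\<^sup>1(0,1)\<close>\<close>

abbreviation unit_ivl :: "real set" where
  "unit_ivl \<equiv> {0<..<1}"

definition L2 :: "(real \<Rightarrow> real) set" where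
  "L2 = {f \<in> borel_measurable (lebesgue_on unit_ivl). integrable (lebesgue_on unit_ivl) (\<lambda>x. (f x)\<^sup>2)}"

definition L2_norm :: "(real \<Rightarrow> real) \<Rightarrow> real" where
  "L2_norm f = sqrt (LINT x|lebesgue_on unit_ivl. (f x)\<^sup>2)"

abbreviation dx :: "(real \<Rightarrow> real) \<Rightarrow> real \<Rightarrow> real" where
  "dx \<equiv> weak_deriv 1 unit_ivl"

definition H1 :: "(real \<Rightarrow> real) set" where
  "H1 = {f \<in> L2. \<exists>g\<in>L2. has_weak_deriv 1 unit_ivl f g}"

definition H1_norm :: "(real \<Rightarrow> real) \<Rightarrow> real" where
  "H1_norm f = sqrt ((L2_norm f)\<^sup>2 + (L2_norm (dx f))\<^sup>2)"

text \<open>Trace at an end point \<open>e \<in> {0, 1}\<close>: the value there of the representative that is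
  continuous on the closed interval.\<close>

definition trace_at :: "real \<Rightarrow> (real \<Rightarrow> real) \<Rightarrow> real" where
  "trace_at e f =
     (THE v. \<exists>F. continuous_on {0..1} F \<and> (AE x in lebesgue_on unit_ivl. F x = f x) \<and> F e = v)"

section \<open>Functions of time with values in a space \<open>V\<close> with norm \<open>N\<close>\<close>

definition C0_in :: "real \<Rightarrow> (real \<Rightarrow> real) set \<Rightarrow> ((real \<Rightarrow> real) \<Rightarrow> real) \<Rightarrow> (real \<Rightarrow> real \<Rightarrow> real) \<Rightarrow> bool" where
  "C0_in T V N w \<longleftrightarrow> (\<forall>t\<in>{0..T}. w t \<in> V) \<and>
     (\<forall>t\<in>{0..T}. ((\<lambda>s. N (\<lambda>x. w s x - w t x)) \<longlongrightarrow> 0) (at t within {0..T}))"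

definition has_time_deriv ::
    "real \<Rightarrow> (real \<Rightarrow> real) set \<Rightarrow> ((real \<Rightarrow> real) \<Rightarrow> real) \<Rightarrow> (real \<Rightarrow> real \<Rightarrow> real) \<Rightarrow> real \<Rightarrow> (real \<Rightarrow> real) \<Rightarrow> bool" where
  "has_time_deriv T V N w t q \<longleftrightarrow> q \<in> V \<and>
     ((\<lambda>s. N (\<lambda>x. (w s x - w t x) / (s - t) - q x)) \<longlongrightarrow> 0) (at t within {0..T})"

definition time_deriv ::
    "real \<Rightarrow> (real \<Rightarrow> real) set \<Rightarrow> ((real \<Rightarrow> real) \<Rightarrow> real) \<Rightarrow> (real \<Rightarrow> real \<Rightarrow> real) \<Rightarrow> real \<Rightarrow> real \<Rightarrow> real" where
  "time_deriv T V N w t = (SOME q. has_time_deriv T V N w t q)"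

definition C1_in :: "real \<Rightarrow> (real \<Rightarrow> real) set \<Rightarrow> ((real \<Rightarrow> real) \<Rightarrow> real) \<Rightarrow> (real \<Rightarrow> real \<Rightarrow> real) \<Rightarrow> bool" where
  "C1_in T V N w \<longleftrightarrow> C0_in T V N w \<and> (\<forall>t\<in>{0..T}. \<exists>q. has_time_deriv T V N w t q) \<and>
     C0_in T V N (time_deriv T V N w)"

text \<open>Norms for pairs, i.e. for functions with values in \<open>V \<times> V\<close>.\<close>

definition C0_norm :: "real \<Rightarrow> ((real \<Rightarrow> real) \<Rightarrow> real) \<Rightarrow> (real \<Rightarrow> real \<Rightarrow> real) \<Rightarrow> (real \<Rightarrow> real \<Rightarrow> real) \<Rightarrow> real" where
  "C0_norm T N p u = (SUP t\<in>{0..T}. sqrt ((N (p t))\<^sup>2 + (N (u t))\<^sup>2))"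

definition C1_norm ::
    "real \<Rightarrow> (real \<Rightarrow> real) set \<Rightarrow> ((real \<Rightarrow> real) \<Rightarrow> real) \<Rightarrow> (real \<Rightarrow> real \<Rightarrow> real) \<Rightarrow> (real \<Rightarrow> real \<Rightarrow> real) \<Rightarrow> real" where
  "C1_norm T V N p u = C0_norm T N p u + C0_norm T N (time_deriv T V N p) (time_deriv T V N u)"

abbreviation dt :: "real \<Rightarrow> (real \<Rightarrow> real \<Rightarrow> real) \<Rightarrow> real \<Rightarrow> real \<Rightarrow> real" where
  "dt T \<equiv> time_deriv T L2 L2_norm"

section \<open>\<open>C\<^sup>k\<close> and Hoelder functions on \<open>[0,T]\<close>\<close>

text \<open>Derivatives on \<open>[0,T]\<close> are one-sided at the end points.\<close>

definition ivl_deriv :: "real \<Rightarrow> (real \<Rightarrow> real) \<Rightarrow> real \<Rightarrow> real" where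
  "ivl_deriv T f t = vector_derivative f (at t within {0..T})"

definition Ck_on :: "nat \<Rightarrow> real \<Rightarrow> (real \<Rightarrow> real) \<Rightarrow> bool" where
  "Ck_on k T f \<longleftrightarrow> (\<forall>j<k. (ivl_deriv T ^^ j) f differentiable_on {0..T}) \<and>
     continuous_on {0..T} ((ivl_deriv T ^^ k) f)"

definition Ck_norm :: "nat \<Rightarrow> real \<Rightarrow> (real \<Rightarrow> real) \<Rightarrow> real" where
  "Ck_norm k T f = (\<Sum>j\<le>k. SUP t\<in>{0..T}. \<bar>(ivl_deriv T ^^ j) f t\<bar>)"

definition Hoelder :: "real \<Rightarrow> real \<Rightarrow> (real \<Rightarrow> real) \<Rightarrow> bool" where
  "Hoelder \<gamma> T f \<longleftrightarrow> continuous_on {0..T} f \<and>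
     (\<gamma> > 0 \<longrightarrow> (\<exists>L. \<forall>s\<in>{0..T}. \<forall>t\<in>{0..T}. \<bar>f s - f t\<bar> \<le> L * \<bar>s - t\<bar> powr \<gamma>))"

definition Hoelder_norm :: "real \<Rightarrow> real \<Rightarrow> (real \<Rightarrow> real) \<Rightarrow> real" where
  "Hoelder_norm \<gamma> T f = (SUP t\<in>{0..T}. \<bar>f t\<bar>) +
     (if \<gamma> = 0 then 0
      else (SUP (s, t)\<in>{(s, t). s \<in> {0..T} \<and> t \<in> {0..T} \<and> s \<noteq> t}. \<bar>f s - f t\<bar> / \<bar>s - t\<bar> powr \<gamma>))"

section \<open>Assumptions on the data and the initial boundary value problem\<close>

text \<open>An element of \<open>W\<^sup>3\<^sup>,\<^sup>\<infinity>\<close> (local) has a continuous representative; this is the one meant by the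
  point value \<open>a 0\<close> and by the composition with \<open>u\<close>.\<close>

definition coefficient_assms :: "real \<Rightarrow> real \<Rightarrow> real \<Rightarrow> real \<Rightarrow> (real \<Rightarrow> real) \<Rightarrow> bool" where
  "coefficient_assms a0 a1 a2 a3 a \<longleftrightarrow>
     W_inf_loc 3 UNIV a \<and> continuous_on UNIV a \<and> a 0 = 0 \<and>
     (AE y in lebesgue. a0 \<le> weak_deriv 1 UNIV a y \<and> weak_deriv 1 UNIV a y \<le> a1) \<and>
     (AE y in lebesgue. \<bar>weak_deriv 2 UNIV a y\<bar> \<le> a2) \<and>
     (AE y in lebesgue. \<bar>weak_deriv 3 UNIV a y\<bar> \<le> a3)"

definition boundary_data_assms :: "real \<Rightarrow> (real \<Rightarrow> real) \<Rightarrow> bool" where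
  "boundary_data_assms T g \<longleftrightarrow> Ck_on 4 T g \<and> g 0 = 0 \<and> ivl_deriv T g 0 = 0"

text \<open>\<open>p t\<close> and \<open>u t\<close> are the spatial profiles at time \<open>t\<close>.\<close>

definition classical_solution ::
    "real \<Rightarrow> (real \<Rightarrow> real) \<Rightarrow> (real \<Rightarrow> real) \<Rightarrow> (real \<Rightarrow> real) \<Rightarrow> (real \<Rightarrow> real) \<Rightarrow> (real \<Rightarrow> real) \<Rightarrow>
     (real \<Rightarrow> real \<Rightarrow> real) \<Rightarrow> (real \<Rightarrow> real \<Rightarrow> real) \<Rightarrow> bool" where
  "classical_solution T a g0 g1 p0 u0 p u \<longleftrightarrow>
     C1_in T L2 L2_norm p \<and> C1_in T L2 L2_norm u \<and> C0_in T H1 H1_norm p \<and> C0_in T H1 H1_norm u \<and>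
     (\<forall>t\<in>{0<..T}. AE x in lebesgue_on unit_ivl. dt T p t x + dx (u t) x = 0) \<and>
     (\<forall>t\<in>{0<..T}. AE x in lebesgue_on unit_ivl. dt T u t x + dx (p t) x + a (u t x) = 0) \<and>
     (\<forall>t\<in>{0<..T}. trace_at 0 (u t) = g0 t \<and> trace_at 1 (u t) = g1 t) \<and>
     (AE x in lebesgue_on unit_ivl. p 0 x = p0 x) \<and> (AE x in lebesgue_on unit_ivl. u 0 x = u0 x)"

definition pressure_drop :: "(real \<Rightarrow> real \<Rightarrow> real) \<Rightarrow> real \<Rightarrow> real" where
  "pressure_drop p t = trace_at 0 (p t) - trace_at 1 (p t)"

end

theory Submission
  imports Defs "HOL-Computational_Algebra.Polynomial"
begin

text \<open>
  In the variables \<open>p + u\<close> and \<open>p - u\<close> the system is a pair of transport equations with speeds \<open>1\<close>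
  and \<open>-1\<close>, coupled by the friction \<open>a(u)\<close> and by the boundary conditions. Three observations make it
  a single transport equation on the line. The state \<open>(c, 0)\<close> is stationary because \<open>a(0) = 0\<close>, so the
  solution may be continued by it to negative times, and the initial condition then says that the
  deviation from \<open>(c, 0)\<close> vanishes for \<open>t \<le> 0\<close>. The frictionless system with the given boundary
  values has an explicit solution, a finite sum of shifts of the data (\<open>boundary_extension\<close>); it is
  \<open>C\<^sup>1\<close> because \<open>g\<^sub>i(0) = g\<^sub>i'(0) = 0\<close>, and subtracting it leaves homogeneous boundary conditions.
  Finally, continuing \<open>p\<close> evenly and \<open>u\<close> oddly across both ends of the interval makes \<open>p - u\<close> the
  reflection of \<open>p + u\<close>, and only one \<open>2\<close>-periodic unknown \<open>w\<close> with \<open>w\<^sub>t + w\<^sub>\<xi> = f\<close> remains. The price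
  is that \<open>f\<close> jumps at the integers, which is harmless after integration along characteristics.

  The fixed point problem is posed for \<open>Z = w\<^sub>t\<close> instead of \<open>w\<close>. Its right-hand side contains
  \<open>a'(u) u\<^sub>t\<close>, and \<open>a'\<close> is bounded and Lipschitz, so the map is a contraction in a supremum norm with
  an exponential weight in time (\<open>duhamel_contraction\<close>, \<open>duhamel_fixpoint\<close>). The time derivative thus
  comes with the solution; the space derivative follows from it by moving along characteristics
  (\<open>duhamel_space_deriv\<close>). The result is a pointwise \<open>C\<^sup>1\<close> solution with explicit bounds in terms of
  \<open>a\<^sub>1\<close>, \<open>T\<close>, \<open>c\<close> and the first derivatives of the data (\<open>smooth_solution\<close>). On the compact set
  \<open>[0,T] \<times> [0,1]\<close> uniform continuity turns it into a classical solution in the sense of \<open>L\<^sup>2\<close> and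
  \<open>H\<^sup>1\<close>, and the pressure drop is even Lipschitz continuous.

  Uniqueness is an energy estimate (\<open>classical_solution_unique\<close>): the squared \<open>L\<^sup>2\<close> norm of the
  difference of two solutions decreases because \<open>a\<close> is monotone and the boundary terms of the
  integration by parts vanish.

  Underneath lies some theory of weak derivatives in one dimension: there are enough test functions
  to determine an integrable function (\<open>du_Bois_Reymond\<close>), so a function with an integrable weak
  derivative is a primitive of it (\<open>weak_pair_primitive\<close>). This yields traces and integration by
  parts in \<open>H\<^sup>1(0,1)\<close>, and it shows that the coefficient \<open>a\<close> is \<open>C\<^sup>1\<close> with a Lipschitz derivative
  (\<open>coefficient_regular\<close>).
\<close>

section \<open>Smooth functions of compact support\<close>

definition smooth :: "(real \<Rightarrow> real) \<Rightarrow> bool" where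
  "smooth f \<longleftrightarrow> (\<forall>k x. ((deriv ^^ k) f) field_differentiable (at x))"

text \<open>A class of functions closed under differentiation consists of smooth functions. This avoids any
  computation with iterated derivatives: for the bump and its rescalings it suffices to name a class.\<close>

lemma smooth_coinduct:
  assumes "f \<in> F"
    and step: "\<And>f. f \<in> F \<Longrightarrow> \<exists>f'\<in>F. \<forall>x. (f has_real_derivative f' x) (at x)"
  shows "smooth f"
proof -
  have "(deriv ^^ k) f \<in> F" for k
  proof (induction k)
    case (Suc k)
    then obtain f' where "f' \<in> F" "\<forall>x. ((deriv ^^ k) f has_real_derivative f' x) (at x)"
      using step by blast
    then have "deriv ((deriv ^^ k) f) = f'"
      by (intro ext DERIV_imp_deriv) auto
    with \<open>f' \<in> F\<close> show ?case by simp
  qed (simp add: assms(1))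
  with step show ?thesis
    unfolding smooth_def field_differentiable_def by blast
qed

lemma smooth_has_deriv: "smooth f \<Longrightarrow> (f has_real_derivative deriv f x) (at x)"
  unfolding smooth_def by (metis DERIV_deriv_iff_field_differentiable funpow_0)

lemma smooth_deriv: "smooth f \<Longrightarrow> smooth (deriv f)"
  unfolding smooth_def by (metis funpow_Suc_right o_apply)

lemma smooth_primitive:
  assumes "smooth f" and "\<And>x. (g has_real_derivative f x) (at x)"
  shows "smooth g"
  by (rule smooth_coinduct[where F = "insert g {f. smooth f}"])
    (use assms smooth_has_deriv smooth_deriv in blast)+

lemma smooth_combination:
  assumes "smooth f" "smooth g"
  shows "smooth (\<lambda>x. c * f x + d * g x)"
proof (rule smooth_coinduct[where F = "{\<lambda>x. c * f x + d * g x |f g. smooth f \<and> smooth g}"])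
  fix h assume "h \<in> {\<lambda>x. c * f x + d * g x |f g. smooth f \<and> smooth g}"
  then obtain f g where "h = (\<lambda>x. c * f x + d * g x)" "smooth f" "smooth g" by blast
  then show "\<exists>h'\<in>{\<lambda>x. c * f x + d * g x |f g. smooth f \<and> smooth g}. \<forall>x. (h has_real_derivative h' x) (at x)"
    by (intro bexI[of _ "\<lambda>x. c * deriv f x + d * deriv g x"])
      (auto intro!: derivative_eq_intros smooth_has_deriv smooth_deriv)
qed (use assms in blast)

lemma smooth_affine:
  assumes "smooth f"
  shows "smooth (\<lambda>x. f (m * x + b))"
proof (rule smooth_coinduct[where F = "{\<lambda>x. c * f (m * x + b) |c f. smooth f}"])
  fix h assume "h \<in> {\<lambda>x. c * f (m * x + b) |c f. smooth f}"
  then obtain c f where h: "h = (\<lambda>x. c * f (m * x + b))" "smooth f" by blast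
  have "(h has_real_derivative (c * m) * deriv f (m * x + b)) (at x)" for x
    unfolding h(1)
    by (rule derivative_eq_intros DERIV_chain2[OF smooth_has_deriv[OF h(2)]] refl | simp)+
  then show "\<exists>h'\<in>{\<lambda>x. c * f (m * x + b) |c f. smooth f}. \<forall>x. (h has_real_derivative h' x) (at x)"
    by (intro bexI[of _ "\<lambda>x. (c * m) * deriv f (m * x + b)"]) (use h smooth_deriv in auto)
qed (use assms in \<open>auto intro!: exI[of _ 1]\<close>)

lemma smooth_continuous: "smooth f \<Longrightarrow> continuous_on S f"
  by (meson DERIV_continuous continuous_at_imp_continuous_on smooth_has_deriv)

text \<open>The derivatives of the bump \<open>exp (- 1 / (1 - x\<^sup>2))\<close> are the bump itself times a polynomial times a
  power of \<open>1 / (1 - x\<^sup>2)\<close>; this is the class closed under differentiation.\<close>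

definition bump_term :: "real poly \<Rightarrow> nat \<Rightarrow> real \<Rightarrow> real" where
  "bump_term P n x =
     (if \<bar>x\<bar> < 1 then poly P x * (1 / (1 - x\<^sup>2)) ^ n * exp (- (1 / (1 - x\<^sup>2))) else 0)"

lemma power_mult_exp_minus_le:
  fixes y :: real assumes "y \<ge> 0" shows "y ^ n * exp (- y) \<le> fact n"
proof -
  have "y ^ n / fact n \<le> exp y"
  proof -
    have "exp y = (\<Sum>n. y ^ n /\<^sub>R fact n)" by (simp add: exp_def)
    moreover have "(\<Sum>k\<in>{n}. y ^ k /\<^sub>R fact k) \<le> (\<Sum>n. y ^ n /\<^sub>R fact n)"
      by (rule sum_le_suminf) (use assms summable_exp_generic[of y] in \<open>auto simp: divide_inverse mult.commute\<close>)
    ultimately show ?thesis by (simp add: divide_inverse mult.commute)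
  qed
  then have "y ^ n \<le> fact n * exp y" by (simp add: field_simps)
  then show ?thesis by (simp add: exp_minus field_simps)
qed

text \<open>With \<open>y = 1 / (1 - x\<^sup>2)\<close> the product \<open>y ^ (n + 2) * exp (- y)\<close> is bounded. The bound is quadratic in
  the distance to the end points, which is what makes the derivative vanish there.\<close>

lemma bump_term_flat:
  obtains C where "\<And>x. \<bar>bump_term P n x\<bar> \<le> C * (1 - x\<^sup>2)\<^sup>2"
proof -
  have "compact ((\<lambda>x. poly P x) ` {-1..1})"
    by (intro compact_continuous_image continuous_intros) auto
  then obtain B where B: "\<And>x. x \<in> {-1..1} \<Longrightarrow> \<bar>poly P x\<bar> \<le> B"
    using compact_imp_bounded bounded_iff by (metis imageI real_norm_def)
  have B0: "B \<ge> 0" using B[of 0] by auto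
  have "\<bar>bump_term P n x\<bar> \<le> (B * fact (n + 2)) * (1 - x\<^sup>2)\<^sup>2" for x
  proof (cases "\<bar>x\<bar> < 1")
    case True
    define y where "y = 1 / (1 - x\<^sup>2)"
    have pos: "1 - x\<^sup>2 > 0" using True by (simp add: abs_square_less_1)
    then have y: "y > 0" "(1 - x\<^sup>2)\<^sup>2 = 1 / y\<^sup>2" by (auto simp: y_def field_simps)
    have "\<bar>bump_term P n x\<bar> = \<bar>poly P x\<bar> * (y ^ n * exp (- y))"
      using True y by (simp add: bump_term_def y_def abs_mult)
    also have "\<dots> = \<bar>poly P x\<bar> * ((y ^ (n+2) * exp (- y)) * (1 - x\<^sup>2)\<^sup>2)"
    proof -
      have "y ^ (n+2) * (1 - x\<^sup>2)\<^sup>2 = y ^ n" using y by (simp add: power_add power2_eq_square)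
      then show ?thesis by (metis mult.commute mult.left_commute)
    qed
    also have "\<dots> \<le> B * (fact (n+2) * (1 - x\<^sup>2)\<^sup>2)"
      using True y B0 by (intro mult_mono B power_mult_exp_minus_le mult_right_mono) auto
    finally show ?thesis by (simp add: mult_ac)
  qed (use B0 in \<open>simp add: bump_term_def\<close>)
  then show ?thesis using that by blast
qed

lemma bump_term_has_deriv:
  "(bump_term P n has_real_derivative
     bump_term (pderiv P * [:1, 0, -1:]\<^sup>2 + smult (2 * real n) ([:0, 1:] * P * [:1, 0, -1:]) - smult 2 ([:0, 1:] * P)) (n + 2) x) (at x)"
proof (cases "\<bar>x\<bar> < 1")
  case True
  have pos: "1 - x\<^sup>2 > 0" using True by (simp add: abs_square_less_1)
  define y where "y = 1 / (1 - x\<^sup>2)"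
  have y: "y * (1 - x\<^sup>2) = 1" "y > 0" using pos by (auto simp: y_def)
  have dy: "((\<lambda>x. 1 / (1 - x\<^sup>2)) has_real_derivative 2 * x * y\<^sup>2) (at x)"
    using pos by (auto intro!: derivative_eq_intros simp: y_def power2_eq_square field_simps)
  have "((\<lambda>x. poly P x * (1 / (1 - x\<^sup>2)) ^ n * exp (- (1 / (1 - x\<^sup>2)))) has_real_derivative
     (poly (pderiv P) x * y ^ n + poly P x * (real n * y ^ (n - 1) * (2 * x * y\<^sup>2))) * exp (- y)
     + poly P x * y ^ n * (exp (- y) * (- (2 * x * y\<^sup>2)))) (at x)"
    by (rule derivative_eq_intros dy poly_DERIV refl | simp add: y_def algebra_simps)+
  moreover have "(poly (pderiv P) x * y ^ n + poly P x * (real n * y ^ (n - 1) * (2 * x * y\<^sup>2))) * exp (- y)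
     + poly P x * y ^ n * (exp (- y) * (- (2 * x * y\<^sup>2)))
    = bump_term (pderiv P * [:1, 0, -1:]\<^sup>2 + smult (2 * real n) ([:0, 1:] * P * [:1, 0, -1:]) - smult 2 ([:0, 1:] * P)) (n + 2) x"
  proof -
    have 1: "poly (pderiv P) x * y ^ n = poly (pderiv P) x * (1 - x\<^sup>2)\<^sup>2 * y ^ (n + 2)"
    proof -
      have "(1 - x\<^sup>2)\<^sup>2 * y ^ (n + 2) = y ^ n * (y * (1 - x\<^sup>2))\<^sup>2" by (simp add: power_add power2_eq_square)
      then show ?thesis using y by simp
    qed
    have 2: "real n * y ^ (n - 1) * (2 * x * y\<^sup>2) = 2 * real n * x * (1 - x\<^sup>2) * y ^ (n + 2)"
    proof (cases n)
      case (Suc m)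
      have "(1 - x\<^sup>2) * y ^ (n + 2) = y ^ (n + 1) * (y * (1 - x\<^sup>2))" by (simp add: power_add power2_eq_square)
      then have "(1 - x\<^sup>2) * y ^ (n + 2) = y ^ (n - 1) * y\<^sup>2" unfolding y(1) using Suc by (simp add: power2_eq_square)
      then show ?thesis by (metis (no_types, lifting) mult.assoc mult.commute)
    qed simp
    have q: "poly [:1, 0, -1:] x = 1 - x\<^sup>2" by (simp add: power2_eq_square)
    have e: "bump_term R k x = poly R x * y ^ k * exp (- y)" for R k
      using True by (simp add: bump_term_def y_def)
    show ?thesis
      unfolding 2 1 e by (simp add: q power2_eq_square del: poly_pCons) (simp add: algebra_simps)
  qed
  ultimately have "((\<lambda>x. poly P x * (1 / (1 - x\<^sup>2)) ^ n * exp (- (1 / (1 - x\<^sup>2)))) has_real_derivative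
     bump_term (pderiv P * [:1, 0, -1:]\<^sup>2 + smult (2 * real n) ([:0, 1:] * P * [:1, 0, -1:]) - smult 2 ([:0, 1:] * P)) (n + 2) x) (at x)"
    by simp
  then show ?thesis
    by (rule has_field_derivative_transform_within_open[where S = "{-1<..<1}"])
      (use True in \<open>auto simp: bump_term_def\<close>)
next
  case False
  obtain C where C: "\<And>y. \<bar>bump_term P n y\<bar> \<le> C * (1 - y\<^sup>2)\<^sup>2"
    using bump_term_flat by blast
  have "(bump_term P n has_real_derivative 0) (at x)"
  proof (cases "\<bar>x\<bar> = 1")
    case True
    then have x2: "x\<^sup>2 = 1" by (metis one_power2 power2_abs)
    have "((\<lambda>y. (bump_term P n y - bump_term P n x) / (y - x)) \<longlongrightarrow> 0) (at x)"
    proof (rule Lim_null_comparison)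
      show "\<forall>\<^sub>F y in at x. norm ((bump_term P n y - bump_term P n x) / (y - x)) \<le> C * \<bar>y - x\<bar> * (y + x)\<^sup>2"
      proof (rule eventually_at_filter[THEN iffD2], rule always_eventually, intro allI impI)
        fix y :: real assume "y \<noteq> x"
        have "1 - y\<^sup>2 = (x - y) * (x + y)" using x2 by (simp add: power2_eq_square algebra_simps)
        then have "(1 - y\<^sup>2)\<^sup>2 = (y - x)\<^sup>2 * (y + x)\<^sup>2"
          by (simp add: power_mult_distrib power2_commute add.commute)
        then have "\<bar>bump_term P n y\<bar> \<le> C * (y - x)\<^sup>2 * (y + x)\<^sup>2" using C[of y] by simp
        also have "(y - x)\<^sup>2 = \<bar>y - x\<bar> * \<bar>y - x\<bar>" by (simp add: power2_eq_square)
        finally have "\<bar>bump_term P n y\<bar> \<le> (C * \<bar>y - x\<bar> * (y + x)\<^sup>2) * \<bar>y - x\<bar>" by (simp only: mult_ac)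
        moreover have "bump_term P n x = 0" using False by (simp add: bump_term_def)
        ultimately show "norm ((bump_term P n y - bump_term P n x) / (y - x)) \<le> C * \<bar>y - x\<bar> * (y + x)\<^sup>2"
          using \<open>y \<noteq> x\<close> by (simp add: pos_divide_le_eq)
      qed
      have "((\<lambda>y. C * \<bar>y - x\<bar> * (y + x)\<^sup>2) \<longlongrightarrow> C * \<bar>x - x\<bar> * (x + x)\<^sup>2) (at x)"
        by (intro tendsto_intros)
      then show "((\<lambda>y. C * \<bar>y - x\<bar> * (y + x)\<^sup>2) \<longlongrightarrow> 0) (at x)" by simp
    qed
    then show ?thesis by (simp add: has_field_derivative_iff)
  next
    case ne: False
    have "((\<lambda>x. 0 :: real) has_real_derivative 0) (at x)" by simp
    then show ?thesis
      by (rule has_field_derivative_transform_within_open[where S = "{x. \<bar>x\<bar> > 1}"])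
        (use ne False in \<open>auto simp: bump_term_def intro!: open_Collect_less continuous_intros\<close>)
  qed
  then show ?thesis using False by (simp add: bump_term_def)
qed

definition bump :: "real \<Rightarrow> real" where "bump = bump_term 1 0"

lemma smooth_bump: "smooth bump"
proof (rule smooth_coinduct[where F = "{bump_term P n |P n. True}"])
  show "bump \<in> {bump_term P n |P n. True}" unfolding bump_def by blast
  show "\<exists>f'\<in>{bump_term P n |P n. True}. \<forall>x. (f has_real_derivative f' x) (at x)"
    if "f \<in> {bump_term P n |P n. True}" for f
    using that bump_term_has_deriv by blast
qed

lemma bump_nonneg: "bump x \<ge> 0" and bump_outside: "\<bar>x\<bar> \<ge> 1 \<Longrightarrow> bump x = 0" and bump_0: "bump 0 > 0"
  by (auto simp: bump_def bump_term_def)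

section \<open>Test functions determine integrable functions\<close>

lemma integral_eq_0:
  fixes f :: "real \<Rightarrow> real"
  assumes "\<And>x. x \<in> S \<Longrightarrow> f x = 0" shows "integral S f = 0"
  using integral_cong[of S f "\<lambda>_. 0"] assms by simp

text \<open>Because the integrand vanishes to the left, the lower limit may be moved below any given point, so
  the fundamental theorem of calculus holds also at and below \<open>\<alpha>\<close>.\<close>

lemma primitive_has_deriv_within:
  fixes f :: "real \<Rightarrow> real"
  assumes cont: "continuous_on {..b} f" and zero: "\<And>x. x \<le> \<alpha> \<Longrightarrow> f x = 0" and "x \<le> b"
  shows "((\<lambda>x. integral {\<alpha>..x} f) has_real_derivative f x) (at x within {..b})"
proof -
  define c where "c = min \<alpha> x - 1"
  have shift: "integral {\<alpha>..y} f = integral {c..y} f" if "y \<le> b" for y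
  proof (cases "y \<le> \<alpha>")
    case True
    then have "integral {\<alpha>..y} f = 0" "integral {c..y} f = 0"
      by (auto intro!: integral_eq_0 zero)
    then show ?thesis by simp
  next
    case False
    have "f integrable_on {c..y}"
      by (intro integrable_continuous_real continuous_on_subset[OF cont]) (use that in auto)
    then have "integral {c..\<alpha>} f + integral {\<alpha>..y} f = integral {c..y} f"
      by (intro Henstock_Kurzweil_Integration.integral_combine) (use False c_def in auto)
    moreover have "integral {c..\<alpha>} f = 0"
      by (auto intro!: integral_eq_0 zero)
    ultimately show ?thesis by simp
  qed
  have "((\<lambda>x. integral {c..x} f) has_vector_derivative f x) (at x within {c..b})"
    by (intro integral_has_vector_derivative continuous_on_subset[OF cont])
      (use \<open>x \<le> b\<close> c_def in auto)
  moreover have "at x within {c..b} = at x within {..b}"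
    by (rule at_within_nhd[of _ "{c<..}"]) (auto simp: c_def)
  ultimately have "((\<lambda>x. integral {c..x} f) has_real_derivative f x) (at x within {..b})"
    by (simp add: has_real_derivative_iff_has_vector_derivative)
  then show ?thesis
    by (rule has_field_derivative_transform_within[where d = 1]) (use \<open>x \<le> b\<close> shift in auto)
qed

lemma primitive_has_deriv:
  fixes f :: "real \<Rightarrow> real"
  assumes cont: "continuous_on UNIV f" and zero: "\<And>x. x \<le> \<alpha> \<Longrightarrow> f x = 0"
  shows "((\<lambda>x. integral {\<alpha>..x} f) has_real_derivative f x) (at x)"
proof -
  have "((\<lambda>x. integral {\<alpha>..x} f) has_real_derivative f x) (at x within {..x+1})"
    by (intro primitive_has_deriv_within continuous_on_subset[OF cont] zero) auto
  moreover have "at x within {..x+1} = at x"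
    by (rule at_within_interior) (simp add: interior_real_atMost)
  ultimately show ?thesis by simp
qed

text \<open>The normalised primitive of the bump.\<close>

lemma smooth_step:
  obtains \<theta> where "smooth \<theta>" "\<And>x. x \<le> -1 \<Longrightarrow> \<theta> x = 0" "\<And>x. x \<ge> 1 \<Longrightarrow> \<theta> x = 1"
    "\<And>x. 0 \<le> \<theta> x" "\<And>x. \<theta> x \<le> 1"
proof -
  let ?I = "\<lambda>x. integral {-1..x} bump"
  note cb = smooth_continuous[OF smooth_bump]
  have d: "(?I has_real_derivative bump x) (at x)" for x
    by (intro primitive_has_deriv cb) (auto intro: bump_outside)
  have mono: "?I x \<le> ?I y" if "x \<le> y" for x y
    using DERIV_nonneg_imp_nondecreasing[OF that] d bump_nonneg by blast
  have I0: "?I x = 0" if "x \<le> -1" for x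
    using that by (intro integral_eq_0) (auto intro: bump_outside)
  have I1: "?I x = ?I 1" if "x \<ge> 1" for x
  proof -
    have "?I 1 + integral {1..x} bump = ?I x"
      by (intro Henstock_Kurzweil_Integration.integral_combine integrable_continuous_real cb) (use that in auto)
    moreover have "integral {1..x} bump = 0"
      by (intro integral_eq_0) (auto intro: bump_outside)
    ultimately show ?thesis by simp
  qed
  have "?I 1 \<noteq> 0"
  proof
    assume z: "?I 1 = 0"
    have "?I x = 0" for x
      using mono[of "-1" x] I0[of "-1"] I0[of x] mono[of x 1] I1[of x] z by (cases "x \<le> -1"; cases "x \<ge> 1") force+
    then have "((\<lambda>x. 0) has_real_derivative bump 0) (at 0)" using d[of 0] by simp
    then show False using DERIV_unique[of "\<lambda>x. 0" "bump 0" 0 0] bump_0 by auto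
  qed
  then have pos: "?I 1 > 0" using mono[of "-1" 1] I0[of "-1"] by simp
  have dt: "((\<lambda>x. ?I x / ?I 1) has_real_derivative bump x / ?I 1) (at x)" for x
    by (rule DERIV_cdivide[OF d])
  have sm: "smooth (\<lambda>x. bump x / ?I 1)"
    using smooth_combination[OF smooth_bump smooth_bump, of "1 / ?I 1" 0] by simp
  show ?thesis
  proof (rule that[of "\<lambda>x. ?I x / ?I 1"])
    show "smooth (\<lambda>x. ?I x / ?I 1)" by (rule smooth_primitive[OF sm dt])
    show "?I x / ?I 1 \<ge> 0" for x
      using mono[of "-1" x] I0[of "-1"] I0[of x] pos by (cases "x \<ge> -1") auto
    show "?I x / ?I 1 \<le> 1" for x
      using mono[of x 1] I1[of x] pos by (cases "x \<le> 1") auto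
    show "?I x / ?I 1 = 0" if "x \<le> -1" for x using I0[OF that] by simp
    show "?I x / ?I 1 = 1" if "x \<ge> 1" for x using I1[OF that] pos by simp
  qed
qed

lemma test_fun_Ioo_iff:
  "test_fun {\<alpha><..<\<beta>} \<phi> \<longleftrightarrow>
     smooth \<phi> \<and> (\<exists>c d. \<alpha> < c \<and> c < d \<and> d < \<beta> \<and> (\<forall>x. x \<notin> {c..d} \<longrightarrow> \<phi> x = 0))" if "\<alpha> < \<beta>"
proof
  assume t: "test_fun {\<alpha><..<\<beta>} \<phi>"
  let ?K = "closure {x. \<phi> x \<noteq> 0}"
  have sm: "smooth \<phi>" and K: "compact ?K" "?K \<subseteq> {\<alpha><..<\<beta>}"
    using t by (auto simp: test_fun_def smooth_def)
  show "smooth \<phi> \<and> (\<exists>c d. \<alpha> < c \<and> c < d \<and> d < \<beta> \<and> (\<forall>x. x \<notin> {c..d} \<longrightarrow> \<phi> x = 0))"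
  proof (cases "?K = {}")
    case True
    then have "\<phi> x = 0" for x using closure_subset[of "{x. \<phi> x \<noteq> 0}"] by blast
    moreover obtain c d where "\<alpha> < c" "c < d" "d < \<beta>" using \<open>\<alpha> < \<beta>\<close> dense by meson
    ultimately show ?thesis using sm by blast
  next
    case False
    obtain c where c: "c \<in> ?K" "\<And>x. x \<in> ?K \<Longrightarrow> c \<le> x" using compact_attains_inf[OF K(1) False] by blast
    obtain d where d: "d \<in> ?K" "\<And>x. x \<in> ?K \<Longrightarrow> x \<le> d" using compact_attains_sup[OF K(1) False] by blast
    have "d < \<beta>" using K(2) d(1) by force
    then obtain d' where d': "d < d'" "d' < \<beta>" using dense by blast
    have "\<phi> x = 0" if "x \<notin> {c..d'}" for x
    proof (rule ccontr)
      assume "\<phi> x \<noteq> 0"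
      then have "x \<in> ?K" using closure_subset[of "{x. \<phi> x \<noteq> 0}"] by blast
      then show False using c(2) d(2) d' that by force
    qed
    moreover have "\<alpha> < c" "c < d'" using K(2) c d d' by force+
    ultimately show ?thesis using sm d' by blast
  qed
next
  assume "smooth \<phi> \<and> (\<exists>c d. \<alpha> < c \<and> c < d \<and> d < \<beta> \<and> (\<forall>x. x \<notin> {c..d} \<longrightarrow> \<phi> x = 0))"
  then obtain c d where sm: "smooth \<phi>" and cd: "\<alpha> < c" "c < d" "d < \<beta>" "\<And>x. x \<notin> {c..d} \<Longrightarrow> \<phi> x = 0" by blast
  have sub: "closure {x. \<phi> x \<noteq> 0} \<subseteq> {c..d}"
    by (rule closure_minimal) (use cd(4) in force)+
  then have "compact (closure {x. \<phi> x \<noteq> 0})"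
    by (meson bounded_closed_interval bounded_subset closed_closure compact_eq_bounded_closed)
  then show "test_fun {\<alpha><..<\<beta>} \<phi>"
    using sub sm cd by (auto simp: test_fun_def smooth_def)
qed

lemma deriv_eq_0_outside:
  fixes \<phi> :: "real \<Rightarrow> real"
  assumes "\<And>x. x \<notin> {c..d} \<Longrightarrow> \<phi> x = 0" "x \<notin> {c..d}"
  shows "deriv \<phi> x = 0"
proof -
  have "((\<lambda>_. 0) has_real_derivative 0) (at x)" by simp
  then have "(\<phi> has_real_derivative 0) (at x)"
    by (rule has_field_derivative_transform_within_open[where S = "- {c..d}"])
      (use assms in \<open>auto simp: open_Compl\<close>)
  then show ?thesis by (rule DERIV_imp_deriv)
qed

lemma test_fun_deriv: "test_fun {\<alpha><..<\<beta>} \<phi> \<Longrightarrow> \<alpha> < \<beta> \<Longrightarrow> test_fun {\<alpha><..<\<beta>} (deriv \<phi>)"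
  using smooth_deriv deriv_eq_0_outside unfolding test_fun_Ioo_iff by metis

lemma integrable_compact_support:
  fixes f :: "real \<Rightarrow> real"
  assumes "continuous_on UNIV f" "\<And>x. x \<notin> {c..d} \<Longrightarrow> f x = 0"
  shows "integrable lborel f"
proof -
  have "integrable lborel (\<lambda>x. indicator {c..d} x *\<^sub>R f x)"
    by (intro borel_integrable_compact continuous_on_subset[OF assms(1)]) auto
  moreover have "(\<lambda>x. indicator {c..d} x *\<^sub>R f x) = f"
    using assms(2) by (auto simp: indicator_def fun_eq_iff)
  ultimately show ?thesis by simp
qed

lemma integrable_mult_bounded:
  fixes f g :: "'a \<Rightarrow> real"
  assumes "integrable M f" "g \<in> borel_measurable M" "\<And>x. \<bar>g x\<bar> \<le> B"
  shows "integrable M (\<lambda>x. f x * g x)"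
proof (rule Bochner_Integration.integrable_bound)
  show "integrable M (\<lambda>x. B * f x)" using assms(1) by simp
  show "AE x in M. norm (f x * g x) \<le> norm (B * f x)"
  proof (rule AE_I2)
    fix x
    have "\<bar>g x\<bar> \<le> \<bar>B\<bar>" using assms(3)[of x] by linarith
    then show "norm (f x * g x) \<le> norm (B * f x)" by (simp add: abs_mult mult.commute[of "\<bar>f x\<bar>"] mult_right_mono)
  qed
qed (use assms in auto)

text \<open>Differences of two rescaled smooth steps converge pointwise to the indicator of \<open>(a, \<beta>)\<close>, so by
  dominated convergence the integral of \<open>f\<close> over every such tail vanishes. The positive and the
  negative part of \<open>f\<close> then define the same measure.\<close>

lemma du_Bois_Reymond:
  fixes f :: "real \<Rightarrow> real"
  assumes "\<alpha> < \<beta>" and int: "integrable lborel f" and supp: "\<And>x. x \<notin> {\<alpha><..<\<beta>} \<Longrightarrow> f x = 0"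
    and orth: "\<And>\<phi>. test_fun {\<alpha><..<\<beta>} \<phi> \<Longrightarrow> (LINT x|lborel. f x * \<phi> x) = 0"
  shows "AE x in lborel. f x = 0"
proof -
  obtain \<theta> where \<theta>: "smooth \<theta>" "\<And>x. x \<le> -1 \<Longrightarrow> \<theta> x = 0" "\<And>x. x \<ge> 1 \<Longrightarrow> \<theta> x = 1"
    "\<And>x. 0 \<le> \<theta> x" "\<And>x. \<theta> x \<le> 1" using smooth_step by metis
  have fm[measurable]: "f \<in> borel_measurable borel" using int by auto
  have tail: "(LINT x|lborel. f x * indicator {a<..} x) = 0" if a: "\<alpha> \<le> a" "a < \<beta>" for a
  proof -
    define \<phi> where "\<phi> n x = \<theta> (real n * (x - a) - 2) - \<theta> (real n * (x - \<beta>) + 2)" for n :: nat and x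
    have cphi: "continuous_on UNIV (\<phi> n)" for n
      unfolding \<phi>_def
      by (intro continuous_intros continuous_on_compose2[OF smooth_continuous[OF \<theta>(1)]]) auto
    have pm[measurable]: "\<phi> n \<in> borel_measurable borel" for n
      by (rule borel_measurable_continuous_onI[OF cphi])
    \<comment> \<open>For these \<open>n\<close> both steps fit between \<open>a + 1/n\<close> and \<open>\<beta> - 1/n\<close>, so \<open>\<phi> n\<close> is a test function.\<close>
    have "\<forall>\<^sub>F n :: nat in sequentially. 5 / (\<beta> - a) \<le> real n"
      using filterlim_real_sequentially by (simp add: filterlim_at_top)
    then obtain n0 :: nat where n0: "\<And>n. n \<ge> n0 \<Longrightarrow> 5 / (\<beta> - a) \<le> real n"
      by (auto simp: eventually_sequentially)
    have test: "test_fun {\<alpha><..<\<beta>} (\<phi> n)" if "n \<ge> n0" for n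
    proof -
      have n: "real n * (\<beta> - a) \<ge> 5" using n0[OF that] a by (simp add: field_simps)
      then have np: "real n > 0" by (cases "n = 0") auto
      have "smooth (\<lambda>x. \<theta> (real n * x + (- real n * a - 2)))" "smooth (\<lambda>x. \<theta> (real n * x + (- real n * \<beta> + 2)))"
        by (intro smooth_affine \<theta>(1))+
      from smooth_combination[OF this, of 1 "-1"] have "smooth (\<phi> n)"
        by (simp add: \<phi>_def[abs_def] algebra_simps)
      moreover have "\<phi> n x = 0" if "x \<notin> {a + 1 / n .. \<beta> - 1 / n}" for x
      proof -
        have "x < a + 1 / n \<or> x > \<beta> - 1 / n" using that by (simp add: not_le)
        then consider "x < a + 1 / n" | "x > \<beta> - 1 / n" by blast
        then show ?thesis
        proof cases
          case 1
          then have "real n * (x - a) < 1" using np by (simp add: field_simps)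
          moreover have "real n * (x - \<beta>) = real n * (x - a) - real n * (\<beta> - a)" by (simp add: algebra_simps)
          ultimately show ?thesis using n by (simp add: \<phi>_def \<theta>(2))
        next
          case 2
          then have "real n * (x - \<beta>) > -1" using np by (simp add: field_simps)
          moreover have "real n * (x - \<beta>) = real n * (x - a) - real n * (\<beta> - a)" by (simp add: algebra_simps)
          ultimately show ?thesis using n by (simp add: \<phi>_def \<theta>(3))
        qed
      qed
      moreover have "a + 1 / n < \<beta> - 1 / n"
      proof -
        have "\<beta> - a \<ge> 5 / real n" using n np by (simp add: pos_divide_le_eq mult.commute)
        moreover have "1 / real n > 0" using np by simp
        ultimately show ?thesis by linarith
      qed
      moreover have "\<alpha> < a + 1 / n" "\<beta> - 1 / n < \<beta>"
        using \<open>\<alpha> \<le> a\<close> np divide_pos_pos[of 1 "real n"] by linarith+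
      ultimately show ?thesis
        unfolding test_fun_Ioo_iff[OF \<open>\<alpha> < \<beta>\<close>] by blast
    qed
    have lim: "(\<lambda>n. f x * \<phi> n x) \<longlonglongrightarrow> f x * indicator {a<..} x" for x
    proof (cases "x \<in> {\<alpha><..<\<beta>}")
      case True
      have "\<forall>\<^sub>F n :: nat in sequentially. 3 / (\<beta> - x) \<le> real n"
        using filterlim_real_sequentially by (simp add: filterlim_at_top)
      then have e1: "\<forall>\<^sub>F n in sequentially. \<theta> (real n * (x - \<beta>) + 2) = 0"
      proof eventually_elim
        case (elim n)
        then have "real n * (\<beta> - x) \<ge> 3" using True by (simp add: field_simps)
        then show ?case by (intro \<theta>(2)) (simp add: algebra_simps)
      qed
      have e2: "\<forall>\<^sub>F n in sequentially. \<theta> (real n * (x - a) - 2) = indicator {a<..} x"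
      proof (cases "x > a")
        case True
        have "\<forall>\<^sub>F n :: nat in sequentially. 3 / (x - a) \<le> real n"
          using filterlim_real_sequentially by (simp add: filterlim_at_top)
        then show ?thesis
        proof eventually_elim
          case (elim n)
          then have "real n * (x - a) \<ge> 3" using True by (simp add: field_simps)
          then show ?case using True by (simp add: \<theta>(3))
        qed
      next
        case False
        then have "real n * (x - a) \<le> 0" for n by (simp add: mult_nonneg_nonpos)
        then have "\<theta> (real n * (x - a) - 2) = 0" for n by (intro \<theta>(2)) (smt (verit))
        then show ?thesis using False by simp
      qed
      show ?thesis
        by (rule tendsto_eventually) (use e1 e2 in eventually_elim, simp add: \<phi>_def)
    qed (use supp in simp)
    have "(\<lambda>n. LINT x|lborel. f x * \<phi> n x) \<longlonglongrightarrow> (LINT x|lborel. f x * indicator {a<..} x)"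
    proof (rule integral_dominated_convergence[where w = "\<lambda>x. \<bar>f x\<bar>"])
      show "AE x in lborel. norm (f x * \<phi> n x) \<le> \<bar>f x\<bar>" for n
      proof (rule AE_I2)
        fix x
        have "\<bar>\<phi> n x\<bar> \<le> 1" unfolding \<phi>_def using \<theta>(4,5)[of "real n * (x - a) - 2"] \<theta>(4,5)[of "real n * (x - \<beta>) + 2"] by linarith
        then show "norm (f x * \<phi> n x) \<le> \<bar>f x\<bar>" by (simp add: abs_mult mult_left_le)
      qed
    qed (use int lim in auto)
    moreover have "(\<lambda>n. LINT x|lborel. f x * \<phi> n x) \<longlonglongrightarrow> 0"
      by (rule tendsto_eventually) (use test orth in \<open>auto simp: eventually_sequentially\<close>)
    ultimately show ?thesis by (rule LIMSEQ_unique)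
  qed
  have tails: "(LINT x|lborel. f x * indicator {a<..} x) = 0" for a
  proof -
    consider "a < \<alpha>" | "\<alpha> \<le> a" "a < \<beta>" | "\<beta> \<le> a" by linarith
    then show ?thesis
    proof cases
      case 1
      then have e: "(\<lambda>x. f x * indicator {a<..} x) = (\<lambda>x. f x * indicator {\<alpha><..} x)"
        using supp by (fastforce simp: indicator_def)
      show ?thesis unfolding e by (rule tail) (use \<open>\<alpha> < \<beta>\<close> in auto)
    next
      case 3
      then have e: "(\<lambda>x. f x * indicator {a<..} x) = (\<lambda>_. 0)"
        using supp by (fastforce simp: indicator_def)
      show ?thesis unfolding e by simp
    qed (rule tail)
  qed
  have fin: "(\<integral>\<^sup>+x\<in>A. ennreal (f x) \<partial>lborel) < \<infinity>" "(\<integral>\<^sup>+x\<in>A. ennreal (- f x) \<partial>lborel) < \<infinity>" for A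
  proof -
    have b: "(\<integral>\<^sup>+x. ennreal \<bar>f x\<bar> \<partial>lborel) < \<infinity>" using int by (simp add: integrable_iff_bounded)
    show "(\<integral>\<^sup>+x\<in>A. ennreal (f x) \<partial>lborel) < \<infinity>"
      by (rule le_less_trans[OF nn_integral_mono b]) (auto simp: indicator_def intro: ennreal_leI)
    show "(\<integral>\<^sup>+x\<in>A. ennreal (- f x) \<partial>lborel) < \<infinity>"
      by (rule le_less_trans[OF nn_integral_mono b]) (auto simp: indicator_def intro: ennreal_leI)
  qed
  have "density lborel (\<lambda>x. ennreal (f x)) = density lborel (\<lambda>x. ennreal (- f x))"
  proof (rule measure_eqI_lessThan)
    fix a :: real
    let ?g = "\<lambda>x. f x * indicator {a<..} x"
    have ig: "integrable lborel ?g" using int integrable_real_mult_indicator[of "{a<..}" lborel f] by simp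
    have e: "(\<integral>\<^sup>+x. ennreal (?g x) \<partial>lborel) = (\<integral>\<^sup>+x\<in>{a<..}. ennreal (f x) \<partial>lborel)"
      "(\<integral>\<^sup>+x. ennreal (- ?g x) \<partial>lborel) = (\<integral>\<^sup>+x\<in>{a<..}. ennreal (- f x) \<partial>lborel)"
      by (auto intro!: nn_integral_cong simp: indicator_def)
    have "enn2real (\<integral>\<^sup>+x\<in>{a<..}. ennreal (f x) \<partial>lborel) = enn2real (\<integral>\<^sup>+x\<in>{a<..}. ennreal (- f x) \<partial>lborel)"
      using real_lebesgue_integral_def[OF ig] tails[of a] e by simp
    then have "(\<integral>\<^sup>+x\<in>{a<..}. ennreal (f x) \<partial>lborel) = (\<integral>\<^sup>+x\<in>{a<..}. ennreal (- f x) \<partial>lborel)"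
      using fin[of "{a<..}"] by (metis ennreal_enn2real infinity_ennreal_def)
    then show "emeasure (density lborel (\<lambda>x. ennreal (f x))) {a<..} = emeasure (density lborel (\<lambda>x. ennreal (- f x))) {a<..}"
      by (simp add: emeasure_density)
    show "emeasure (density lborel (\<lambda>x. ennreal (f x))) {a<..} < \<infinity>"
      using fin[of "{a<..}"] by (simp add: emeasure_density)
  qed auto
  then have "AE x in lborel. ennreal (f x) = ennreal (- f x)"
    by (intro sigma_finite_measure.density_unique[OF sigma_finite_lborel]) auto
  then show ?thesis
  proof eventually_elim
    case (elim x)
    show ?case
    proof (cases "f x \<ge> 0")
      case True
      then have "ennreal (- f x) = 0" by (intro ennreal_neg) simp
      with elim have "ennreal (f x) = 0" by (rule trans)
      with True show ?thesis by simp
    next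
      case False
      then have "ennreal (f x) = 0" by (intro ennreal_neg) simp
      with elim have "ennreal (- f x) = 0" by (rule trans[OF sym])
      with False show ?thesis by simp
    qed
  qed
qed

section \<open>Primitives of integrable functions\<close>

text \<open>Fubini's theorem is applied to Borel functions on the line, while the function spaces consist of
  Lebesgue measurable functions on an interval. Changing a function on a null set and extending it by
  zero connects the two.\<close>

lemma borel_representative:
  fixes f :: "real \<Rightarrow> real"
  assumes S: "S \<in> sets borel" and f: "integrable (lebesgue_on S) f"
  obtains f' where "integrable lborel f'" "\<And>x. x \<notin> S \<Longrightarrow> f' x = 0" "AE x in lebesgue_on S. f x = f' x"
proof -
  have S': "S \<in> sets lebesgue" using S by auto
  have int: "integrable lebesgue (\<lambda>x. indicator S x * f x)"
    using f S' by (simp add: integrable_restrict_space)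
  then obtain g where g[measurable]: "g \<in> borel_measurable lborel" and ae: "AE x in lborel. indicator S x * f x = g x"
    using completion_ex_borel_measurable_real[of "\<lambda>x. indicator S x * f x" lborel] by auto
  have ae': "AE x in lebesgue. indicator S x * f x = g x" using ae by (rule AE_completion)
  have "integrable lebesgue g"
    using int by (rule integrable_cong_AE_imp) (use ae' in \<open>auto simp: eq_commute measurable_completion\<close>)
  then have g_int: "integrable lborel g" using integrable_completion[of g lborel] by simp
  show ?thesis
  proof (rule that[of "\<lambda>x. g x * indicator S x"])
    show "integrable lborel (\<lambda>x. g x * indicator S x)"
      using g_int S by (intro integrable_real_mult_indicator) auto
    show "AE x in lebesgue_on S. f x = g x * indicator S x"
      unfolding AE_restrict_space_iff[of S lebesgue, simplified, OF S']
      using ae' by eventually_elim auto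
  qed auto
qed

lemma integral_lebesgue_on_eq_lborel:
  fixes F G :: "real \<Rightarrow> real"
  assumes S: "S \<in> sets borel" and F: "F \<in> borel_measurable borel" "\<And>x. x \<notin> S \<Longrightarrow> F x = 0"
    and G: "G \<in> borel_measurable (lebesgue_on S)" and ae: "AE x in lebesgue_on S. G x = F x"
  shows "(LINT x|lebesgue_on S. G x) = (LINT x|lborel. F x)"
proof -
  have S': "S \<in> sets lebesgue" using S by auto
  have "(LINT x|lebesgue_on S. G x) = (LINT x|lebesgue_on S. F x)"
    by (rule integral_cong_AE) (use F G ae in \<open>auto intro!: measurable_restrict_space1 measurable_completion[of F lborel borel]\<close>)
  also have "\<dots> = (LINT x|lebesgue. indicator S x *\<^sub>R F x)"
    by (rule integral_restrict_space) (use S' in auto)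
  also have "(\<lambda>x. indicator S x *\<^sub>R F x) = F" using F(2) by (auto simp: indicator_def fun_eq_iff)
  also have "integral\<^sup>L lebesgue F = integral\<^sup>L lborel F"
    by (rule integral_completion) (use F in auto)
  finally show ?thesis .
qed

text \<open>The relation ``\<open>g\<close> is the weak derivative of \<open>h\<close> on \<open>(\<alpha>, \<beta>)\<close>'' for integrable Borel representatives
  that vanish outside the interval.\<close>

definition weak_pair :: "real \<Rightarrow> real \<Rightarrow> (real \<Rightarrow> real) \<Rightarrow> (real \<Rightarrow> real) \<Rightarrow> bool" where
  "weak_pair \<alpha> \<beta> h g \<longleftrightarrow> integrable lborel h \<and> integrable lborel g \<and>
     (\<forall>x. x \<notin> {\<alpha><..<\<beta>} \<longrightarrow> h x = 0 \<and> g x = 0) \<and>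
     (\<forall>\<phi>. test_fun {\<alpha><..<\<beta>} \<phi> \<longrightarrow> (LINT x|lborel. h x * deriv \<phi> x) = - (LINT x|lborel. g x * \<phi> x))"

definition primitive :: "(real \<Rightarrow> real) \<Rightarrow> real \<Rightarrow> real" where
  "primitive f x = (LINT y|lborel. f y * indicator {..x} y)"

lemma primitive_eq_integral:
  assumes "integrable lborel f" "\<And>x. x \<le> \<alpha> \<Longrightarrow> f x = 0"
  shows "primitive f x = integral {\<alpha>..x} f" and "f integrable_on {\<alpha>..x}"
proof -
  have s: "set_integrable lborel {\<alpha>..x} f"
    using assms(1) unfolding set_integrable_def by (intro integrable_mult_indicator) auto
  have "(\<lambda>y. f y * indicator {..x} y) = (\<lambda>y. indicator {\<alpha>..x} y *\<^sub>R f y)"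
    using assms(2) by (auto simp: fun_eq_iff indicator_def)
  then show "primitive f x = integral {\<alpha>..x} f"
    using set_borel_integral_eq_integral(2)[OF s] by (simp add: primitive_def set_lebesgue_integral_def)
  show "f integrable_on {\<alpha>..x}" by (rule set_borel_integral_eq_integral(1)[OF s])
qed

lemma primitive_continuous:
  assumes "integrable lborel f" "\<And>x. x \<le> \<alpha> \<Longrightarrow> f x = 0"
  shows "continuous_on UNIV (primitive f)"
proof -
  have *: "continuous_on {\<alpha>..b} (primitive f)" for b
    using indefinite_integral_continuous_1[OF primitive_eq_integral(2)[of f \<alpha>, OF assms], of b]
    by (simp add: primitive_eq_integral(1)[of f \<alpha>, OF assms])
  have z: "primitive f x = 0" if "x \<le> \<alpha>" for x
  proof -
    have "primitive f x = integral {\<alpha>..x} f" using primitive_eq_integral(1)[of f \<alpha> x] assms by blast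
    also have "\<dots> = 0" using that assms(2) by (intro integral_eq_0) auto
    finally show ?thesis .
  qed
  have "continuous_on {..b} (primitive f)" for b
  proof -
    have "continuous_on ({..\<alpha>} \<union> {\<alpha>..max \<alpha> b}) (primitive f)"
    proof (rule continuous_on_closed_Un)
      have "continuous_on {..\<alpha>} (\<lambda>_. 0 :: real)" by simp
      then show "continuous_on {..\<alpha>} (primitive f)" by (rule continuous_on_eq) (use z in auto)
    qed (use * in auto)
    then show ?thesis by (rule continuous_on_subset) auto
  qed
  then have "continuous_on {..<b} (primitive f)" for b by (rule continuous_on_subset[of "{..b}"]) auto
  then have "continuous_on (\<Union>b\<in>UNIV. {..<b}) (primitive f)"
    by (intro continuous_on_open_UN) auto
  moreover have "(\<Union>b\<in>UNIV. {..<b}) = (UNIV :: real set)"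
    using gt_ex by auto
  ultimately show ?thesis by simp
qed

lemma primitive_bounded: "integrable lborel f \<Longrightarrow> \<bar>primitive f x\<bar> \<le> (LINT y|lborel. \<bar>f y\<bar>)"
  unfolding primitive_def
  by (rule order_trans[OF integral_abs_bound])
    (auto intro!: integral_mono integrable_abs integrable_real_mult_indicator mult_left_le simp: abs_mult)

text \<open>Integration by parts for absolutely continuous functions. The two integrals on the left are double
  integrals over complementary halves of the plane, so by Fubini's theorem they add up to the full product integral;
  no derivative at a point is ever taken.\<close>

lemma primitive_parts:
  assumes f: "integrable lborel f" and g: "integrable lborel g"
    and mf: "primitive f \<in> borel_measurable borel" and mg: "primitive g \<in> borel_measurable borel"
  shows "(LINT x|lborel. f x * primitive g x) + (LINT x|lborel. g x * primitive f x)
       = (LINT x|lborel. f x) * (LINT x|lborel. g x)"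
proof -
  have [measurable]: "f \<in> borel_measurable borel" "g \<in> borel_measurable borel" using f g by auto
  define k where "k x y = f x * (g y * indicator {..x} y)" for x y
  have kx: "(LINT y|lborel. k x y) = f x * primitive g x" for x
    unfolding k_def primitive_def by simp
  have ky: "(LINT x|lborel. k x y) = g y * ((LINT x|lborel. f x) - primitive f y)" for y
  proof -
    have k': "k x y = f x * (g y * indicator {y..} x)" for x
      by (auto simp: k_def indicator_def)
    have "AE x in lborel. k x y = g y * (f x - f x * indicator {..y} x)"
      using AE_lborel_singleton[of y] by eventually_elim (auto simp: k_def indicator_def)
    then have "(LINT x|lborel. k x y) = (LINT x|lborel. g y * (f x - f x * indicator {..y} x))"
      unfolding k' by (intro integral_cong_AE) auto
    also have "\<dots> = g y * ((LINT x|lborel. f x) - primitive f y)"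
      using f unfolding primitive_def by (simp add: integrable_real_mult_indicator Bochner_Integration.integral_diff)
    finally show ?thesis .
  qed
  have "integrable (lborel \<Otimes>\<^sub>M lborel) (case_prod k)"
  proof (rule lborel_pair.Fubini_integrable)
    have "{p :: real \<times> real. snd p \<le> fst p} \<in> sets borel"
      by (intro borel_closed closed_Collect_le continuous_intros)
    moreover have "sets (lborel \<Otimes>\<^sub>M lborel) = sets (borel \<Otimes>\<^sub>M borel :: (real \<times> real) measure)"
      by (intro sets_pair_measure_cong) auto
    ultimately have "{p :: real \<times> real. snd p \<le> fst p} \<in> sets (lborel \<Otimes>\<^sub>M lborel)"
      unfolding borel_prod by simp
    then have [measurable]: "Measurable.pred (lborel \<Otimes>\<^sub>M lborel) (\<lambda>p :: real \<times> real. snd p \<le> fst p)"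
      by (simp add: pred_def space_pair_measure)
    have "case_prod k = (\<lambda>p. f (fst p) * (g (snd p) * (if snd p \<le> fst p then 1 else 0)))"
      by (auto simp: k_def indicator_def fun_eq_iff)
    then show "case_prod k \<in> borel_measurable (lborel \<Otimes>\<^sub>M lborel)" by simp
    show "AE x in lborel. integrable lborel (\<lambda>y. case (x, y) of (x, y) \<Rightarrow> k x y)"
      unfolding k_def using g by (auto intro!: AE_I2 integrable_mult_right integrable_real_mult_indicator)
    have ag: "integrable lborel (\<lambda>x. \<bar>g x\<bar>)" using g by simp
    have "(LINT y|lborel. norm (k x y)) = \<bar>f x\<bar> * primitive (\<lambda>y. \<bar>g y\<bar>) x" for x
      unfolding k_def primitive_def by (simp add: abs_mult)
    moreover have "integrable lborel (\<lambda>x. \<bar>f x\<bar> * primitive (\<lambda>y. \<bar>g y\<bar>) x)"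
    proof (rule integrable_mult_bounded)
      have "primitive (\<lambda>y. \<bar>g y\<bar>) = (\<lambda>x. LINT y|lborel. \<bar>g y\<bar> * (if y \<le> x then 1 else 0))"
        by (auto simp: primitive_def fun_eq_iff indicator_def intro!: Bochner_Integration.integral_cong)
      also have "\<dots> \<in> borel_measurable lborel"
      proof (rule lborel.borel_measurable_lebesgue_integral)
        have "(\<lambda>p. \<bar>g (snd p)\<bar> * (if snd p \<le> fst p then 1 else 0)) \<in> borel_measurable (lborel \<Otimes>\<^sub>M lborel)"
          by simp
        then show "(\<lambda>(x, y). \<bar>g y\<bar> * (if y \<le> x then 1 else 0)) \<in> borel_measurable (lborel \<Otimes>\<^sub>M lborel)"
          by (simp add: case_prod_beta')
      qed
      finally show "primitive (\<lambda>y. \<bar>g y\<bar>) \<in> borel_measurable lborel" .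
    qed (use f primitive_bounded[OF ag] in auto)
    ultimately show "integrable lborel (\<lambda>x. LINT y|lborel. norm (case (x, y) of (x, y) \<Rightarrow> k x y))" by simp
  qed
  from lborel_pair.Fubini_integral[OF this]
  have "(LINT y|lborel. g y * ((LINT x|lborel. f x) - primitive f y)) = (LINT x|lborel. f x * primitive g x)"
    unfolding kx ky .
  moreover have "(LINT y|lborel. g y * ((LINT x|lborel. f x) - primitive f y))
      = (LINT y|lborel. g y) * (LINT x|lborel. f x) - (LINT y|lborel. g y * primitive f y)"
  proof -
    have "integrable lborel (\<lambda>y. g y * primitive f y)"
      by (rule integrable_mult_bounded[OF g]) (use mf primitive_bounded[OF f] in auto)
    then show ?thesis using g by (simp add: right_diff_distrib Bochner_Integration.integral_diff)
  qed
  ultimately show ?thesis by (simp add: mult.commute)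
qed

text \<open>The mean value zero is what makes the primitive vanish again to the right of the support.\<close>

lemma test_fun_primitive:
  assumes "\<alpha> < \<beta>" "test_fun {\<alpha><..<\<beta>} \<phi>" "(LINT x|lborel. \<phi> x) = 0"
  shows "test_fun {\<alpha><..<\<beta>} (primitive \<phi>)" and "deriv (primitive \<phi>) = \<phi>"
proof -
  obtain c d where sm: "smooth \<phi>" and cd: "\<alpha> < c" "c < d" "d < \<beta>" "\<And>x. x \<notin> {c..d} \<Longrightarrow> \<phi> x = 0"
    using assms test_fun_Ioo_iff by metis
  note cont = smooth_continuous[OF sm]
  have int: "integrable lborel \<phi>" by (rule integrable_compact_support[OF cont cd(4)])
  have c0: "\<phi> x = 0" if "x \<le> \<alpha>" for x using cd that by auto
  have d: "(primitive \<phi> has_real_derivative \<phi> x) (at x)" for x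
  proof -
    have "primitive \<phi> = (\<lambda>x. integral {\<alpha>..x} \<phi>)"
      using primitive_eq_integral(1)[of \<phi> \<alpha>, OF int c0] by blast
    then show ?thesis using primitive_has_deriv[of \<phi> \<alpha>, OF cont c0] by simp
  qed
  then show "deriv (primitive \<phi>) = \<phi>" by (intro ext DERIV_imp_deriv)
  have "primitive \<phi> x = 0" if "x \<notin> {c..d}" for x
  proof -
    have "x < c \<or> x > d" using that by auto
    then consider "x < c" | "x > d" by blast
    then show ?thesis
    proof cases
      case 1
      have "(\<lambda>y. \<phi> y * indicator {..x} y) = (\<lambda>_. 0)"
        using cd(4) 1 by (auto simp: fun_eq_iff indicator_def)
      then show ?thesis by (simp add: primitive_def)
    next
      case 2
      have "(\<lambda>y. \<phi> y * indicator {..x} y) = \<phi>"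
        using cd(4) 2 by (auto simp: fun_eq_iff indicator_def)
      then show ?thesis using assms(3) by (simp add: primitive_def)
    qed
  qed
  then show "test_fun {\<alpha><..<\<beta>} (primitive \<phi>)"
    using smooth_primitive[OF sm d] cd unfolding test_fun_Ioo_iff[OF assms(1)] by blast
qed

lemma primitive_deriv_test_fun:
  assumes "\<alpha> < \<beta>" "test_fun {\<alpha><..<\<beta>} \<phi>"
  shows "primitive (deriv \<phi>) = \<phi>" and "integrable lborel (deriv \<phi>)" and "integrable lborel \<phi>"
    and "(LINT x|lborel. deriv \<phi> x) = 0"
proof -
  obtain c d where sm: "smooth \<phi>" and cd: "\<alpha> < c" "c < d" "d < \<beta>" "\<And>x. x \<notin> {c..d} \<Longrightarrow> \<phi> x = 0"
    using assms test_fun_Ioo_iff by metis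
  have cd': "deriv \<phi> x = 0" if "x \<notin> {c..d}" for x by (rule deriv_eq_0_outside[OF _ that]) (rule cd(4))
  note cont = smooth_continuous[OF sm] smooth_continuous[OF smooth_deriv[OF sm]]
  show "integrable lborel \<phi>" by (rule integrable_compact_support[OF cont(1) cd(4)])
  show i: "integrable lborel (deriv \<phi>)" by (rule integrable_compact_support[OF cont(2) cd'])
  have *: "(LINT y|lborel. deriv \<phi> y * indicator {c - 1..x} y) = \<phi> x" if "x \<ge> c - 1" for x
  proof -
    have "(LINT y|lborel. deriv \<phi> y * indicator {c - 1..x} y) = \<phi> x - \<phi> (c - 1)"
      using that cont(2)[of UNIV]
      by (intro integral_FTC_Icc_real smooth_has_deriv[OF sm]) (auto simp: continuous_on_eq_continuous_at)
    then show ?thesis using cd(4)[of "c - 1"] by simp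
  qed
  show "primitive (deriv \<phi>) = \<phi>"
  proof
    fix x
    have "(\<lambda>y. deriv \<phi> y * indicator {..x} y) = (\<lambda>y. deriv \<phi> y * indicator {c-1..x} y)"
      using cd' by (auto simp: indicator_def fun_eq_iff)
    then have e: "primitive (deriv \<phi>) x = (LINT y|lborel. deriv \<phi> y * indicator {c - 1..x} y)"
      by (simp add: primitive_def)
    show "primitive (deriv \<phi>) x = \<phi> x"
    proof (cases "x \<ge> c - 1")
      case False
      then show ?thesis using e cd(4)[of x] by simp
    qed (simp add: e *)
  qed
  have "(\<lambda>y. deriv \<phi> y * indicator {c - 1..d+1} y) = deriv \<phi>"
    using cd' by (force simp: fun_eq_iff indicator_def)
  then show "(LINT x|lborel. deriv \<phi> x) = 0" using *[of "d+1"] cd by simp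
qed

lemma exists_test_fun_integral_1:
  assumes "\<alpha> < \<beta>"
  obtains \<psi> where "test_fun {\<alpha><..<\<beta>} \<psi>" "(LINT x|lborel. \<psi> x) = 1"
proof -
  obtain \<theta> where \<theta>: "smooth \<theta>" "\<And>x. x \<le> -1 \<Longrightarrow> \<theta> x = 0" "\<And>x. x \<ge> 1 \<Longrightarrow> \<theta> x = 1"
    using smooth_step by metis
  define m s where "m = (\<alpha> + \<beta>) / 2" and "s = 4 / (\<beta> - \<alpha>)"
  define \<Theta> where "\<Theta> x = \<theta> (s * x + (- s * m))" for x
  have s: "s > 0" using assms by (simp add: s_def)
  define c d where "c = m - 1 / s" and "d = m + 1 / s"
  have inv: "1 / s = (\<beta> - \<alpha>) / 4" by (simp add: s_def)
  have cd: "\<alpha> < c" "c < d" "d < \<beta>" unfolding c_def d_def inv m_def using assms by (auto simp: field_simps)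
  have sm: "smooth \<Theta>" unfolding \<Theta>_def by (rule smooth_affine[OF \<theta>(1)])
  have lo: "\<Theta> x = 0" if "x \<le> c" for x
    using that s unfolding \<Theta>_def c_def by (intro \<theta>(2)) (simp add: field_simps)
  have hi: "\<Theta> x = 1" if "x \<ge> d" for x
    using that s unfolding \<Theta>_def d_def by (intro \<theta>(3)) (simp add: field_simps)
  have out: "deriv \<Theta> x = 0" if "x \<notin> {c..d}" for x
  proof -
    have "x < c \<or> x > d" using that by auto
    then have "(\<Theta> has_real_derivative 0) (at x)"
    proof
      assume "x < c"
      show ?thesis
        by (rule has_field_derivative_transform_within_open[where S = "{..<c}" and f = "\<lambda>_. 0"])
          (use \<open>x < c\<close> lo in auto)
    next
      assume "x > d"
      show ?thesis
        by (rule has_field_derivative_transform_within_open[where S = "{d<..}" and f = "\<lambda>_. 1"])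
          (use \<open>x > d\<close> hi in auto)
    qed
    then show ?thesis by (rule DERIV_imp_deriv)
  qed
  have "(LINT y|lborel. deriv \<Theta> y * indicator {c..d} y) = \<Theta> d - \<Theta> c"
    using cd(2) smooth_continuous[OF smooth_deriv[OF sm], of UNIV]
    by (intro integral_FTC_Icc_real smooth_has_deriv[OF sm]) (auto simp: continuous_on_eq_continuous_at)
  moreover have "(\<lambda>y. deriv \<Theta> y * indicator {c..d} y) = deriv \<Theta>"
    using out by (auto simp: fun_eq_iff indicator_def)
  ultimately have "(LINT y|lborel. deriv \<Theta> y) = 1" using lo[of c] hi[of d] by simp
  moreover have "test_fun {\<alpha><..<\<beta>} (deriv \<Theta>)"
    unfolding test_fun_Ioo_iff[OF assms] using smooth_deriv[OF sm] cd out by blast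
  ultimately show ?thesis using that by blast
qed

lemma test_fun_combination:
  assumes "\<alpha> < \<beta>" "test_fun {\<alpha><..<\<beta>} \<phi>" "test_fun {\<alpha><..<\<beta>} \<psi>"
  shows "test_fun {\<alpha><..<\<beta>} (\<lambda>x. a * \<phi> x + b * \<psi> x)"
proof -
  obtain c d c' d' where *: "smooth \<phi>" "\<alpha> < c" "c < d" "d < \<beta>" "\<And>x. x \<notin> {c..d} \<Longrightarrow> \<phi> x = 0"
    "smooth \<psi>" "\<alpha> < c'" "c' < d'" "d' < \<beta>" "\<And>x. x \<notin> {c'..d'} \<Longrightarrow> \<psi> x = 0"
    using assms(2,3) unfolding test_fun_Ioo_iff[OF assms(1)] by blast
  have "a * \<phi> x + b * \<psi> x = 0" if "x \<notin> {min c c'..max d d'}" for x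
    using *(5)[of x] *(10)[of x] that by (cases "x \<in> {c..d}"; cases "x \<in> {c'..d'}") auto
  moreover have "\<alpha> < min c c'" "min c c' < max d d'" "max d d' < \<beta>" using * by auto
  ultimately show ?thesis
    unfolding test_fun_Ioo_iff[OF assms(1)] using smooth_combination[OF *(1,6)] by blast
qed

text \<open>Subtracting the primitive of \<open>g\<close> leaves a function \<open>k\<close> that is orthogonal to all derivatives of test
  functions. Every test function becomes such a derivative after subtracting a multiple of one fixed
  test function \<open>\<psi>\<close> of integral one; hence \<open>k\<close> agrees with the constant \<open>C\<close> on all test functions.\<close>

lemma weak_pair_primitive:
  assumes "\<alpha> < \<beta>" and wp: "weak_pair \<alpha> \<beta> h g"
  obtains C where "AE x in lborel. x \<in> {\<alpha><..<\<beta>} \<longrightarrow> h x = C + primitive g x"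
proof -
  have h: "integrable lborel h" and g: "integrable lborel g"
    and supp: "\<And>x. x \<notin> {\<alpha><..<\<beta>} \<Longrightarrow> h x = 0" "\<And>x. x \<notin> {\<alpha><..<\<beta>} \<Longrightarrow> g x = 0"
    and weak: "\<And>\<phi>. test_fun {\<alpha><..<\<beta>} \<phi> \<Longrightarrow> (LINT x|lborel. h x * deriv \<phi> x) = - (LINT x|lborel. g x * \<phi> x)"
    using wp by (auto simp: weak_pair_def)
  note test = primitive_deriv_test_fun[OF \<open>\<alpha> < \<beta>\<close>]
  have [measurable]: "primitive g \<in> borel_measurable borel"
    by (intro borel_measurable_continuous_onI primitive_continuous[OF g, of \<alpha>] supp) auto
  have hm[measurable]: "h \<in> borel_measurable borel" using h by auto
  define I where "I = (indicator {\<alpha><..<\<beta>} :: real \<Rightarrow> real)"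
  have Im[measurable]: "I \<in> borel_measurable borel" by (simp add: I_def)
  have Iint: "integrable lborel I" unfolding I_def using \<open>\<alpha> < \<beta>\<close> by (intro integrable_real_indicator) auto
  have PI: "integrable lborel (\<lambda>x. I x * primitive g x)"
    by (rule integrable_mult_bounded[OF Iint]) (use primitive_bounded[OF g] in auto)
  define k where "k x = h x - I x * primitive g x" for x
  have k: "integrable lborel k" unfolding k_def by (intro Bochner_Integration.integrable_diff h PI)
  have bdd: "\<exists>B. \<forall>x. \<bar>\<phi> x\<bar> \<le> B" if "test_fun {\<alpha><..<\<beta>} \<phi>" for \<phi>
    using test(1,2)[OF that] primitive_bounded[of "deriv \<phi>"] by metis
  have mtest: "\<phi> \<in> borel_measurable borel" if "test_fun {\<alpha><..<\<beta>} \<phi>" for \<phi>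
    using test(3)[OF that] by auto
  have Itest: "I x * \<phi> x = \<phi> x" if t: "test_fun {\<alpha><..<\<beta>} \<phi>" for \<phi> x
  proof -
    obtain c d where "\<alpha> < c" "d < \<beta>" "\<forall>x. x \<notin> {c..d} \<longrightarrow> \<phi> x = 0"
      using t unfolding test_fun_Ioo_iff[OF \<open>\<alpha> < \<beta>\<close>] by metis
    then show ?thesis by (cases "x \<in> {c..d}") (auto simp: I_def)
  qed
  have int_mult: "integrable lborel (\<lambda>x. f x * \<phi> x)" if "integrable lborel f" "test_fun {\<alpha><..<\<beta>} \<phi>" for f \<phi>
    using bdd[OF that(2)] mtest[OF that(2)] by (auto intro!: integrable_mult_bounded[OF that(1)])
  have k_deriv: "(LINT x|lborel. k x * deriv \<phi> x) = 0" if t: "test_fun {\<alpha><..<\<beta>} \<phi>" for \<phi>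
  proof -
    note t' = test_fun_deriv[OF t \<open>\<alpha> < \<beta>\<close>]
    have "(LINT x|lborel. deriv \<phi> x * primitive g x) + (LINT x|lborel. g x * primitive (deriv \<phi>) x) = 0"
      using primitive_parts[OF test(2)[OF t] g] test(1,4)[OF t] mtest[OF t] by simp
    then have "(LINT x|lborel. deriv \<phi> x * primitive g x) = (LINT x|lborel. h x * deriv \<phi> x)"
      using weak[OF t] test(1)[OF t] by simp
    moreover have "k x * deriv \<phi> x = h x * deriv \<phi> x - deriv \<phi> x * primitive g x" for x
      using Itest[OF t', of x] by (simp add: k_def left_diff_distrib)
    moreover have "integrable lborel (\<lambda>x. deriv \<phi> x * primitive g x)"
      by (rule integrable_mult_bounded[OF test(2)[OF t]]) (use primitive_bounded[OF g] in auto)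
    ultimately show ?thesis
      using int_mult[OF h t'] by (simp add: Bochner_Integration.integral_diff)
  qed
  obtain \<psi> where \<psi>: "test_fun {\<alpha><..<\<beta>} \<psi>" "(LINT x|lborel. \<psi> x) = 1"
    using exists_test_fun_integral_1[OF \<open>\<alpha> < \<beta>\<close>] .
  define C where "C = (LINT x|lborel. k x * \<psi> x)"
  have "AE x in lborel. k x - C * I x = 0"
  proof (rule du_Bois_Reymond[OF \<open>\<alpha> < \<beta>\<close>])
    show "integrable lborel (\<lambda>x. k x - C * I x)" using k Iint by simp
    show "k x - C * I x = 0" if "x \<notin> {\<alpha><..<\<beta>}" for x using that supp by (simp add: k_def I_def)
    fix \<phi> assume t: "test_fun {\<alpha><..<\<beta>} \<phi>"
    define m where "m = (LINT x|lborel. \<phi> x)"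
    have t2: "test_fun {\<alpha><..<\<beta>} (\<lambda>x. 1 * \<phi> x + (- m) * \<psi> x)"
      by (rule test_fun_combination[OF \<open>\<alpha> < \<beta>\<close> t \<psi>(1)])
    have "(LINT x|lborel. 1 * \<phi> x + (- m) * \<psi> x) = 0"
      using test(3)[OF t] test(3)[OF \<psi>(1)] \<psi>(2) by (simp add: m_def)
    note P = test_fun_primitive[OF \<open>\<alpha> < \<beta>\<close> t2 this]
    have "(LINT x|lborel. k x * (\<phi> x - m * \<psi> x)) = 0"
      using k_deriv[OF P(1)] unfolding P(2) by simp
    moreover have "(LINT x|lborel. k x * (\<phi> x - m * \<psi> x)) = (LINT x|lborel. k x * \<phi> x) - m * C"
      using int_mult[OF k t] int_mult[OF k \<psi>(1)] unfolding C_def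
      by (simp add: right_diff_distrib mult.left_commute Bochner_Integration.integral_diff)
    moreover have "(LINT x|lborel. (k x - C * I x) * \<phi> x) = (LINT x|lborel. k x * \<phi> x) - C * m"
      using int_mult[OF k t] test(3)[OF t] unfolding m_def
      by (simp add: left_diff_distrib mult.assoc Itest[OF t] Bochner_Integration.integral_diff)
    ultimately show "(LINT x|lborel. (k x - C * I x) * \<phi> x) = 0" by simp
  qed
  then have "AE x in lborel. x \<in> {\<alpha><..<\<beta>} \<longrightarrow> h x = C + primitive g x"
    by eventually_elim (auto simp: k_def I_def)
  then show ?thesis using that by blast
qed

section \<open>Weak derivatives\<close>

text \<open>A nonempty open set is not a null set.\<close>

lemma open_AE_all:
  fixes S :: "real set"
  assumes "open S" "open {x \<in> S. \<not> P x}" "AE x in lebesgue_on S. P x" "x \<in> S"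
  shows "P x"
proof (rule ccontr)
  assume "\<not> P x"
  then have ne: "{x \<in> S. \<not> P x} \<noteq> {}" using assms(4) by auto
  have "AE x in lebesgue. x \<notin> {x \<in> S. \<not> P x}"
    using assms(3) \<open>open S\<close> by (auto simp: AE_restrict_space_iff)
  then have "{x \<in> S. \<not> P x} \<in> null_sets lebesgue"
    using AE_iff_null_sets[of "{x \<in> S. \<not> P x}" lebesgue] assms(2) by auto
  then have "negligible {x \<in> S. \<not> P x}" by (simp add: negligible_iff_null_sets)
  then show False using open_not_negligible[OF assms(2) ne] by simp
qed

lemma continuous_AE_eq:
  fixes f g :: "real \<Rightarrow> real"
  assumes "open S" "continuous_on S f" "continuous_on S g" "AE x in lebesgue_on S. f x = g x" "x \<in> S"
  shows "f x = g x"
proof (rule open_AE_all[OF assms(1) _ assms(4,5)])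
  have "open ((\<lambda>x. f x - g x) -` (- {0}) \<inter> S)"
    using assms by (intro continuous_on_open_vimage[THEN iffD1, rule_format] continuous_intros) auto
  also have "(\<lambda>x. f x - g x) -` (- {0}) \<inter> S = {x \<in> S. \<not> f x = g x}" by auto
  finally show "open {x \<in> S. \<not> f x = g x}" .
qed

lemma integral_lebesgue_on_support:
  fixes G :: "real \<Rightarrow> real"
  assumes "S \<in> sets lebesgue" "T \<in> sets lebesgue" "T \<subseteq> S" "\<And>x. x \<in> S - T \<Longrightarrow> G x = 0"
  shows "(LINT x|lebesgue_on S. G x) = (LINT x|lebesgue_on T. G x)"
    and "integrable (lebesgue_on S) G \<longleftrightarrow> integrable (lebesgue_on T) G"
proof -
  have "(\<lambda>x. indicator S x *\<^sub>R G x) = (\<lambda>x. indicator T x *\<^sub>R G x)"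
    using assms(3,4) by (auto simp: fun_eq_iff indicator_def)
  then show "(LINT x|lebesgue_on S. G x) = (LINT x|lebesgue_on T. G x)"
    and "integrable (lebesgue_on S) G \<longleftrightarrow> integrable (lebesgue_on T) G"
    using assms(1,2) integral_restrict_space[of S lebesgue G] integral_restrict_space[of T lebesgue G]
      integrable_restrict_space[of S lebesgue G] integrable_restrict_space[of T lebesgue G] by simp_all
qed

lemma integrable_lebesgue_on_subset:
  fixes f :: "real \<Rightarrow> real"
  assumes "integrable (lebesgue_on S) f" "S \<in> sets lebesgue" "T \<in> sets lebesgue" "T \<subseteq> S"
  shows "integrable (lebesgue_on T) f"
proof -
  have "integrable lebesgue (\<lambda>x. indicator T x *\<^sub>R (indicator S x *\<^sub>R f x))"
    by (rule integrable_mult_indicator) (use assms(1,2,3) in \<open>simp_all add: integrable_restrict_space\<close>)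
  moreover have "(\<lambda>x. indicator T x *\<^sub>R (indicator S x *\<^sub>R f x)) = (\<lambda>x. indicator T x *\<^sub>R f x)"
    using assms(4) by (auto simp: fun_eq_iff indicator_def)
  ultimately show ?thesis using assms(3) by (simp add: integrable_restrict_space)
qed

text \<open>The set \<open>S\<close> may be larger than the interval: a test function on the interval is one on \<open>S\<close>, and the
  integrals over \<open>S\<close> only see its support.\<close>

lemma weak_pair_representative:
  assumes "\<alpha> < \<beta>" "S \<in> sets lebesgue" "{\<alpha><..<\<beta>} \<subseteq> S"
    and int: "integrable (lebesgue_on {\<alpha><..<\<beta>}) h" "integrable (lebesgue_on {\<alpha><..<\<beta>}) g"
    and weak: "\<And>\<phi>. test_fun {\<alpha><..<\<beta>} \<phi> \<Longrightarrow>
      (LINT x|lebesgue_on S. h x * deriv \<phi> x) = - (LINT x|lebesgue_on S. g x * \<phi> x)"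
  obtains h' g' where "weak_pair \<alpha> \<beta> h' g'" "AE x in lebesgue_on {\<alpha><..<\<beta>}. h x = h' x"
    "AE x in lebesgue_on {\<alpha><..<\<beta>}. g x = g' x"
proof -
  obtain h' where h': "integrable lborel h'" "\<And>x. x \<notin> {\<alpha><..<\<beta>} \<Longrightarrow> h' x = 0"
    "AE x in lebesgue_on {\<alpha><..<\<beta>}. h x = h' x"
    using borel_representative[OF _ int(1)] by auto
  obtain g' where g': "integrable lborel g'" "\<And>x. x \<notin> {\<alpha><..<\<beta>} \<Longrightarrow> g' x = 0"
    "AE x in lebesgue_on {\<alpha><..<\<beta>}. g x = g' x"
    using borel_representative[OF _ int(2)] by auto
  have transfer: "(LINT x|lebesgue_on S. f x * \<phi> x) = (LINT x|lborel. f' x * \<phi> x)"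
    if f: "integrable (lebesgue_on {\<alpha><..<\<beta>}) f" "integrable lborel f'" "\<And>x. x \<notin> {\<alpha><..<\<beta>} \<Longrightarrow> f' x = 0"
      "AE x in lebesgue_on {\<alpha><..<\<beta>}. f x = f' x" and t: "test_fun {\<alpha><..<\<beta>} \<phi>" for f f' \<phi>
  proof -
    obtain c d where cd: "smooth \<phi>" "\<alpha> < c" "d < \<beta>" "\<forall>x. x \<notin> {c..d} \<longrightarrow> \<phi> x = 0"
      using t unfolding test_fun_Ioo_iff[OF \<open>\<alpha> < \<beta>\<close>] by metis
    have out: "\<phi> x = 0" if "x \<notin> {\<alpha><..<\<beta>}" for x
      using cd that by (cases "x \<in> {c..d}") auto
    have [measurable]: "\<phi> \<in> borel_measurable borel"
      by (rule borel_measurable_continuous_onI[OF smooth_continuous[OF cd(1)]])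
    have m: "\<phi> \<in> borel_measurable (lebesgue_on {\<alpha><..<\<beta>})"
      by (intro measurable_restrict_space1 measurable_completion[of \<phi> lborel borel]) simp
    have "(LINT x|lebesgue_on S. f x * \<phi> x) = (LINT x|lebesgue_on {\<alpha><..<\<beta>}. f x * \<phi> x)"
      by (rule integral_lebesgue_on_support) (use assms out in auto)
    also have "\<dots> = (LINT x|lborel. f' x * \<phi> x)"
    proof (rule integral_lebesgue_on_eq_lborel)
      show "(\<lambda>x. f' x * \<phi> x) \<in> borel_measurable borel" using f(2) by auto
      show "(\<lambda>x. f x * \<phi> x) \<in> borel_measurable (lebesgue_on {\<alpha><..<\<beta>})"
        using f(1) m by auto
      show "AE x in lebesgue_on {\<alpha><..<\<beta>}. f x * \<phi> x = f' x * \<phi> x"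
        using f(4) by eventually_elim simp
    qed (use f(3) in auto)
    finally show ?thesis .
  qed
  have "weak_pair \<alpha> \<beta> h' g'"
    unfolding weak_pair_def
    using h' g' transfer[OF int(1) h' test_fun_deriv[OF _ \<open>\<alpha> < \<beta>\<close>]] transfer[OF int(2) g'] weak by auto
  then show ?thesis using that h' g' by blast
qed

lemma L1_loc_mult_test_fun:
  assumes "L1_loc S h" "test_fun S \<phi>" "S \<in> sets lebesgue"
  shows "integrable (lebesgue_on S) (\<lambda>x. h x * \<phi> x)" "integrable (lebesgue_on S) (\<lambda>x. h x * deriv \<phi> x)"
proof -
  let ?K = "closure {x. \<phi> x \<noteq> 0}"
  have K: "compact ?K" "?K \<subseteq> S" and sm: "smooth \<phi>" using assms(2) by (auto simp: test_fun_def smooth_def)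
  have h: "integrable (lebesgue_on ?K) h" using assms(1) K by (auto simp: L1_loc_def)
  have Kl: "?K \<in> sets lebesgue" using K(1) by (simp add: lmeasurable_compact fmeasurableD)
  have *: "integrable (lebesgue_on S) (\<lambda>x. h x * \<psi> x)"
    if \<psi>: "continuous_on UNIV \<psi>" "\<And>x. x \<notin> ?K \<Longrightarrow> \<psi> x = 0" for \<psi> :: "real \<Rightarrow> real"
  proof -
    have "compact (\<psi> ` ?K)" by (intro compact_continuous_image continuous_on_subset[OF \<psi>(1)] K(1)) auto
    then obtain B where "\<And>x. x \<in> ?K \<Longrightarrow> \<bar>\<psi> x\<bar> \<le> B"
      using compact_imp_bounded bounded_iff by (metis imageI real_norm_def)
    then have "\<bar>\<psi> x\<bar> \<le> max B 0" for x using \<psi>(2)[of x] by (cases "x \<in> ?K") (auto simp: le_max_iff_disj)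
    moreover have "\<psi> \<in> borel_measurable (lebesgue_on ?K)"
      by (intro measurable_restrict_space1 measurable_completion[of \<psi> lborel borel])
        (use borel_measurable_continuous_onI[OF \<psi>(1)] in simp)
    ultimately have "integrable (lebesgue_on ?K) (\<lambda>x. h x * \<psi> x)"
      by (intro integrable_mult_bounded[OF h])
    then show ?thesis
      using integral_lebesgue_on_support(2)[OF assms(3) Kl K(2), of "\<lambda>x. h x * \<psi> x"] \<psi>(2) by auto
  qed
  have out: "\<phi> x = 0" if "x \<notin> ?K" for x using that closure_subset[of "{x. \<phi> x \<noteq> 0}"] by blast
  show "integrable (lebesgue_on S) (\<lambda>x. h x * \<phi> x)"
    by (rule *[OF smooth_continuous[OF sm] out])
  have "deriv \<phi> x = 0" if "x \<notin> ?K" for x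
  proof (rule DERIV_imp_deriv)
    show "(\<phi> has_real_derivative 0) (at x)"
    proof (rule has_field_derivative_transform_within_open[where S = "- ?K" and f = "\<lambda>_. 0"])
      show "open (- ?K)" by blast
      show "x \<in> - ?K" using that by blast
      show "0 = \<phi> y" if "y \<in> - ?K" for y using out[of y] that by simp
    qed simp
  qed
  then show "integrable (lebesgue_on S) (\<lambda>x. h x * deriv \<phi> x)"
    by (rule *[OF smooth_continuous[OF smooth_deriv[OF sm]]])
qed

lemma has_weak_deriv_1_iff:
  "has_weak_deriv 1 S f g \<longleftrightarrow> L1_loc S f \<and> L1_loc S g \<and>
     (\<forall>\<phi>. test_fun S \<phi> \<longrightarrow> (LINT x|lebesgue_on S. f x * deriv \<phi> x) = - (LINT x|lebesgue_on S. g x * \<phi> x))"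
  by (simp add: has_weak_deriv_def)

lemma has_weak_deriv_diff:
  assumes "has_weak_deriv 1 S f f'" "has_weak_deriv 1 S g g'" "S \<in> sets lebesgue"
  shows "has_weak_deriv 1 S (\<lambda>x. f x - g x) (\<lambda>x. f' x - g' x)"
proof -
  have L: "L1_loc S f" "L1_loc S f'" "L1_loc S g" "L1_loc S g'"
    using assms(1,2) by (auto simp: has_weak_deriv_def)
  have "(LINT x|lebesgue_on S. (f x - g x) * deriv \<phi> x) = - (LINT x|lebesgue_on S. (f' x - g' x) * \<phi> x)"
    if t: "test_fun S \<phi>" for \<phi>
  proof -
    note i = L1_loc_mult_test_fun[OF _ t assms(3)]
    have "(LINT x|lebesgue_on S. f x * deriv \<phi> x) = - (LINT x|lebesgue_on S. f' x * \<phi> x)"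
      "(LINT x|lebesgue_on S. g x * deriv \<phi> x) = - (LINT x|lebesgue_on S. g' x * \<phi> x)"
      using assms(1,2) t by (auto simp: has_weak_deriv_def)
    then show ?thesis
      using i[OF L(1)] i[OF L(2)] i[OF L(3)] i[OF L(4)]
      by (simp add: left_diff_distrib Bochner_Integration.integral_diff)
  qed
  then show ?thesis using L by (auto simp: has_weak_deriv_def L1_loc_def)
qed

text \<open>Weak derivatives are only locally integrable in the open interval, so the argument runs on the
  compactly contained intervals \<open>(1/n, 1 - 1/n)\<close>, which exhaust \<open>(0, 1)\<close>.\<close>

lemma has_weak_deriv_unique:
  assumes "has_weak_deriv 1 unit_ivl h g1" "has_weak_deriv 1 unit_ivl h g2"
  shows "AE x in lebesgue_on unit_ivl. g1 x = g2 x"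
proof -
  have sl: "unit_ivl \<in> sets lebesgue" by simp
  have w: "has_weak_deriv 1 unit_ivl (\<lambda>x. h x - h x) (\<lambda>x. g1 x - g2 x)"
    by (rule has_weak_deriv_diff[OF assms sl])
  \<comment> \<open>The shift by \<open>3\<close> makes \<open>1 / (n + 3) < 1 / 2\<close>, so that the intervals are nonempty.\<close>
  have part: "AE x in lebesgue. x \<in> {1 / real (n+3)<..<1 - 1 / real (n+3)} \<longrightarrow> g1 x = g2 x" for n :: nat
  proof -
    define \<alpha> where "\<alpha> = 1 / real (n+3)"
    have \<alpha>: "0 < \<alpha>" "\<alpha> < 1 - \<alpha>" by (auto simp: \<alpha>_def field_simps)
    have sub: "{\<alpha>..1-\<alpha>} \<subseteq> unit_ivl" "{\<alpha><..<1-\<alpha>} \<subseteq> unit_ivl" using \<alpha> by auto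
    have int: "integrable (lebesgue_on {\<alpha>..1-\<alpha>}) (\<lambda>x. h x - h x)" "integrable (lebesgue_on {\<alpha>..1-\<alpha>}) (\<lambda>x. g1 x - g2 x)"
      using w sub(1) by (auto simp: has_weak_deriv_def L1_loc_def)
    have int': "integrable (lebesgue_on {\<alpha><..<1-\<alpha>}) (\<lambda>x. h x - h x)" "integrable (lebesgue_on {\<alpha><..<1-\<alpha>}) (\<lambda>x. g1 x - g2 x)"
      by (rule integrable_lebesgue_on_subset[OF int(1)] integrable_lebesgue_on_subset[OF int(2)]; force)+
    have tt: "test_fun unit_ivl \<phi>" if "test_fun {\<alpha><..<1-\<alpha>} \<phi>" for \<phi>
      using that sub(2) unfolding test_fun_def by blast
    have "(LINT x|lebesgue_on unit_ivl. (h x - h x) * deriv \<phi> x) = - (LINT x|lebesgue_on unit_ivl. (g1 x - g2 x) * \<phi> x)"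
      if "test_fun {\<alpha><..<1-\<alpha>} \<phi>" for \<phi>
      using w tt[OF that] unfolding has_weak_deriv_1_iff by blast
    then obtain h' g' where wp: "weak_pair \<alpha> (1 - \<alpha>) h' g'" "AE x in lebesgue_on {\<alpha><..<1-\<alpha>}. h x - h x = h' x"
      "AE x in lebesgue_on {\<alpha><..<1-\<alpha>}. g1 x - g2 x = g' x"
      by (rule weak_pair_representative[OF \<alpha>(2) sl sub(2) int'])
    have "AE x in lborel. h' x = 0"
    proof -
      have "AE x in lebesgue. h' x = 0"
      proof -
        have "AE x in lebesgue. x \<in> {\<alpha><..<1-\<alpha>} \<longrightarrow> h x - h x = h' x"
          using wp(2) by (simp add: AE_restrict_space_iff)
        then show ?thesis
          by eventually_elim (use wp(1) in \<open>fastforce simp: weak_pair_def\<close>)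
      qed
      then show ?thesis using AE_completion_iff by blast
    qed
    moreover have hm: "h' \<in> borel_measurable lborel" using wp(1) by (auto simp: weak_pair_def)
    moreover have "(LINT x|lborel. h' x * deriv \<phi> x) = 0" if "test_fun {\<alpha><..<1-\<alpha>} \<phi>" for \<phi>
    proof -
      have "AE x in lborel. h' x * deriv \<phi> x = 0"
        using \<open>AE x in lborel. h' x = 0\<close> by eventually_elim simp
      then show ?thesis by (rule integral_eq_zero_AE)
    qed
    ultimately have "(LINT x|lborel. g' x * \<phi> x) = 0" if "test_fun {\<alpha><..<1-\<alpha>} \<phi>" for \<phi>
      using wp(1) that by (auto simp: weak_pair_def)
    then have "AE x in lborel. g' x = 0"
      using wp(1) by (intro du_Bois_Reymond[OF \<alpha>(2)]) (auto simp: weak_pair_def)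
    then have "AE x in lebesgue. g' x = 0" by (rule AE_completion)
    moreover have "AE x in lebesgue. x \<in> {\<alpha><..<1-\<alpha>} \<longrightarrow> g1 x - g2 x = g' x"
      using wp(3) by (simp add: AE_restrict_space_iff)
    ultimately show ?thesis unfolding \<alpha>_def[symmetric] by eventually_elim auto
  qed
  then have "AE x in lebesgue. \<forall>n. x \<in> {1 / real (n+3)<..<1 - 1 / real (n+3)} \<longrightarrow> g1 x = g2 x"
    unfolding AE_all_countable using part by blast
  then have "AE x in lebesgue. x \<in> unit_ivl \<longrightarrow> g1 x = g2 x"
  proof eventually_elim
    case (elim x)
    show ?case
    proof
      assume x: "x \<in> unit_ivl"
      obtain n :: nat where n: "real n > max (1 / x) (1 / (1 - x))" using reals_Archimedean2 by blast
      have "real (n+3) > 1 / x" "real (n+3) > 1 / (1-x)" using n by auto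
      then have "1 / real (n+3) < x" "1 / real (n+3) < 1 - x" using x by (auto simp: field_simps)
      then show "g1 x = g2 x" using elim by auto
    qed
  qed
  then show ?thesis by (simp add: AE_restrict_space_iff)
qed

section \<open>Regularity of the coefficient and of functions in the Sobolev space\<close>

lemma weak_deriv_some: "has_weak_deriv k S f g \<Longrightarrow> has_weak_deriv k S f (weak_deriv k S f)"
  unfolding weak_deriv_def by (rule someI[of "has_weak_deriv k S f"])

lemma primitive_diff_bound:
  assumes g: "integrable lborel g" and b: "AE y in lborel. \<bar>g y\<bar> \<le> B"
  shows "\<bar>primitive g x - primitive g y\<bar> \<le> B * \<bar>x - y\<bar>"
proof -
  have *: "\<bar>primitive g y - primitive g x\<bar> \<le> B * (y - x)" if "x \<le> y" for x y
  proof -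
    have gi: "integrable lborel (\<lambda>t. g t * indicator A t)" if "A \<in> sets borel" for A
      using g that by (intro integrable_real_mult_indicator) auto
    have "primitive g y - primitive g x = (LINT t|lborel. g t * indicator {..y} t - g t * indicator {..x} t)"
      unfolding primitive_def by (intro Bochner_Integration.integral_diff[symmetric] gi) auto
    also have "(\<lambda>t. g t * indicator {..y} t - g t * indicator {..x} t) = (\<lambda>t. g t * indicator {x<..y} t)"
      using that by (auto simp: fun_eq_iff indicator_def)
    finally have "\<bar>primitive g y - primitive g x\<bar> \<le> (LINT t|lborel. \<bar>g t * indicator {x<..y} t\<bar>)"
      by (simp add: integral_abs_bound)
    also have "\<dots> \<le> (LINT t|lborel. B * indicator {x<..y} t)"
    proof (rule integral_mono_AE)
      show "AE t in lborel. \<bar>g t * indicator {x<..y} t\<bar> \<le> B * indicator {x<..y} t"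
        using b by eventually_elim (auto simp: indicator_def)
      show "integrable lborel (\<lambda>t. B * indicator {x<..y} t)"
        using that by (intro integrable_mult_right integrable_real_indicator) auto
    qed (use gi in auto)
    also have "\<dots> = B * (y - x)" using that by simp
    finally show ?thesis .
  qed
  show ?thesis using *[of x y] *[of y x] by (cases "x \<le> y") (auto simp: abs_minus_commute)
qed

text \<open>The first weak derivative of \<open>a\<close> has the second one as its own weak derivative, since the derivative of
  a test function is a test function. So it is a primitive of a function bounded by \<open>a\<^sub>2\<close>, that is, a
  Lipschitz function \<open>b\<close>, and \<open>a\<close> is a primitive of \<open>b\<close>. Everything happens on bounded intervals
  \<open>(-R, R)\<close>, and the pieces fit together because each \<open>b\<close> is the classical derivative of \<open>a\<close>.\<close>

lemma coefficient_regular: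
  assumes "coefficient_assms a0 a1 a2 a3 a"
  obtains b where "\<And>y. (a has_real_derivative b y) (at y)" "\<And>y. a0 \<le> b y" "\<And>y. b y \<le> a1"
    "\<And>y z. \<bar>b y - b z\<bar> \<le> a2 * \<bar>y - z\<bar>"
proof -
  define g1 g2 where "g1 = weak_deriv 1 UNIV a" and "g2 = weak_deriv 2 UNIV a"
  have W: "\<exists>g. has_weak_deriv k UNIV a g" if "k \<le> 3" for k
    using assms that by (auto simp: coefficient_assms_def W_inf_loc_def)
  have w1: "has_weak_deriv 1 UNIV a g1" and w2: "has_weak_deriv 2 UNIV a g2"
    using W[of 1] W[of 2] weak_deriv_some unfolding g1_def g2_def by auto
  have ac: "continuous_on UNIV a" and b1: "AE y in lebesgue. a0 \<le> g1 y \<and> g1 y \<le> a1"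
    and b2: "AE y in lebesgue. \<bar>g2 y\<bar> \<le> a2"
    using assms by (auto simp: coefficient_assms_def g1_def g2_def)
  have loc: "\<exists>b. (\<forall>y\<in>{-R<..<R}. (a has_real_derivative b y) (at y) \<and> a0 \<le> b y \<and> b y \<le> a1) \<and>
      (\<forall>y\<in>{-R<..<R}. \<forall>z\<in>{-R<..<R}. \<bar>b y - b z\<bar> \<le> a2 * \<bar>y - z\<bar>)" if R: "R > 0" for R
  proof -
    have RR: "-R < R" using R by simp
    have int: "integrable (lebesgue_on {-R<..<R}) f" if "L1_loc UNIV f" for f
    proof -
      have "integrable (lebesgue_on {-R..R}) f" using that by (auto simp: L1_loc_def)
      then show ?thesis by (rule integrable_lebesgue_on_subset) auto
    qed
    have i: "integrable (lebesgue_on {-R<..<R}) a" "integrable (lebesgue_on {-R<..<R}) g1" "integrable (lebesgue_on {-R<..<R}) g2"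
      using int w1 w2 by (auto simp: has_weak_deriv_def)
    have tU: "test_fun UNIV \<phi>" if "test_fun {-R<..<R} \<phi>" for \<phi>
      using that by (auto simp: test_fun_def)
    have p1: "(LINT x|lebesgue_on UNIV. a x * deriv \<phi> x) = - (LINT x|lebesgue_on UNIV. g1 x * \<phi> x)"
      if "test_fun {-R<..<R} \<phi>" for \<phi>
      using w1 tU[OF that] unfolding has_weak_deriv_1_iff by blast
    have p2: "(LINT x|lebesgue_on UNIV. g1 x * deriv \<phi> x) = - (LINT x|lebesgue_on UNIV. g2 x * \<phi> x)"
      if t: "test_fun {-R<..<R} \<phi>" for \<phi>
    proof -
      have "(LINT x|lebesgue_on UNIV. a x * deriv (deriv \<phi>) x) = (LINT x|lebesgue_on UNIV. g2 x * \<phi> x)"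
        using w2 tU[OF t] by (simp add: has_weak_deriv_def numeral_2_eq_2)
      then show ?thesis using p1[OF test_fun_deriv[OF t RR]] by simp
    qed
    obtain A G where A: "weak_pair (-R) R A G" "AE x in lebesgue_on {-R<..<R}. a x = A x"
      "AE x in lebesgue_on {-R<..<R}. g1 x = G x"
      by (rule weak_pair_representative[OF RR _ _ i(1,2) p1]) auto
    obtain G' H where G': "weak_pair (-R) R G' H" "AE x in lebesgue_on {-R<..<R}. g1 x = G' x"
      "AE x in lebesgue_on {-R<..<R}. g2 x = H x"
      by (rule weak_pair_representative[OF RR _ _ i(2,3) p2]) auto
    obtain C where C: "AE x in lborel. x \<in> {-R<..<R} \<longrightarrow> A x = C + primitive G x"
      using weak_pair_primitive[OF RR A(1)] .
    obtain D where D: "AE x in lborel. x \<in> {-R<..<R} \<longrightarrow> G' x = D + primitive H x"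
      using weak_pair_primitive[OF RR G'(1)] .
    have iG: "integrable lborel G" "\<And>x. x \<le> -R \<Longrightarrow> G x = 0" and iH: "integrable lborel H" "\<And>x. x \<le> -R \<Longrightarrow> H x = 0"
      using A(1) G'(1) by (auto simp: weak_pair_def)
    define b where "b x = D + primitive H x" for x
    have cb: "continuous_on UNIV b" unfolding b_def
      by (intro continuous_intros primitive_continuous[OF iH])
    have on: "(AE x in lebesgue_on {-R<..<R}. P x) \<longleftrightarrow> (AE x in lebesgue. x \<in> {-R<..<R} \<longrightarrow> P x)" for P
      by (simp add: AE_restrict_space_iff)
    have g1b: "AE x in lebesgue_on {-R<..<R}. g1 x = b x"
      using AE_completion[OF D] G'(2) unfolding on by eventually_elim (auto simp: b_def)
    have Gb: "AE x in lborel. x \<in> {-R<..<R} \<longrightarrow> G x = b x"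
    proof -
      have "AE x in lebesgue. x \<in> {-R<..<R} \<longrightarrow> G x = b x"
        using g1b A(3) unfolding on by eventually_elim auto
      then show ?thesis by (simp add: AE_completion_iff)
    qed
    have aC: "a x = C + primitive G x" if "x \<in> {-R<..<R}" for x
    proof (rule continuous_AE_eq[OF _ _ _ _ that])
      show "AE x in lebesgue_on {-R<..<R}. a x = C + primitive G x"
        using AE_completion[OF C] A(2) unfolding on by eventually_elim auto
    qed (auto intro!: continuous_intros continuous_on_subset[OF ac] continuous_on_subset[OF primitive_continuous[OF iG]])
    have prim: "primitive G x = integral {-R..x} b" if "x \<in> {-R<..<R}" for x
    proof -
      have "AE y in lborel. G y * indicator {..x} y = indicator {-R..x} y *\<^sub>R b y"
        using Gb AE_lborel_singleton[of "-R"] by eventually_elim (use that iG(2) in \<open>auto simp: indicator_def\<close>)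
      then have "primitive G x = (LINT y|lborel. indicator {-R..x} y *\<^sub>R b y)"
        unfolding primitive_def
        by (intro integral_cong_AE) (use iG(1) borel_measurable_continuous_onI[OF cb] in auto)
      also have "\<dots> = integral {-R..x} b"
        using set_borel_integral_eq_integral(2)[of "{-R..x}" b] borel_integrable_compact[of "{-R..x}" b]
          continuous_on_subset[OF cb, of "{-R..x}"]
        by (simp add: set_lebesgue_integral_def set_integrable_def)
      finally show ?thesis .
    qed
    have d: "(a has_real_derivative b y) (at y)" if y: "y \<in> {-R<..<R}" for y
    proof -
      have "((\<lambda>x. integral {-R..x} b) has_real_derivative b y) (at y within {-R..R})"
        using y by (intro integral_has_real_derivative continuous_on_subset[OF cb]) auto
      moreover have "at y within {-R..R} = at y"
        by (rule at_within_interior) (use y in auto)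
      ultimately have "((\<lambda>x. C + integral {-R..x} b) has_real_derivative b y) (at y)"
        by (auto intro!: derivative_eq_intros)
      then show ?thesis
        by (rule has_field_derivative_transform_within_open[where S = "{-R<..<R}"])
          (use y aC prim in auto)
    qed
    have H2: "AE y in lborel. \<bar>H y\<bar> \<le> a2"
    proof -
      have "AE y in lebesgue. \<bar>H y\<bar> \<le> a2"
        using b2 G'(3) unfolding on
        by eventually_elim (use G'(1) in \<open>smt (verit) weak_pair_def\<close>)
      then show ?thesis by (simp add: AE_completion_iff)
    qed
    have bb: "a0 \<le> b y \<and> b y \<le> a1" if "y \<in> {-R<..<R}" for y
    proof (rule open_AE_all[OF _ _ _ that])
      have "{x \<in> {-R<..<R}. \<not> (a0 \<le> b x \<and> b x \<le> a1)} = {-R<..<R} \<inter> ({x. b x < a0} \<union> {x. a1 < b x})" by auto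
      then show "open {x \<in> {-R<..<R}. \<not> (a0 \<le> b x \<and> b x \<le> a1)}"
        by (simp add: open_Collect_less cb open_Int open_Un)
      show "AE x in lebesgue_on {-R<..<R}. a0 \<le> b x \<and> b x \<le> a1"
        using g1b b1 unfolding on by eventually_elim auto
    qed auto
    show ?thesis
      using d bb primitive_diff_bound[OF iH(1) H2] by (intro exI[of _ b]) (auto simp: b_def)
  qed
  show ?thesis
  proof (rule that[of "deriv a"])
    fix y z :: real
    define R where "R = \<bar>y\<bar> + \<bar>z\<bar> + 1"
    have R: "R > 0" "y \<in> {-R<..<R}" "z \<in> {-R<..<R}" by (auto simp: R_def)
    obtain b where b: "\<forall>y\<in>{-R<..<R}. (a has_real_derivative b y) (at y) \<and> a0 \<le> b y \<and> b y \<le> a1"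
      "\<forall>y\<in>{-R<..<R}. \<forall>z\<in>{-R<..<R}. \<bar>b y - b z\<bar> \<le> a2 * \<bar>y - z\<bar>" using loc[OF R(1)] by blast
    have e: "deriv a y = b y" "deriv a z = b z" using b(1) R by (auto intro!: DERIV_imp_deriv)
    show "(a has_real_derivative deriv a y) (at y)" "a0 \<le> deriv a y" "deriv a y \<le> a1"
      "\<bar>deriv a y - deriv a z\<bar> \<le> a2 * \<bar>y - z\<bar>"
      unfolding e using b R by auto
  qed
qed

text \<open>Two continuous representatives agree almost everywhere, hence on the open interval and by continuity
  at the end points, so the description defining the trace has exactly one solution.\<close>

lemma trace_at_eq:
  assumes F: "continuous_on {0..1} F" "AE x in lebesgue_on unit_ivl. F x = f x" and e: "e \<in> {0, 1}"
  shows "trace_at e f = F e"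
  unfolding trace_at_def
proof (rule the_equality)
  fix v assume "\<exists>G. continuous_on {0..1} G \<and> (AE x in lebesgue_on unit_ivl. G x = f x) \<and> G e = v"
  then obtain G where G: "continuous_on {0..1} G" "AE x in lebesgue_on unit_ivl. G x = f x" "G e = v" by blast
  have "AE x in lebesgue_on unit_ivl. F x = G x" using F(2) G(2) by eventually_elim simp
  then have eq: "F x = G x" if "x \<in> unit_ivl" for x
    by (intro continuous_AE_eq[OF _ _ _ _ that] continuous_on_subset[OF F(1)] continuous_on_subset[OF G(1)]) auto
  have "F x - G x = 0" if "x \<in> closure unit_ivl" for x
    by (rule continuous_constant_on_closure[OF _ _ that])
      (use eq F(1) G(1) in \<open>auto intro!: continuous_intros\<close>)
  then show "v = F e" using e G(3) by auto
qed (use F in blast)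

lemma L2_integrable: "f \<in> L2 \<Longrightarrow> integrable (lebesgue_on unit_ivl) f"
proof -
  assume f: "f \<in> L2"
  have "integrable (lebesgue_on unit_ivl) (\<lambda>x. 1 + (f x)\<^sup>2)"
    using f by (intro Bochner_Integration.integrable_add finite_measure.integrable_const finite_measure_lebesgue_on)
      (auto simp: L2_def)
  then show ?thesis
  proof (rule Bochner_Integration.integrable_bound)
    have "\<bar>y\<bar> \<le> 1 + y\<^sup>2" for y :: real using sum_squares_bound[of "\<bar>y\<bar>" 1] by (simp add: power2_eq_square)
    then show "AE x in lebesgue_on unit_ivl. norm (f x) \<le> norm (1 + (f x)\<^sup>2)" by auto
  qed (use f in \<open>auto simp: L2_def\<close>)
qed

lemma L2_cong_AE:
  assumes "f \<in> L2" "AE x in lebesgue_on unit_ivl. f x = g x"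
  shows "g \<in> L2"
proof -
  have fm: "f \<in> borel_measurable (lebesgue_on unit_ivl)" using assms(1) by (auto simp: L2_def)
  have "(\<lambda>x. if x \<in> unit_ivl then f x else 0) \<in> borel_measurable lebesgue"
    by (rule borel_measurable_if_I[OF fm]) simp
  moreover have "AE x in lebesgue. (if x \<in> unit_ivl then f x else 0) = (if x \<in> unit_ivl then g x else 0)"
    using assms(2) by (auto simp: AE_restrict_space_iff)
  ultimately have "(\<lambda>x. if x \<in> unit_ivl then g x else 0) \<in> borel_measurable lebesgue"
    by (rule borel_measurable_AE)
  then have gm: "g \<in> borel_measurable (lebesgue_on unit_ivl)" by (rule borel_measurable_if_D)
  moreover have "integrable (lebesgue_on unit_ivl) (\<lambda>x. (g x)\<^sup>2)"
    by (rule integrable_cong_AE_imp[of _ "\<lambda>x. (f x)\<^sup>2"])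
      (use assms gm in \<open>auto simp: L2_def elim!: eventually_mono\<close>)
  ultimately show ?thesis by (simp add: L2_def)
qed

text \<open>Square integrable functions on a bounded interval are integrable, so the weak derivative has a
  primitive up to both end points; this primitive is the continuous representative.\<close>

lemma H1_representative:
  assumes "f \<in> H1"
  obtains C g where "integrable lborel g" "\<And>x. x \<notin> unit_ivl \<Longrightarrow> g x = 0"
    "AE x in lebesgue_on unit_ivl. dx f x = g x"
    "AE x in lebesgue_on unit_ivl. f x = C + primitive g x"
    "continuous_on UNIV (primitive g)" "dx f \<in> L2"
proof -
  obtain g0 where g0: "g0 \<in> L2" "has_weak_deriv 1 unit_ivl f g0" and f: "f \<in> L2" using assms by (auto simp: H1_def)
  have w: "has_weak_deriv 1 unit_ivl f (dx f)" by (rule weak_deriv_some[OF g0(2)])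
  obtain h g where wp: "weak_pair 0 1 h g" "AE x in lebesgue_on unit_ivl. f x = h x"
    "AE x in lebesgue_on unit_ivl. g0 x = g x"
    by (rule weak_pair_representative[OF _ _ _ L2_integrable[OF f] L2_integrable[OF g0(1)], of unit_ivl])
      (use g0(2)[unfolded has_weak_deriv_1_iff] in auto)
  obtain C where C: "AE x in lborel. x \<in> {0<..<1} \<longrightarrow> h x = C + primitive g x"
    using weak_pair_primitive[OF _ wp(1)] by auto
  have dg: "AE x in lebesgue_on unit_ivl. dx f x = g x"
    using has_weak_deriv_unique[OF w g0(2)] wp(3) by eventually_elim simp
  have fC: "AE x in lebesgue_on unit_ivl. f x = C + primitive g x"
  proof -
    have "AE x in lebesgue_on unit_ivl. h x = C + primitive g x"
      using AE_completion[OF C] by (simp add: AE_restrict_space_iff)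
    then show ?thesis using wp(2) by eventually_elim simp
  qed
  have "dx f \<in> L2"
    by (rule L2_cong_AE[OF g0(1) has_weak_deriv_unique[OF g0(2) w]])
  show ?thesis
    by (rule that[of g C, OF _ _ dg fC]) (use wp(1) \<open>dx f \<in> L2\<close> primitive_continuous[of g 0] in \<open>auto simp: weak_pair_def\<close>)
qed

section \<open>Inner product, traces and integration by parts\<close>

abbreviation L2_inner :: "(real \<Rightarrow> real) \<Rightarrow> (real \<Rightarrow> real) \<Rightarrow> real" where
  "L2_inner f g \<equiv> (LINT x|lebesgue_on unit_ivl. f x * g x)"

lemma L2_measurable: "f \<in> L2 \<Longrightarrow> f \<in> borel_measurable (lebesgue_on unit_ivl)"
  and L2_square_integrable: "f \<in> L2 \<Longrightarrow> integrable (lebesgue_on unit_ivl) (\<lambda>x. (f x)\<^sup>2)"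
  by (auto simp: L2_def)

lemma L2_mult_integrable:
  assumes "f \<in> L2" "g \<in> L2"
  shows "integrable (lebesgue_on unit_ivl) (\<lambda>x. f x * g x)"
proof (rule Bochner_Integration.integrable_bound)
  show "integrable (lebesgue_on unit_ivl) (\<lambda>x. (f x)\<^sup>2 + (g x)\<^sup>2)"
    using assms by (intro Bochner_Integration.integrable_add L2_square_integrable)
  have "\<bar>y * z\<bar> \<le> y\<^sup>2 + z\<^sup>2" for y z :: real
  proof -
    have "2 * (\<bar>y\<bar> * \<bar>z\<bar>) \<le> y\<^sup>2 + z\<^sup>2" using sum_squares_bound[of "\<bar>y\<bar>" "\<bar>z\<bar>"] by simp
    moreover have "0 \<le> \<bar>y\<bar> * \<bar>z\<bar>" by simp
    ultimately show ?thesis unfolding abs_mult by linarith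
  qed
  then show "AE x in lebesgue_on unit_ivl. norm (f x * g x) \<le> norm ((f x)\<^sup>2 + (g x)\<^sup>2)" by simp
qed (use assms L2_measurable in auto)

lemma L2_combination:
  assumes "f \<in> L2" "g \<in> L2"
  shows "(\<lambda>x. a * f x + b * g x) \<in> L2"
proof -
  have "integrable (lebesgue_on unit_ivl) (\<lambda>x. a\<^sup>2 * (f x)\<^sup>2 + 2 * a * b * (f x * g x) + b\<^sup>2 * (g x)\<^sup>2)"
    using assms by (intro Bochner_Integration.integrable_add integrable_mult_right L2_square_integrable L2_mult_integrable)
  moreover have "(\<lambda>x. (a * f x + b * g x)\<^sup>2) = (\<lambda>x. a\<^sup>2 * (f x)\<^sup>2 + 2 * a * b * (f x * g x) + b\<^sup>2 * (g x)\<^sup>2)"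
    by (auto simp: fun_eq_iff power2_eq_square algebra_simps)
  moreover have "(\<lambda>x. a * f x + b * g x) \<in> borel_measurable (lebesgue_on unit_ivl)"
    using assms by (intro borel_measurable_add borel_measurable_times borel_measurable_const L2_measurable)
  ultimately show ?thesis by (simp add: L2_def)
qed

lemma L2_add: "f \<in> L2 \<Longrightarrow> g \<in> L2 \<Longrightarrow> (\<lambda>x. f x + g x) \<in> L2"
  and L2_diff: "f \<in> L2 \<Longrightarrow> g \<in> L2 \<Longrightarrow> (\<lambda>x. f x - g x) \<in> L2"
  and L2_scale: "f \<in> L2 \<Longrightarrow> (\<lambda>x. f x / c) \<in> L2"
  using L2_combination[of f g 1 1] L2_combination[of f g 1 "-1"] L2_combination[of f f "1 / c" 0] by simp_all

lemma L2_norm_squared: "(L2_norm f)\<^sup>2 = L2_inner f f"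
  and L2_norm_nonneg: "0 \<le> L2_norm f"
  by (simp_all add: L2_norm_def power2_eq_square)

lemma L2_inner_add_left: "f \<in> L2 \<Longrightarrow> g \<in> L2 \<Longrightarrow> h \<in> L2 \<Longrightarrow> L2_inner (\<lambda>x. f x + g x) h = L2_inner f h + L2_inner g h"
  by (simp add: distrib_right L2_mult_integrable)

lemma L2_inner_commute: "L2_inner f g = L2_inner g f" by (simp add: mult.commute)

text \<open>The quadratic polynomial \<open>\<parallel>f + t g\<parallel>\<^sup>2\<close> in \<open>t\<close> is nonnegative.\<close>

lemma L2_Cauchy_Schwarz:
  assumes "f \<in> L2" "g \<in> L2"
  shows "\<bar>L2_inner f g\<bar> \<le> L2_norm f * L2_norm g"
proof -
  define A B C where "A = L2_inner f f" and "B = L2_inner f g" and "C = L2_inner g g"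
  have nn: "A \<ge> 0" "C \<ge> 0" unfolding A_def C_def by simp_all
  have q: "A + 2 * t * B + t\<^sup>2 * C \<ge> 0" for t
  proof -
    have "0 \<le> (LINT x|lebesgue_on unit_ivl. (f x + t * g x)\<^sup>2)" by simp
    also have "\<dots> = (LINT x|lebesgue_on unit_ivl. f x * f x + 2 * t * (f x * g x) + t\<^sup>2 * (g x * g x))"
      by (intro Bochner_Integration.integral_cong refl) (simp add: power2_eq_square algebra_simps)
    also have "\<dots> = A + 2 * t * B + t\<^sup>2 * C"
      unfolding A_def B_def C_def
      using L2_mult_integrable[OF assms(1,1)] L2_mult_integrable[OF assms] L2_mult_integrable[OF assms(2,2)] by simp
    finally show ?thesis .
  qed
  have "B\<^sup>2 \<le> A * C"
  proof (cases "C = 0")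
    case True
    have "B = 0"
    proof (rule ccontr)
      assume "B \<noteq> 0"
      then show False using q[of "- (A + 1) / (2 * B)"] True by (simp add: field_simps)
    qed
    then show ?thesis using True by simp
  next
    case False
    then have "C > 0" using nn by simp
    then show ?thesis using q[of "- B / C"] by (simp add: power2_eq_square field_simps)
  qed
  then have "\<bar>B\<bar> \<le> sqrt (A * C)" by (intro real_le_rsqrt) simp
  then show ?thesis
    by (simp add: real_sqrt_mult L2_norm_def A_def B_def C_def power2_eq_square)
qed

lemma L2_triangle:
  assumes "f \<in> L2" "g \<in> L2"
  shows "L2_norm (\<lambda>x. f x + g x) \<le> L2_norm f + L2_norm g"
proof (rule power2_le_imp_le)
  have fg: "(\<lambda>x. f x + g x) \<in> L2" by (rule L2_add[OF assms])
  have "(L2_norm (\<lambda>x. f x + g x))\<^sup>2 = L2_inner f (\<lambda>x. f x + g x) + L2_inner g (\<lambda>x. f x + g x)"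
    unfolding L2_norm_squared by (rule L2_inner_add_left[OF assms fg])
  also have "\<dots> = L2_inner f f + 2 * L2_inner f g + L2_inner g g"
    using L2_inner_add_left[OF assms assms(1)] L2_inner_add_left[OF assms assms(2)]
    by (simp add: L2_inner_commute[of _ "\<lambda>x. f x + g x"] L2_inner_commute[of g f])
  also have "\<dots> \<le> (L2_norm f)\<^sup>2 + 2 * (L2_norm f * L2_norm g) + (L2_norm g)\<^sup>2"
    unfolding L2_norm_squared using L2_Cauchy_Schwarz[OF assms] by linarith
  finally show "(L2_norm (\<lambda>x. f x + g x))\<^sup>2 \<le> (L2_norm f + L2_norm g)\<^sup>2"
    by (simp add: power2_sum)
qed (simp add: L2_norm_nonneg)

lemma L2_norm_cong_AE:
  assumes "f \<in> L2" "AE x in lebesgue_on unit_ivl. f x = g x"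
  shows "L2_norm f = L2_norm g"
proof -
  have "(LINT x|lebesgue_on unit_ivl. (f x)\<^sup>2) = (LINT x|lebesgue_on unit_ivl. (g x)\<^sup>2)"
    by (rule integral_cong_AE)
      (use assms L2_measurable[OF assms(1)] L2_measurable[OF L2_cong_AE[OF assms]] in \<open>auto elim!: eventually_mono\<close>)
  then show ?thesis by (simp add: L2_norm_def)
qed

lemma L2_inner_cong_AE:
  assumes "f \<in> L2" "AE x in lebesgue_on unit_ivl. f x = f' x" "g \<in> L2"
  shows "L2_inner f g = L2_inner f' g"
  by (rule integral_cong_AE)
    (use assms L2_measurable[OF assms(1)] L2_measurable[OF assms(3)] L2_measurable[OF L2_cong_AE[OF assms(1,2)]]
      in \<open>auto elim!: eventually_mono\<close>)

lemma L2_norm_eq_0: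
  assumes "f \<in> L2" "L2_norm f = 0"
  shows "AE x in lebesgue_on unit_ivl. f x = 0"
proof -
  have "(LINT x|lebesgue_on unit_ivl. (f x)\<^sup>2) = 0" using assms(2) by (simp add: L2_norm_def)
  then have "AE x in lebesgue_on unit_ivl. (f x)\<^sup>2 = 0"
    using integral_nonneg_eq_0_iff_AE[OF L2_square_integrable[OF assms(1)]] by simp
  then show ?thesis by eventually_elim simp
qed

lemma H1_diff:
  assumes "f \<in> H1" "g \<in> H1"
  shows "(\<lambda>x. f x - g x) \<in> H1"
    and "AE x in lebesgue_on unit_ivl. dx (\<lambda>x. f x - g x) x = dx f x - dx g x"
proof -
  obtain f' g' where *: "f' \<in> L2" "has_weak_deriv 1 unit_ivl f f'" "g' \<in> L2" "has_weak_deriv 1 unit_ivl g g'"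
    "f \<in> L2" "g \<in> L2" using assms by (auto simp: H1_def)
  have s: "unit_ivl \<in> sets lebesgue" by simp
  show "(\<lambda>x. f x - g x) \<in> H1"
    using has_weak_deriv_diff[OF *(2,4) s] L2_diff[OF *(1,3)] L2_diff[OF *(5,6)] by (auto simp: H1_def)
  have d: "has_weak_deriv 1 unit_ivl (\<lambda>x. f x - g x) (\<lambda>x. dx f x - dx g x)"
    by (rule has_weak_deriv_diff[OF weak_deriv_some[OF *(2)] weak_deriv_some[OF *(4)] s])
  show "AE x in lebesgue_on unit_ivl. dx (\<lambda>x. f x - g x) x = dx f x - dx g x"
    by (rule has_weak_deriv_unique[OF weak_deriv_some[OF d] d])
qed

lemma H1_trace:
  assumes "f \<in> H1"
  obtains F where "continuous_on {0..1} F" "AE x in lebesgue_on unit_ivl. F x = f x"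
    "\<And>e. e \<in> {0, 1} \<Longrightarrow> trace_at e f = F e"
proof -
  obtain C g where g: "AE x in lebesgue_on unit_ivl. f x = C + primitive g x" "continuous_on UNIV (primitive g)"
    by (rule H1_representative[OF assms])
  have 1: "continuous_on {0..1} (\<lambda>x. C + primitive g x)"
    by (intro continuous_intros continuous_on_subset[OF g(2)]) auto
  have 2: "AE x in lebesgue_on unit_ivl. C + primitive g x = f x" using g(1) by eventually_elim simp
  show ?thesis using that[OF 1 2 trace_at_eq[OF 1 2]] .
qed

lemma trace_at_diff:
  assumes "f \<in> H1" "g \<in> H1" "e \<in> {0, 1}"
  shows "trace_at e (\<lambda>x. f x - g x) = trace_at e f - trace_at e g"
proof -
  obtain F where F: "continuous_on {0..1} F" "AE x in lebesgue_on unit_ivl. F x = f x" "\<And>e. e \<in> {0, 1} \<Longrightarrow> trace_at e f = F e"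
    by (rule H1_trace[OF assms(1)]) blast
  obtain G where G: "continuous_on {0..1} G" "AE x in lebesgue_on unit_ivl. G x = g x" "\<And>e. e \<in> {0, 1} \<Longrightarrow> trace_at e g = G e"
    by (rule H1_trace[OF assms(2)]) blast
  have "trace_at e (\<lambda>x. f x - g x) = F e - G e"
    by (rule trace_at_eq[of "\<lambda>x. F x - G x", OF _ _ assms(3)])
      (use F(1,2) G(1,2) in \<open>auto intro!: continuous_intros elim!: eventually_elim2\<close>)
  then show ?thesis using F(3) G(3) assms(3) by simp
qed

lemma dx_L2: "f \<in> H1 \<Longrightarrow> dx f \<in> L2"
  using H1_representative by blast

lemma H1_subset_L2: "f \<in> H1 \<Longrightarrow> f \<in> L2"
  by (simp add: H1_def)

lemma primitive_at_0_1:
  assumes "integrable lborel g" "\<And>x. x \<notin> unit_ivl \<Longrightarrow> g x = 0"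
  shows "primitive g 0 = 0" "primitive g 1 = (LINT x|lborel. g x)"
proof -
  have "(\<lambda>x. g x * indicator {..0} x) = (\<lambda>_. 0)" "(\<lambda>x. g x * indicator {..1} x) = g"
    using assms(2) by (force simp: fun_eq_iff indicator_def)+
  then show "primitive g 0 = 0" "primitive g 1 = (LINT x|lborel. g x)"
    by (simp_all add: primitive_def)
qed

text \<open>The continuous representatives are \<open>C + primitive f'\<close> and \<open>D + primitive g'\<close>; the constants contribute
  the mixed terms of the boundary values.\<close>

lemma H1_integration_by_parts:
  assumes "f \<in> H1" "g \<in> H1"
  shows "L2_inner f (dx g) + L2_inner g (dx f) = trace_at 1 f * trace_at 1 g - trace_at 0 f * trace_at 0 g"
proof -
  obtain C f' where f': "integrable lborel f'" "\<And>x. x \<notin> unit_ivl \<Longrightarrow> f' x = 0"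
    "AE x in lebesgue_on unit_ivl. dx f x = f' x" "AE x in lebesgue_on unit_ivl. f x = C + primitive f' x"
    "continuous_on UNIV (primitive f')" "dx f \<in> L2"
    by (rule H1_representative[OF assms(1)]) blast
  obtain D g' where g': "integrable lborel g'" "\<And>x. x \<notin> unit_ivl \<Longrightarrow> g' x = 0"
    "AE x in lebesgue_on unit_ivl. dx g x = g' x" "AE x in lebesgue_on unit_ivl. g x = D + primitive g' x"
    "continuous_on UNIV (primitive g')" "dx g \<in> L2"
    by (rule H1_representative[OF assms(2)]) blast
  have m: "primitive f' \<in> borel_measurable borel" "primitive g' \<in> borel_measurable borel"
    by (intro borel_measurable_continuous_onI f'(5) g'(5))+
  have ip: "L2_inner h k = (LINT x|lborel. (c + primitive h' x) * k' x)"
    if "h \<in> L2" "k \<in> L2" "AE x in lebesgue_on unit_ivl. h x = c + primitive h' x" "AE x in lebesgue_on unit_ivl. k x = k' x"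
      "primitive h' \<in> borel_measurable borel" "integrable lborel k'" "\<And>x. x \<notin> unit_ivl \<Longrightarrow> k' x = 0" for h k c h' k'
  proof (rule integral_lebesgue_on_eq_lborel)
    show "AE x in lebesgue_on unit_ivl. h x * k x = (c + primitive h' x) * k' x"
      using that(3,4) by eventually_elim simp
    show "(\<lambda>x. h x * k x) \<in> borel_measurable (lebesgue_on unit_ivl)"
      using that(1,2) L2_measurable by auto
    show "(\<lambda>x. (c + primitive h' x) * k' x) \<in> borel_measurable borel" using that(5,6) by auto
  qed (use that(7) in auto)
  have i: "integrable lborel (\<lambda>x. k' x * primitive h' x)"
    if "integrable lborel k'" "integrable lborel h'" "primitive h' \<in> borel_measurable borel" for h' k'
    by (rule integrable_mult_bounded[OF that(1)]) (use that(3) primitive_bounded[OF that(2)] in auto)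
  define F G where "F = (LINT x|lborel. f' x)" and "G = (LINT x|lborel. g' x)"
  have "L2_inner f (dx g) = (LINT x|lborel. (C + primitive f' x) * g' x)"
    by (rule ip[OF H1_subset_L2[OF assms(1)] g'(6) f'(4) g'(3) m(1) g'(1,2)])
  also have "\<dots> = C * G + (LINT x|lborel. g' x * primitive f' x)"
    using g'(1) i[OF g'(1) f'(1) m(1)] unfolding G_def by (simp add: distrib_right mult.commute[of "primitive f' _"])
  finally have "L2_inner f (dx g) = C * G + (LINT x|lborel. g' x * primitive f' x)" .
  moreover have "L2_inner g (dx f) = D * F + (LINT x|lborel. f' x * primitive g' x)"
  proof -
    have "L2_inner g (dx f) = (LINT x|lborel. (D + primitive g' x) * f' x)"
      by (rule ip[OF H1_subset_L2[OF assms(2)] f'(6) g'(4) f'(3) m(2) f'(1,2)])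
    also have "\<dots> = D * F + (LINT x|lborel. f' x * primitive g' x)"
      using f'(1) i[OF f'(1) g'(1) m(2)] unfolding F_def by (simp add: distrib_right mult.commute[of "primitive g' _"])
    finally show ?thesis .
  qed
  moreover have "(LINT x|lborel. f' x * primitive g' x) + (LINT x|lborel. g' x * primitive f' x) = F * G"
    unfolding F_def G_def by (rule primitive_parts[OF f'(1) g'(1) m])
  moreover have "trace_at e f = C + primitive f' e" "trace_at e g = D + primitive g' e" if "e \<in> {0,1}" for e
    by (rule trace_at_eq[OF _ _ that];
        use f'(4,5) g'(4,5) in \<open>auto intro!: continuous_intros elim: continuous_on_subset eventually_mono\<close>)+
  ultimately show ?thesis
    using primitive_at_0_1[OF f'(1,2)] primitive_at_0_1[OF g'(1,2)] unfolding F_def[symmetric] G_def[symmetric]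
    by (simp add: algebra_simps)
qed

lemma has_time_deriv_diff:
  assumes "has_time_deriv T L2 L2_norm w t d" "has_time_deriv T L2 L2_norm z t e"
    and "\<And>s. s \<in> {0..T} \<Longrightarrow> w s \<in> L2" "\<And>s. s \<in> {0..T} \<Longrightarrow> z s \<in> L2" "t \<in> {0..T}"
  shows "has_time_deriv T L2 L2_norm (\<lambda>t x. w t x - z t x) t (\<lambda>x. d x - e x)"
  unfolding has_time_deriv_def
proof
  have de: "d \<in> L2" "e \<in> L2" using assms(1,2) by (auto simp: has_time_deriv_def)
  then show "(\<lambda>x. d x - e x) \<in> L2" by (rule L2_diff)
  let ?D = "\<lambda>w d s x. (w s x - w t x) / (s - t) - d x"
  have lim: "((\<lambda>s. L2_norm (?D w d s) + L2_norm (?D z e s)) \<longlongrightarrow> 0 + 0) (at t within {0..T})"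
    using assms(1,2) by (intro tendsto_add) (auto simp: has_time_deriv_def)
  show "((\<lambda>s. L2_norm (\<lambda>x. (w s x - z s x - (w t x - z t x)) / (s - t) - (d x - e x))) \<longlongrightarrow> 0) (at t within {0..T})"
  proof (rule Lim_null_comparison)
    show "\<forall>\<^sub>F s in at t within {0..T}. norm (L2_norm (\<lambda>x. (w s x - z s x - (w t x - z t x)) / (s - t) - (d x - e x)))
        \<le> L2_norm (?D w d s) + L2_norm (?D z e s)"
      unfolding eventually_at_filter
    proof (rule always_eventually, intro allI impI)
      fix s assume "s \<noteq> t" "s \<in> {0..T}"
      have 1: "?D w d s \<in> L2" "?D z e s \<in> L2"
        using assms(3)[OF \<open>s \<in> {0..T}\<close>] assms(3)[OF assms(5)] assms(4)[OF \<open>s \<in> {0..T}\<close>] assms(4)[OF assms(5)] de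
        by - (rule L2_diff L2_scale | assumption)+
      have "(\<lambda>x. (w s x - z s x - (w t x - z t x)) / (s - t) - (d x - e x)) = (\<lambda>x. ?D w d s x + (- 1) * ?D z e s x)"
        by (auto simp: fun_eq_iff diff_divide_distrib)
      moreover have "L2_norm (\<lambda>x. ?D w d s x + (- 1) * ?D z e s x) \<le> L2_norm (?D w d s) + L2_norm (\<lambda>x. (-1) * ?D z e s x)"
        using L2_combination[OF 1(2) 1(2), of "-1" 0] by (intro L2_triangle[OF 1(1)]) simp
      moreover have "L2_norm (\<lambda>x. (-1) * ?D z e s x) = L2_norm (?D z e s)" by (simp add: L2_norm_def power2_commute)
      ultimately show "norm (L2_norm (\<lambda>x. (w s x - z s x - (w t x - z t x)) / (s - t) - (d x - e x)))
        \<le> L2_norm (?D w d s) + L2_norm (?D z e s)"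
        using L2_norm_nonneg by simp
    qed
    show "((\<lambda>s. L2_norm (?D w d s) + L2_norm (?D z e s)) \<longlongrightarrow> 0) (at t within {0..T})" using lim by simp
  qed
qed

text \<open>With \<open>Q = (w(s) - w(t)) / (s - t)\<close> one has \<open>\<parallel>w(s)\<parallel>\<^sup>2 - \<parallel>w(t)\<parallel>\<^sup>2 = 2 (s - t) \<langle>Q, w(t)\<rangle> + (s - t)\<^sup>2 \<parallel>Q\<parallel>\<^sup>2\<close>, and
  \<open>Q\<close> tends to \<open>d\<close> in \<open>L\<^sup>2\<close> as \<open>s\<close> tends to \<open>t\<close>.\<close>

lemma has_time_deriv_norm_squared:
  assumes w: "has_time_deriv T L2 L2_norm w t d" "\<And>s. s \<in> {0..T} \<Longrightarrow> w s \<in> L2" "t \<in> {0..T}"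
  shows "((\<lambda>s. (L2_norm (w s))\<^sup>2) has_real_derivative 2 * L2_inner d (w t)) (at t within {0..T})"
proof -
  have d: "d \<in> L2" using w(1) by (simp add: has_time_deriv_def)
  note wt = w(2)[OF w(3)]
  define R where "R s x = (w s x - w t x) / (s - t) - d x" for s x
  have R0: "((\<lambda>s. L2_norm (R s)) \<longlongrightarrow> 0) (at t within {0..T})"
    using w(1) by (simp add: has_time_deriv_def R_def[abs_def])
  have RL: "R s \<in> L2" if "s \<in> {0..T}" for s
    unfolding R_def[abs_def] using w(2)[OF that] wt d by (intro L2_diff L2_scale)
  have inc: "\<bar>((L2_norm (w s))\<^sup>2 - (L2_norm (w t))\<^sup>2) / (s - t) - 2 * L2_inner d (w t)\<bar>
      \<le> 2 * L2_norm (R s) * L2_norm (w t) + \<bar>s - t\<bar> * (L2_norm (R s) + L2_norm d)\<^sup>2"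
    if s: "s \<in> {0..T}" "s \<noteq> t" for s
  proof -
    note RL = RL[OF s(1)]
    define Q where "Q x = R s x + d x" for x
    have Q: "Q \<in> L2" unfolding Q_def[abs_def] by (rule L2_add[OF RL d])
    have ws: "w s x = w t x + (s - t) * Q x" for x using s(2) by (simp add: Q_def R_def)
    have "(L2_norm (w s))\<^sup>2 = (LINT x|lebesgue_on unit_ivl. w t x * w t x + 2 * (s - t) * (Q x * w t x) + (s - t)\<^sup>2 * (Q x * Q x))"
      unfolding L2_norm_squared ws
      by (intro Bochner_Integration.integral_cong refl) (simp add: power2_eq_square algebra_simps)
    also have "\<dots> = (L2_norm (w t))\<^sup>2 + 2 * (s - t) * L2_inner Q (w t) + (s - t)\<^sup>2 * (L2_norm Q)\<^sup>2"
      unfolding L2_norm_squared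
      using L2_mult_integrable[OF wt wt] L2_mult_integrable[OF Q wt] L2_mult_integrable[OF Q Q] by simp
    finally have "((L2_norm (w s))\<^sup>2 - (L2_norm (w t))\<^sup>2) / (s - t) = 2 * L2_inner Q (w t) + (s - t) * (L2_norm Q)\<^sup>2"
      using s(2) by (simp add: field_simps power2_eq_square)
    also have "L2_inner Q (w t) = L2_inner (R s) (w t) + L2_inner d (w t)"
      unfolding Q_def by (rule L2_inner_add_left[OF RL d wt])
    finally have e: "((L2_norm (w s))\<^sup>2 - (L2_norm (w t))\<^sup>2) / (s - t) - 2 * L2_inner d (w t)
        = 2 * L2_inner (R s) (w t) + (s - t) * (L2_norm Q)\<^sup>2" by simp
    have "\<bar>(s - t) * (L2_norm Q)\<^sup>2\<bar> \<le> \<bar>s - t\<bar> * (L2_norm (R s) + L2_norm d)\<^sup>2"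
      unfolding Q_def using L2_triangle[OF RL d] L2_norm_nonneg
      by (simp add: abs_mult mult_left_mono power_mono)
    then show ?thesis unfolding e using L2_Cauchy_Schwarz[OF RL wt] by linarith
  qed
  have "((\<lambda>s. 2 * L2_norm (R s) * L2_norm (w t) + \<bar>s - t\<bar> * (L2_norm (R s) + L2_norm d)\<^sup>2)
      \<longlongrightarrow> 2 * 0 * L2_norm (w t) + \<bar>t - t\<bar> * (0 + L2_norm d)\<^sup>2) (at t within {0..T})"
    by (intro tendsto_intros R0)
  then have lim: "((\<lambda>s. 2 * L2_norm (R s) * L2_norm (w t) + \<bar>s - t\<bar> * (L2_norm (R s) + L2_norm d)\<^sup>2) \<longlongrightarrow> 0) (at t within {0..T})"
    by simp
  have "((\<lambda>s. ((L2_norm (w s))\<^sup>2 - (L2_norm (w t))\<^sup>2) / (s - t) - 2 * L2_inner d (w t)) \<longlongrightarrow> 0) (at t within {0..T})"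
    by (rule Lim_null_comparison[OF _ lim])
      (use inc in \<open>auto simp: eventually_at_filter intro!: always_eventually\<close>)
  then show ?thesis
    unfolding has_field_derivative_iff by (simp add: LIM_zero_iff)
qed

section \<open>Uniqueness\<close>

lemma C1_in_D:
  assumes "C1_in T L2 L2_norm w" "t \<in> {0..T}"
  shows "w t \<in> L2" "has_time_deriv T L2 L2_norm w t (dt T w t)" "dt T w t \<in> L2"
proof -
  show "w t \<in> L2" using assms by (auto simp: C1_in_def C0_in_def)
  obtain q where "has_time_deriv T L2 L2_norm w t q" using assms unfolding C1_in_def by blast
  then show "has_time_deriv T L2 L2_norm w t (dt T w t)"
    unfolding time_deriv_def by (rule someI[of "has_time_deriv T L2 L2_norm w t"])
  then show "dt T w t \<in> L2" by (simp add: has_time_deriv_def)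
qed

text \<open>Let \<open>(P, U)\<close> be the difference of two solutions and \<open>E = \<parallel>P\<parallel>\<^sup>2 + \<parallel>U\<parallel>\<^sup>2\<close>. The equations give
  \<open>E'(t) / 2 = - \<langle>P, U\<^sub>x\<rangle> - \<langle>U, P\<^sub>x\<rangle> - \<langle>a(u) - a(v), u - v\<rangle>\<close>. The first two terms cancel because \<open>U\<close> has
  vanishing traces, and the last one is nonpositive by monotonicity. Since \<open>E(0) = 0\<close>, also \<open>E = 0\<close>.\<close>

lemma classical_solution_unique:
  assumes T: "T > 0" and mono: "mono a"
    and sol1: "classical_solution T a g0 g1 p0 u0 p u"
    and sol2: "classical_solution T a g0 g1 p0 u0 q v"
    and t: "t \<in> {0..T}"
  shows "AE x in lebesgue_on unit_ivl. q t x = p t x \<and> v t x = u t x"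
proof -
  define P where "P t x = p t x - q t x" for t x
  define U where "U t x = u t x - v t x" for t x
  have C1: "C1_in T L2 L2_norm p" "C1_in T L2 L2_norm q" "C1_in T L2 L2_norm u" "C1_in T L2 L2_norm v"
    using sol1 sol2 by (auto simp: classical_solution_def)
  have H: "p t \<in> H1" "q t \<in> H1" "u t \<in> H1" "v t \<in> H1" if "t \<in> {0..T}" for t
    using sol1 sol2 that by (auto simp: classical_solution_def C0_in_def)
  define dP where "dP t x = dt T p t x - dt T q t x" for t x
  define dU where "dU t x = dt T u t x - dt T v t x" for t x
  have PL: "P t \<in> L2" "U t \<in> L2" "dP t \<in> L2" "dU t \<in> L2" if "t \<in> {0..T}" for t
    unfolding P_def U_def dP_def dU_def
    using C1_in_D(1,3)[OF C1(1) that] C1_in_D(1,3)[OF C1(2) that] C1_in_D(1,3)[OF C1(3) that] C1_in_D(1,3)[OF C1(4) that]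
    by (simp_all add: L2_diff)
  define E where "E s = (L2_norm (P s))\<^sup>2 + (L2_norm (U s))\<^sup>2" for s
  have dE: "(E has_real_derivative 2 * L2_inner (dP t) (P t) + 2 * L2_inner (dU t) (U t)) (at t within {0..T})"
    if "t \<in> {0..T}" for t
    unfolding E_def[abs_def]
  proof (intro DERIV_add has_time_deriv_norm_squared PL that)
    show "has_time_deriv T L2 L2_norm P t (dP t)"
      using has_time_deriv_diff[OF C1_in_D(2)[OF C1(1) that] C1_in_D(2)[OF C1(2) that] C1_in_D(1)[OF C1(1)] C1_in_D(1)[OF C1(2)] that]
      by (simp add: P_def[abs_def] dP_def[abs_def])
    show "has_time_deriv T L2 L2_norm U t (dU t)"
      using has_time_deriv_diff[OF C1_in_D(2)[OF C1(3) that] C1_in_D(2)[OF C1(4) that] C1_in_D(1)[OF C1(3)] C1_in_D(1)[OF C1(4)] that]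
      by (simp add: U_def[abs_def] dU_def[abs_def])
  qed
  have dissip: "L2_inner (dP t) (P t) + L2_inner (dU t) (U t) \<le> 0" if t: "t \<in> {0<..T}" for t
  proof -
    have t0: "t \<in> {0..T}" using t by auto
    note H = H[OF t0] and PL = PL[OF t0]
    have HP: "P t \<in> H1" and HU: "U t \<in> H1"
      unfolding P_def U_def by (intro H1_diff(1) H)+
    have dxP: "AE x in lebesgue_on unit_ivl. dx (P t) x = dx (p t) x - dx (q t) x"
      unfolding P_def by (rule H1_diff(2)[OF H(1,2)])
    have dxU: "AE x in lebesgue_on unit_ivl. dx (U t) x = dx (u t) x - dx (v t) x"
      unfolding U_def by (rule H1_diff(2)[OF H(3,4)])
    have eq: "AE x in lebesgue_on unit_ivl. dt T p t x + dx (u t) x = 0"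
      "AE x in lebesgue_on unit_ivl. dt T q t x + dx (v t) x = 0"
      "AE x in lebesgue_on unit_ivl. dt T u t x + dx (p t) x + a (u t x) = 0"
      "AE x in lebesgue_on unit_ivl. dt T v t x + dx (q t) x + a (v t x) = 0"
      using sol1 sol2 t unfolding classical_solution_def by blast+
    have tr: "trace_at e (U t) = 0" if "e \<in> {0, 1}" for e
      using sol1 sol2 t that trace_at_diff[OF H(3,4) that]
      unfolding classical_solution_def U_def by auto
    have "L2_inner (dP t) (P t) = - L2_inner (P t) (dx (U t))"
    proof -
      have "L2_inner (dP t) (P t) = L2_inner (\<lambda>x. 0 * dx (U t) x + (- 1) * dx (U t) x) (P t)"
      proof (rule L2_inner_cong_AE[OF PL(3) _ PL(1)])
        show "AE x in lebesgue_on unit_ivl. dP t x = 0 * dx (U t) x + (- 1) * dx (U t) x"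
          using eq(1,2) dxU by eventually_elim (simp add: dP_def)
      qed
      then show ?thesis by (simp add: mult.commute)
    qed
    moreover have "L2_inner (dU t) (U t) \<le> - L2_inner (U t) (dx (P t))"
    proof -
      have "L2_inner (dU t) (U t) \<le> L2_inner (\<lambda>x. - dx (P t) x) (U t)"
      proof (rule integral_mono_AE)
        show "integrable (lebesgue_on unit_ivl) (\<lambda>x. dU t x * U t x)"
          by (rule L2_mult_integrable[OF PL(4,2)])
        show "integrable (lebesgue_on unit_ivl) (\<lambda>x. - dx (P t) x * U t x)"
          using L2_mult_integrable[OF dx_L2[OF HP] PL(2)] by simp
        show "AE x in lebesgue_on unit_ivl. dU t x * U t x \<le> - dx (P t) x * U t x"
          using eq(3,4) dxP
        proof eventually_elim
          case (elim x)
          have "(a (u t x) - a (v t x)) * U t x \<ge> 0"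
          proof (cases "u t x \<ge> v t x")
            case True
            then show ?thesis using monoD[OF mono True] by (simp add: U_def)
          next
            case False
            then show ?thesis using monoD[OF mono, of "u t x" "v t x"] by (simp add: U_def mult_nonpos_nonpos)
          qed
          moreover have "dU t x = - dx (P t) x - (a (u t x) - a (v t x))"
            using elim by (simp add: dU_def)
          ultimately show ?case by (simp add: left_diff_distrib)
        qed
      qed
      then show ?thesis by (simp add: mult.commute)
    qed
    ultimately show ?thesis
      using H1_integration_by_parts[OF HP HU] tr by simp
  qed
  have "E t \<le> E 0"
  proof (rule DERIV_nonpos_imp_decreasing_open[where f = E and a = 0 and b = t])
    show "0 \<le> t" using t by simp
    have "continuous_on {0..T} E" by (rule DERIV_continuous_on) (rule dE)
    then show "continuous_on {0..t} E" by (rule continuous_on_subset) (use t in auto)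
    show "\<exists>y. (E has_real_derivative y) (at s) \<and> y \<le> 0" if s: "0 < s" "s < t" for s
    proof -
      have "at s within {0..T} = at s" using s t by (intro at_within_interior) auto
      then show ?thesis
        using dE[of s] dissip[of s] s t by (intro exI[of _ "2 * L2_inner (dP s) (P s) + 2 * L2_inner (dU s) (U s)"]) auto
    qed
  qed
  moreover have "E 0 = 0"
  proof -
    have 0: "0 \<in> {0..T}" using T by simp
    have "AE x in lebesgue_on unit_ivl. p 0 x = p0 x" "AE x in lebesgue_on unit_ivl. q 0 x = p0 x"
      using sol1 sol2 by (auto simp: classical_solution_def)
    then have "AE x in lebesgue_on unit_ivl. P 0 x = 0" by eventually_elim (simp add: P_def)
    from L2_norm_cong_AE[OF PL(1)[OF 0] this] have "L2_norm (P 0) = 0" by (simp add: L2_norm_def)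
    moreover have "AE x in lebesgue_on unit_ivl. u 0 x = u0 x" "AE x in lebesgue_on unit_ivl. v 0 x = u0 x"
      using sol1 sol2 by (auto simp: classical_solution_def)
    then have "AE x in lebesgue_on unit_ivl. U 0 x = 0" by eventually_elim (simp add: U_def)
    from L2_norm_cong_AE[OF PL(2)[OF 0] this] have "L2_norm (U 0) = 0" by (simp add: L2_norm_def)
    ultimately show ?thesis by (simp add: E_def)
  qed
  ultimately have "(L2_norm (P t))\<^sup>2 + (L2_norm (U t))\<^sup>2 \<le> 0" by (simp add: E_def)
  then have "L2_norm (P t) = 0" "L2_norm (U t) = 0"
    by (smt (verit) power2_less_eq_zero_iff zero_le_power2)+
  then have "AE x in lebesgue_on unit_ivl. P t x = 0" "AE x in lebesgue_on unit_ivl. U t x = 0"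
    using L2_norm_eq_0 PL t by auto
  then show ?thesis by eventually_elim (simp add: P_def U_def)
qed

section \<open>Reflection and weighted parameter integrals\<close>

text \<open>The reflection of the line onto \<open>[0, 1]\<close>, i.e. the distance to the nearest even integer, written with
  trigonometric functions so that continuity and periodicity are immediate.\<close>

definition fold_pos :: "real \<Rightarrow> real" where "fold_pos \<eta> = arccos (cos (pi * \<eta>)) / pi"

text \<open>The orientation of the reflection, almost everywhere the derivative of \<open>fold_pos\<close>: the sign that an
  odd, \<open>2\<close>-periodic continuation picks up.\<close>

definition fold_sgn :: "real \<Rightarrow> real" where "fold_sgn \<eta> = sgn (sin (pi * \<eta>))"

lemma fold_pos_range: "fold_pos \<eta> \<in> {0..1}"
  using arccos_bounded[of "cos (pi * \<eta>)"] by (simp add: fold_pos_def)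

lemma fold_pos_abs: "\<bar>\<eta>\<bar> \<le> 1 \<Longrightarrow> fold_pos \<eta> = \<bar>\<eta>\<bar>"
proof -
  assume "\<bar>\<eta>\<bar> \<le> 1"
  have "cos (pi * \<eta>) = cos (pi * \<bar>\<eta>\<bar>)" by (cases "\<eta> \<ge> 0") auto
  then show ?thesis using \<open>\<bar>\<eta>\<bar> \<le> 1\<close> by (simp add: fold_pos_def arccos_cos mult_left_le)
qed

lemma fold_periodic: "fold_pos (\<eta> + 2) = fold_pos \<eta>" "fold_sgn (\<eta> + 2) = fold_sgn \<eta>"
proof -
  have "pi * (\<eta> + 2) = pi * \<eta> + 2 * pi" by (simp add: algebra_simps)
  then show "fold_pos (\<eta> + 2) = fold_pos \<eta>" "fold_sgn (\<eta> + 2) = fold_sgn \<eta>"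
    by (simp_all add: fold_pos_def fold_sgn_def)
qed

lemma fold_sgn_eq: "0 < \<eta> \<Longrightarrow> \<eta> < 1 \<Longrightarrow> fold_sgn \<eta> = 1" "-1 < \<eta> \<Longrightarrow> \<eta> < 0 \<Longrightarrow> fold_sgn \<eta> = -1"
proof -
  show "fold_sgn \<eta> = 1" if "0 < \<eta>" "\<eta> < 1"
  proof -
    have "0 < pi * \<eta>" "pi * \<eta> < pi * 1" using that by (intro mult_pos_pos mult_strict_left_mono; simp)+
    then have "sin (pi * \<eta>) > 0" by (intro sin_gt_zero) auto
    then show ?thesis by (simp add: fold_sgn_def)
  qed
  show "fold_sgn \<eta> = -1" if "-1 < \<eta>" "\<eta> < 0"
  proof -
    have "0 < pi * (- \<eta>)" "pi * (- \<eta>) < pi * 1" using that by (intro mult_pos_pos mult_strict_left_mono; simp)+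
    then have "sin (pi * (- \<eta>)) > 0" by (intro sin_gt_zero) auto
    then show ?thesis by (simp add: fold_sgn_def)
  qed
qed

lemma fold_sgn_bound: "\<bar>fold_sgn \<eta>\<bar> \<le> 1"
  by (simp add: fold_sgn_def sgn_if)

lemma fold_sgn_measurable: "fold_sgn \<in> borel_measurable borel"
  unfolding fold_sgn_def[abs_def]
  by (rule measurable_compose[OF _ borel_measurable_sgn])
    (intro borel_measurable_continuous_onI continuous_intros)

lemma fold_pos_continuous: "continuous_on S fold_pos"
  unfolding fold_pos_def[abs_def] by (intro continuous_intros) auto

text \<open>The integrands below are continuous up to the discontinuous factor \<open>fold_sgn\<close>. For continuity and
  differentiability with respect to parameters such a factor is harmless, as long as it does not
  depend on the parameter. The constant \<open>1\<close> is the other instance.\<close>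

definition weight :: "(real \<Rightarrow> real) \<Rightarrow> bool" where
  "weight wt \<longleftrightarrow> wt \<in> borel_measurable borel \<and> (\<forall>\<eta>. \<bar>wt \<eta>\<bar> \<le> 1)"

lemma weight_fold_sgn: "weight fold_sgn"
  by (simp add: weight_def fold_sgn_measurable fold_sgn_bound)

lemma weighted_integrable:
  fixes f :: "real \<Rightarrow> real"
  assumes wt: "weight wt" and "continuous_on {\<alpha>..\<beta>} f"
  shows "(\<lambda>\<eta>. wt \<eta> * f \<eta>) integrable_on {\<alpha>..\<beta>}"
proof -
  have "(\<lambda>\<eta>. wt \<eta> * f \<eta>) absolutely_integrable_on {\<alpha>..\<beta>}"
  proof (rule absolutely_integrable_bounded_measurable_product_real)
    show "wt \<in> borel_measurable (lebesgue_on {\<alpha>..\<beta>})"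
      by (intro measurable_restrict_space1 measurable_completion) (use wt in \<open>simp add: weight_def\<close>)
    show "bounded (wt ` {\<alpha>..\<beta>})"
      using wt by (auto simp: bounded_iff weight_def)
    show "f absolutely_integrable_on {\<alpha>..\<beta>}"
      using assms(2) by (rule absolutely_integrable_continuous_real)
  qed simp
  then show ?thesis using set_lebesgue_integral_eq_integral(1) by blast
qed

lemma weighted_integral_bound:
  fixes f g :: "real \<Rightarrow> real"
  assumes wt: "weight wt" and "continuous_on {\<alpha>..\<beta>} f" "g integrable_on {\<alpha>..\<beta>}" "\<And>\<eta>. \<eta> \<in> {\<alpha>..\<beta>} \<Longrightarrow> \<bar>f \<eta>\<bar> \<le> g \<eta>"
  shows "\<bar>integral {\<alpha>..\<beta>} (\<lambda>\<eta>. wt \<eta> * f \<eta>)\<bar> \<le> integral {\<alpha>..\<beta>} g"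
proof -
  have "norm (integral {\<alpha>..\<beta>} (\<lambda>\<eta>. wt \<eta> * f \<eta>)) \<le> integral {\<alpha>..\<beta>} g"
  proof (rule integral_norm_bound_integral[OF weighted_integrable[OF assms(1,2)] assms(3)])
    fix \<eta> assume "\<eta> \<in> {\<alpha>..\<beta>}"
    have "\<bar>wt \<eta>\<bar> * \<bar>f \<eta>\<bar> \<le> 1 * \<bar>f \<eta>\<bar>" by (intro mult_right_mono) (use wt in \<open>auto simp: weight_def\<close>)
    then show "norm (wt \<eta> * f \<eta>) \<le> g \<eta>" using assms(4)[OF \<open>\<eta> \<in> {\<alpha>..\<beta>}\<close>] by (simp add: abs_mult)
  qed
  then show ?thesis by simp
qed

lemma weighted_integral_bound_const:
  fixes f :: "real \<Rightarrow> real"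
  assumes wt: "weight wt" and "continuous_on {\<alpha>..\<beta>} f" "\<And>\<eta>. \<eta> \<in> {\<alpha>..\<beta>} \<Longrightarrow> \<bar>f \<eta>\<bar> \<le> c" "\<alpha> \<le> \<beta>"
  shows "\<bar>integral {\<alpha>..\<beta>} (\<lambda>\<eta>. wt \<eta> * f \<eta>)\<bar> \<le> c * (\<beta> - \<alpha>)"
proof -
  have "(\<lambda>_. c) integrable_on {\<alpha>..\<beta>}" by (rule integrable_const_ivl)
  from weighted_integral_bound[OF assms(1,2) this assms(3)] show ?thesis
    using assms(4) by (simp add: mult.commute)
qed

lemma continuous_on_slice:
  assumes "continuous_on (P \<times> Q) (\<lambda>(p, q). F p q)" "p \<in> P"
  shows "continuous_on Q (F p)"
proof -
  have c: "continuous_on Q (\<lambda>q. (p, q))"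
    by (intro continuous_on_Pair continuous_on_const continuous_on_id)
  have "(\<lambda>q. (p, q)) ` Q \<subseteq> P \<times> Q" using assms(2) by auto
  from continuous_on_compose2[OF assms(1) c this] show ?thesis by simp
qed

text \<open>Near \<open>p0\<close> the integrand is uniformly close to that for \<open>p0\<close>, by compactness of \<open>[\<alpha>, \<beta>]\<close>, and with the
  integrand frozen only the upper limit moves.\<close>

lemma integral_continuous_param_upper:
  fixes F :: "'p::metric_space \<Rightarrow> real \<Rightarrow> real"
  assumes wt: "weight wt" and F: "continuous_on (P \<times> {\<alpha>..\<beta>}) (\<lambda>(p, \<eta>). F p \<eta>)"
    and ub: "continuous_on P ub" "\<And>p. p \<in> P \<Longrightarrow> ub p \<in> {\<alpha>..\<beta>}"
  shows "continuous_on P (\<lambda>p. integral {\<alpha>..ub p} (\<lambda>\<eta>. wt \<eta> * F p \<eta>))"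
proof (cases "\<alpha> \<le> \<beta>")
  case True
  show ?thesis
    unfolding continuous_on_def
  proof (intro ballI)
    fix p0 assume p0: "p0 \<in> P"
    have Fp: "continuous_on {\<alpha>..\<beta>} (F p)" if "p \<in> P" for p
      by (rule continuous_on_slice[OF F that])
    let ?J = "\<lambda>p. integral {\<alpha>..ub p} (\<lambda>\<eta>. wt \<eta> * F p \<eta>)"
    let ?K = "\<lambda>p. integral {\<alpha>..ub p} (\<lambda>\<eta>. wt \<eta> * F p0 \<eta>)"
    have K: "(?K \<longlongrightarrow> ?K p0) (at p0 within P)"
    proof -
      have "continuous_on {\<alpha>..\<beta>} (\<lambda>u. integral {\<alpha>..u} (\<lambda>\<eta>. wt \<eta> * F p0 \<eta>))"
        by (intro indefinite_integral_continuous_1 weighted_integrable wt Fp p0)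
      then have "continuous_on P ?K"
        by (rule continuous_on_compose2[OF _ ub(1)]) (use ub(2) in auto)
      then show ?thesis using p0 by (simp add: continuous_on_def)
    qed
    have "((\<lambda>p. ?J p - ?K p) \<longlongrightarrow> 0) (at p0 within P)"
    proof (rule tendstoI)
      fix e :: real assume e: "e > 0"
      define X where "X = \<beta> - \<alpha> + 1"
      have X: "X > 0" using True by (simp add: X_def)
      define e' where "e' = e / 2 / X"
      have e': "e' > 0" "e' * X = e / 2" using e X by (simp_all add: e'_def)
      obtain X0 where X0: "p0 \<in> X0" "open X0"
        "\<forall>p\<in>X0 \<inter> P. \<forall>\<eta>\<in>{\<alpha>..\<beta>}. dist (case (p, \<eta>) of (p, \<eta>) \<Rightarrow> F p \<eta>) (case (p0, \<eta>) of (p, \<eta>) \<Rightarrow> F p \<eta>) \<le> e'"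
        using continuous_on_prod_compactE[OF F compact_Icc p0 e'(1)] by metis
      have "\<forall>\<^sub>F p in at p0 within P. p \<in> X0 \<inter> P"
        using X0(1,2) by (auto simp: eventually_at_topological)
      then show "\<forall>\<^sub>F p in at p0 within P. dist (?J p - ?K p) 0 < e"
      proof eventually_elim
        case (elim p)
        then have p: "p \<in> X0" "p \<in> P" by auto
        have sub: "{\<alpha>..ub p} \<subseteq> {\<alpha>..\<beta>}" "\<alpha> \<le> ub p" using ub(2)[OF p(2)] by auto
        note c = continuous_on_subset[OF Fp[OF p(2)] sub(1)] continuous_on_subset[OF Fp[OF p0] sub(1)]
        have "?J p - ?K p = integral {\<alpha>..ub p} (\<lambda>\<eta>. wt \<eta> * (F p \<eta> - F p0 \<eta>))"
          using integral_diff[OF weighted_integrable[OF wt c(1)] weighted_integrable[OF wt c(2)]]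
          by (simp add: right_diff_distrib)
        also have "\<bar>\<dots>\<bar> \<le> e' * (ub p - \<alpha>)"
          using X0(3) p sub by (intro weighted_integral_bound_const wt continuous_intros c) (auto simp: dist_real_def)
        also have "\<dots> \<le> e' * X" using e' ub(2)[OF p(2)] by (intro mult_left_mono) (auto simp: X_def)
        also have "\<dots> = e / 2" by (rule e'(2))
        finally show ?case using e by (simp add: dist_real_def)
      qed
    qed
    then have "((\<lambda>p. (?J p - ?K p) + ?K p) \<longlongrightarrow> 0 + ?K p0) (at p0 within P)"
      by (intro tendsto_add K)
    then show "(?J \<longlongrightarrow> ?J p0) (at p0 within P)" by simp
  qed
next
  case False
  then have "P = {}" using ub(2) by force
  then show ?thesis by simp
qed

lemma deriv_estimateI:
  fixes f :: "real \<Rightarrow> real"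
  assumes "\<And>e. e > 0 \<Longrightarrow> \<exists>d>0. \<forall>y\<in>S. \<bar>y - x\<bar> < d \<longrightarrow> \<bar>f y - f x - c * (y - x)\<bar> \<le> e * \<bar>y - x\<bar>"
  shows "(f has_real_derivative c) (at x within S)"
  unfolding has_field_derivative_def has_derivative_within_alt
  using assms by (auto simp: bounded_linear_mult_right)

text \<open>Differentiation under the integral sign. The difference quotients converge uniformly in \<open>\<eta>\<close> by the
  mean value inequality, so the weight only enters through its bound.\<close>

lemma weighted_integral_has_deriv:
  fixes B B' :: "real \<Rightarrow> real \<Rightarrow> real"
  assumes wt: "weight wt" and d: "\<And>\<eta> t. \<eta> \<in> {\<alpha>..\<beta>} \<Longrightarrow> t \<le> T \<Longrightarrow> (B \<eta> has_real_derivative B' \<eta> t) (at t within {..T})"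
    and B': "continuous_on ({..T} \<times> {\<alpha>..\<beta>}) (\<lambda>(t, \<eta>). B' \<eta> t)"
    and B: "\<And>t. t \<le> T \<Longrightarrow> continuous_on {\<alpha>..\<beta>} (\<lambda>\<eta>. B \<eta> t)" and "\<alpha> \<le> \<beta>" "t \<le> T"
  shows "((\<lambda>t. integral {\<alpha>..\<beta>} (\<lambda>\<eta>. wt \<eta> * B \<eta> t)) has_real_derivative
          integral {\<alpha>..\<beta>} (\<lambda>\<eta>. wt \<eta> * B' \<eta> t)) (at t within {..T})"
proof (rule deriv_estimateI)
  fix e :: real assume e: "e > 0"
  define e' where "e' = e / (\<beta> - \<alpha> + 1)"
  have e': "e' > 0" "e' * (\<beta> - \<alpha>) \<le> e" using e \<open>\<alpha> \<le> \<beta>\<close> by (auto simp: e'_def field_simps)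
  have t: "t \<in> {..T}" using \<open>t \<le> T\<close> by simp
  obtain X0 where X0: "t \<in> X0" "open X0"
    "\<forall>p\<in>X0 \<inter> {..T}. \<forall>\<eta>\<in>{\<alpha>..\<beta>}. dist (case (p, \<eta>) of (t, \<eta>) \<Rightarrow> B' \<eta> t) (case (t, \<eta>) of (t, \<eta>) \<Rightarrow> B' \<eta> t) \<le> e'"
    using continuous_on_prod_compactE[OF B' compact_Icc t e'(1)] by metis
  obtain \<delta> where \<delta>: "\<delta> > 0" "ball t \<delta> \<subseteq> X0" using X0 openE by blast
  have "\<bar>integral {\<alpha>..\<beta>} (\<lambda>\<eta>. wt \<eta> * B \<eta> s) - integral {\<alpha>..\<beta>} (\<lambda>\<eta>. wt \<eta> * B \<eta> t)
      - integral {\<alpha>..\<beta>} (\<lambda>\<eta>. wt \<eta> * B' \<eta> t) * (s - t)\<bar> \<le> e * \<bar>s - t\<bar>"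
    if s: "s \<le> T" "\<bar>s - t\<bar> < \<delta>" for s
  proof -
    have B'c: "continuous_on {\<alpha>..\<beta>} (\<lambda>\<eta>. B' \<eta> t)"
      by (rule continuous_on_slice[OF B' t])
    have est: "\<bar>B \<eta> s - B \<eta> t - B' \<eta> t * (s - t)\<bar> \<le> e' * \<bar>s - t\<bar>" if \<eta>: "\<eta> \<in> {\<alpha>..\<beta>}" for \<eta>
    proof -
      let ?S = "closed_segment t s"
      have S: "?S \<subseteq> {..T}" "?S \<subseteq> X0"
      proof -
        show "?S \<subseteq> {..T}" using s t by (auto simp: closed_segment_eq_real_ivl)
        have "?S \<subseteq> ball t \<delta>" using s \<delta>(1) by (auto simp: closed_segment_eq_real_ivl dist_real_def split: if_splits)
        then show "?S \<subseteq> X0" using \<delta>(2) by blast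
      qed
      have "norm ((B \<eta> s - B' \<eta> t * s) - (B \<eta> t - B' \<eta> t * t)) \<le> e' * norm (s - t)"
      proof (rule field_differentiable_bound[where S = ?S and f = "\<lambda>r. B \<eta> r - B' \<eta> t * r" and f' = "\<lambda>r. B' \<eta> r - B' \<eta> t"])
        fix r assume r: "r \<in> ?S"
        have "(B \<eta> has_real_derivative B' \<eta> r) (at r within ?S)"
          using d[OF \<eta>, of r] r S by (auto intro: DERIV_subset)
        then show "((\<lambda>r. B \<eta> r - B' \<eta> t * r) has_real_derivative B' \<eta> r - B' \<eta> t) (at r within ?S)"
          by (auto intro!: derivative_eq_intros)
        show "norm (B' \<eta> r - B' \<eta> t) \<le> e'"
        proof -
          have "r \<in> X0 \<inter> {..T}" using r S by blast
          then show ?thesis using X0(3) \<eta> by (auto simp: dist_real_def)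
        qed
      qed auto
      then show ?thesis by (simp add: algebra_simps)
    qed
    have c: "continuous_on {\<alpha>..\<beta>} (\<lambda>\<eta>. B \<eta> s - B \<eta> t - B' \<eta> t * (s - t))"
      by (intro continuous_intros B B'c s \<open>t \<le> T\<close>)
    have i: "(\<lambda>\<eta>. wt \<eta> * B \<eta> s) integrable_on {\<alpha>..\<beta>}" "(\<lambda>\<eta>. wt \<eta> * B \<eta> t) integrable_on {\<alpha>..\<beta>}"
      "(\<lambda>\<eta>. wt \<eta> * B' \<eta> t * (s - t)) integrable_on {\<alpha>..\<beta>}"
      using weighted_integrable[OF wt B[OF s(1)]] weighted_integrable[OF wt B[OF \<open>t \<le> T\<close>]]
        integrable_on_mult_left[OF weighted_integrable[OF wt B'c]] by auto
    have "(\<lambda>\<eta>. wt \<eta> * (B \<eta> s - B \<eta> t - B' \<eta> t * (s - t)))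
        = (\<lambda>\<eta>. wt \<eta> * B \<eta> s - wt \<eta> * B \<eta> t - wt \<eta> * B' \<eta> t * (s - t))"
      by (auto simp: algebra_simps)
    then have "integral {\<alpha>..\<beta>} (\<lambda>\<eta>. wt \<eta> * B \<eta> s) - integral {\<alpha>..\<beta>} (\<lambda>\<eta>. wt \<eta> * B \<eta> t)
        - integral {\<alpha>..\<beta>} (\<lambda>\<eta>. wt \<eta> * B' \<eta> t) * (s - t)
      = integral {\<alpha>..\<beta>} (\<lambda>\<eta>. wt \<eta> * (B \<eta> s - B \<eta> t - B' \<eta> t * (s - t)))"
      using i by (simp add: integral_diff integrable_diff)
    also have "\<bar>\<dots>\<bar> \<le> e' * \<bar>s - t\<bar> * (\<beta> - \<alpha>)"
      by (rule weighted_integral_bound_const[OF wt c est \<open>\<alpha> \<le> \<beta>\<close>])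
    also have "\<dots> \<le> e * \<bar>s - t\<bar>"
      using mult_right_mono[OF e'(2), of "\<bar>s - t\<bar>"] by (simp add: mult_ac)
    finally show ?thesis .
  qed
  then show "\<exists>d>0. \<forall>s\<in>{..T}. \<bar>s - t\<bar> < d \<longrightarrow> \<bar>integral {\<alpha>..\<beta>} (\<lambda>\<eta>. wt \<eta> * B \<eta> s) - integral {\<alpha>..\<beta>} (\<lambda>\<eta>. wt \<eta> * B \<eta> t)
      - integral {\<alpha>..\<beta>} (\<lambda>\<eta>. wt \<eta> * B' \<eta> t) * (s - t)\<bar> \<le> e * \<bar>s - t\<bar>"
    using \<delta>(1) by auto
qed

section \<open>The reflected transport equation\<close>

lemma exp_integral_le:
  fixes c \<mu> :: real
  assumes "c \<ge> 0" "\<mu> > 0" "\<alpha> \<le> \<xi>"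
  shows "(\<lambda>\<eta>. c * exp (\<mu> * (s + \<eta>))) integrable_on {\<alpha>..\<xi>}"
    and "integral {\<alpha>..\<xi>} (\<lambda>\<eta>. c * exp (\<mu> * (s + \<eta>))) \<le> c / \<mu> * exp (\<mu> * (s + \<xi>))"
proof -
  have "((\<lambda>\<eta>. c * exp (\<mu> * (s + \<eta>))) has_integral c / \<mu> * exp (\<mu> * (s + \<xi>)) - c / \<mu> * exp (\<mu> * (s + \<alpha>))) {\<alpha>..\<xi>}"
    using assms(2,3)
    by (intro fundamental_theorem_of_calculus)
      (auto intro!: derivative_eq_intros simp: has_real_derivative_iff_has_vector_derivative[symmetric])
  moreover have "c / \<mu> * exp (\<mu> * (s + \<alpha>)) \<ge> 0" using assms by simp
  ultimately show "(\<lambda>\<eta>. c * exp (\<mu> * (s + \<eta>))) integrable_on {\<alpha>..\<xi>}"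
    and "integral {\<alpha>..\<xi>} (\<lambda>\<eta>. c * exp (\<mu> * (s + \<eta>))) \<le> c / \<mu> * exp (\<mu> * (s + \<xi>))"
    by (auto simp: has_integral_iff)
qed

text \<open>The reflected problem. Here \<open>b = a'\<close>, and \<open>V\<close> is the velocity of the frictionless flow that carries the
  boundary data; the velocity sought is \<open>u = V + (w(x) - w(-x)) / 2\<close>. Functions of time live on
  \<open>(-\<infinity>, T]\<close> and vanish for \<open>t \<le> 0\<close>.\<close>

locale reflected_wave =
  fixes T L K m :: real and a b :: "real \<Rightarrow> real" and V Vt :: "real \<Rightarrow> real \<Rightarrow> real"
  assumes T: "T > 0" and L: "L > 0" and K: "K \<ge> 0" and m: "m \<ge> 0"
    and a_deriv: "\<And>y. (a has_real_derivative b y) (at y)"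
    and b_bound: "\<And>y. \<bar>b y\<bar> \<le> L" and b_lipschitz: "\<And>y z. \<bar>b y - b z\<bar> \<le> K * \<bar>y - z\<bar>"
    and a_0: "a 0 = 0"
    and V_deriv: "\<And>x t. x \<in> {0..1} \<Longrightarrow> t \<le> T \<Longrightarrow> (V x has_real_derivative Vt x t) (at t within {..T})"
    and V_zero: "\<And>x t. x \<in> {0..1} \<Longrightarrow> t \<le> 0 \<Longrightarrow> V x t = 0"
    and Vt_cont: "continuous_on ({0..1} \<times> {..T}) (\<lambda>(x, t). Vt x t)"
    and Vt_zero: "\<And>x t. x \<in> {0..1} \<Longrightarrow> t \<le> 0 \<Longrightarrow> Vt x t = 0"
    and Vt_bound: "\<And>x t. x \<in> {0..1} \<Longrightarrow> t \<le> T \<Longrightarrow> \<bar>Vt x t\<bar> \<le> m"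
begin

text \<open>Candidates for \<open>Z = w\<^sub>t\<close>. The growth bound is chosen so that the fixed point map preserves it: if
  \<open>\<bar>Z\<bar> \<le> m exp (2 L t)\<close> and \<open>\<bar>V\<^sub>t\<bar> \<le> m\<close>, then \<open>\<bar>a'(u) u\<^sub>t\<bar> \<le> 2 L m exp (2 L t)\<close>, and integration in time divides
  by the rate \<open>2 L\<close>.\<close>

definition admissible :: "(real \<Rightarrow> real \<Rightarrow> real) \<Rightarrow> bool" where
  "admissible Z \<longleftrightarrow> continuous_on ({-1..1} \<times> {..T}) (\<lambda>(\<xi>, t). Z \<xi> t) \<and>
     (\<forall>\<xi>\<in>{-1..1}. \<forall>t\<le>0. Z \<xi> t = 0) \<and>
     (\<forall>\<xi>\<in>{-1..1}. \<forall>t\<le>T. \<bar>Z \<xi> t\<bar> \<le> m * exp (2 * L * t))"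

definition ut_of :: "(real \<Rightarrow> real \<Rightarrow> real) \<Rightarrow> real \<Rightarrow> real \<Rightarrow> real" where
  "ut_of Z x t = (Z x t - Z (- x) t) / 2 + Vt x t"

definition u_of :: "(real \<Rightarrow> real \<Rightarrow> real) \<Rightarrow> real \<Rightarrow> real \<Rightarrow> real" where
  "u_of Z x t = integral {0..t} (ut_of Z x)"

text \<open>The time derivative of \<open>a(u)\<close>.\<close>

definition friction_rate :: "(real \<Rightarrow> real \<Rightarrow> real) \<Rightarrow> real \<Rightarrow> real \<Rightarrow> real" where
  "friction_rate Z x t = b (u_of Z x t) * ut_of Z x t"

text \<open>The solution of \<open>w\<^sub>t + w\<^sub>\<xi> = - fold_sgn \<xi> * h (fold_pos \<xi>, t)\<close> that vanishes for \<open>t \<le> 0\<close> if \<open>h\<close> does,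
  integrated along the characteristic through \<open>(\<xi>, t)\<close> and parametrised by position. With the position as variable of
  integration, time derivatives fall on \<open>h\<close> only and never on the discontinuous sign. For all
  \<open>\<xi> \<ge> -1\<close> and \<open>t \<le> T\<close> the starting point \<open>-(T + 2)\<close> belongs to a negative time.\<close>

definition duhamel :: "(real \<Rightarrow> real \<Rightarrow> real) \<Rightarrow> real \<Rightarrow> real \<Rightarrow> real" where
  "duhamel h \<xi> t = - integral {-(T+2)..\<xi>} (\<lambda>\<eta>. fold_sgn \<eta> * h (fold_pos \<eta>) (t - \<xi> + \<eta>))"

lemma ut_of_props:
  assumes "admissible Z"
  shows "continuous_on ({0..1} \<times> {..T}) (\<lambda>(x, t). ut_of Z x t)"
    and "\<And>x t. x \<in> {0..1} \<Longrightarrow> t \<le> 0 \<Longrightarrow> ut_of Z x t = 0"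
    and "\<And>x t. x \<in> {0..1} \<Longrightarrow> t \<le> T \<Longrightarrow> \<bar>ut_of Z x t\<bar> \<le> 2 * m * exp (2 * L * t)"
proof -
  have Zc: "continuous_on ({-1..1} \<times> {..T}) (\<lambda>(\<xi>, t). Z \<xi> t)"
    and Z0: "\<And>\<xi> t. \<xi> \<in> {-1..1} \<Longrightarrow> t \<le> 0 \<Longrightarrow> Z \<xi> t = 0"
    and Zb: "\<And>\<xi> t. \<xi> \<in> {-1..1} \<Longrightarrow> t \<le> T \<Longrightarrow> \<bar>Z \<xi> t\<bar> \<le> m * exp (2 * L * t)"
    using assms by (auto simp: admissible_def)
  have "continuous_on ({0..1} \<times> {..T}) (\<lambda>p. case (fst p, snd p) of (\<xi>, t) \<Rightarrow> Z \<xi> t)"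
    by (rule continuous_on_compose2[OF Zc]) (auto intro!: continuous_intros)
  moreover have "continuous_on ({0..1} \<times> {..T}) (\<lambda>p. case (- fst p, snd p) of (\<xi>, t) \<Rightarrow> Z \<xi> t)"
    by (rule continuous_on_compose2[OF Zc]) (auto intro!: continuous_intros)
  ultimately show "continuous_on ({0..1} \<times> {..T}) (\<lambda>(x, t). ut_of Z x t)"
    using Vt_cont unfolding ut_of_def case_prod_beta by (auto intro!: continuous_intros)
  show z: "ut_of Z x t = 0" if "x \<in> {0..1}" "t \<le> 0" for x t
    using that Z0[of x t] Z0[of "-x" t] Vt_zero[OF that] by (simp add: ut_of_def)
  show "\<bar>ut_of Z x t\<bar> \<le> 2 * m * exp (2 * L * t)" if "x \<in> {0..1}" "t \<le> T" for x t
  proof (cases "t \<le> 0")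
    case True
    then show ?thesis using z that m by simp
  next
    case False
    then have "exp (2 * L * t) \<ge> 1" using L by simp
    then have "m \<le> m * exp (2 * L * t)" using m mult_left_mono[of 1 "exp (2 * L * t)" m] by simp
    moreover have "\<bar>(Z x t - Z (-x) t) / 2\<bar> \<le> m * exp (2 * L * t)"
      using Zb[of x t] Zb[of "-x" t] that by (auto simp: abs_le_iff field_simps)
    ultimately show ?thesis using Vt_bound[OF that] unfolding ut_of_def by linarith
  qed
qed

lemma u_of_props:
  assumes "admissible Z"
  shows "\<And>x t. x \<in> {0..1} \<Longrightarrow> t \<le> T \<Longrightarrow> (u_of Z x has_real_derivative ut_of Z x t) (at t within {..T})"
    and "\<And>x t. t \<le> 0 \<Longrightarrow> u_of Z x t = 0"
    and "continuous_on ({0..1} \<times> {..T}) (\<lambda>(x, t). u_of Z x t)"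
proof -
  note uc = ut_of_props(1)[OF assms]
  have sl: "continuous_on {..T} (ut_of Z x)" if "x \<in> {0..1}" for x
    by (rule continuous_on_slice[OF uc that])
  show "(u_of Z x has_real_derivative ut_of Z x t) (at t within {..T})" if "x \<in> {0..1}" "t \<le> T" for x t
    unfolding u_of_def[abs_def] using that
    by (intro primitive_has_deriv_within sl ut_of_props(2)[OF assms])
  show "u_of Z x t = 0" if "t \<le> 0" for x t
    using that by (cases "t = 0") (auto simp: u_of_def)
  have one: "weight (\<lambda>_. 1)" by (simp add: weight_def)
  have "continuous_on ({0..1} \<times> {..T}) (\<lambda>p. integral {0..max 0 (snd p)} (\<lambda>\<eta>. 1 * ut_of Z (fst p) \<eta>))"
  proof (rule integral_continuous_param_upper[OF one, where \<beta> = T])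
    have "continuous_on (({0..1} \<times> {..T}) \<times> {0..T}) (\<lambda>q. case (fst (fst q), snd q) of (x, t) \<Rightarrow> ut_of Z x t)"
      by (rule continuous_on_compose2[OF uc]) (auto intro!: continuous_intros)
    then show "continuous_on (({0..1} \<times> {..T}) \<times> {0..T}) (\<lambda>(p, \<eta>). ut_of Z (fst p) \<eta>)"
      by (simp add: case_prod_beta)
  qed (use T in \<open>auto intro!: continuous_intros\<close>)
  moreover have "integral {0..max 0 t} (\<lambda>\<eta>. 1 * ut_of Z x \<eta>) = u_of Z x t" for x t
    by (cases "t \<ge> 0") (auto simp: u_of_def)
  ultimately show "continuous_on ({0..1} \<times> {..T}) (\<lambda>(x, t). u_of Z x t)"
    by (simp add: case_prod_beta)
qed

lemma b_continuous: "continuous_on S b"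
proof -
  have "K-lipschitz_on S b"
    using b_lipschitz K by (intro lipschitz_onI) (auto simp: dist_real_def)
  then show ?thesis by (rule lipschitz_on_continuous_on)
qed

lemma friction_rate_props:
  assumes "admissible Z"
  shows "continuous_on ({0..1} \<times> {..T}) (\<lambda>(x, t). friction_rate Z x t)"
    and "\<And>x t. x \<in> {0..1} \<Longrightarrow> t \<le> 0 \<Longrightarrow> friction_rate Z x t = 0"
    and "\<And>x t. x \<in> {0..1} \<Longrightarrow> t \<le> T \<Longrightarrow> \<bar>friction_rate Z x t\<bar> \<le> 2 * L * m * exp (2 * L * t)"
proof -
  have "continuous_on ({0..1} \<times> {..T}) (\<lambda>p. b ((\<lambda>(x, t). u_of Z x t) p))"
    by (rule continuous_on_compose2[OF b_continuous[of UNIV] u_of_props(3)[OF assms]]) auto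
  then show "continuous_on ({0..1} \<times> {..T}) (\<lambda>(x, t). friction_rate Z x t)"
    using ut_of_props(1)[OF assms] unfolding friction_rate_def case_prod_beta by (intro continuous_intros)
  show "friction_rate Z x t = 0" if "x \<in> {0..1}" "t \<le> 0" for x t
    using ut_of_props(2)[OF assms that] by (simp add: friction_rate_def)
  show "\<bar>friction_rate Z x t\<bar> \<le> 2 * L * m * exp (2 * L * t)" if "x \<in> {0..1}" "t \<le> T" for x t
    using mult_mono[OF b_bound[of "u_of Z x t"] ut_of_props(3)[OF assms that]] L
    by (simp add: friction_rate_def abs_mult mult_ac)
qed

lemma duhamel_slice_continuous:
  assumes "continuous_on ({0..1} \<times> {..T}) (\<lambda>(x, t). h x t)" "t \<le> T"
  shows "continuous_on {\<alpha>..\<xi>} (\<lambda>\<eta>. h (fold_pos \<eta>) (t - \<xi> + \<eta>))"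
proof -
  have "continuous_on {\<alpha>..\<xi>} (\<lambda>\<eta>. case (fold_pos \<eta>, t - \<xi> + \<eta>) of (x, t) \<Rightarrow> h x t)"
    by (rule continuous_on_compose2[OF assms(1)])
      (use assms(2) fold_pos_range in \<open>auto intro!: continuous_intros fold_pos_continuous\<close>)
  then show ?thesis by simp
qed

lemma duhamel_bound:
  assumes h: "continuous_on ({0..1} \<times> {..T}) (\<lambda>(x, t). h x t)"
    and b: "\<And>x t. x \<in> {0..1} \<Longrightarrow> t \<le> T \<Longrightarrow> \<bar>h x t\<bar> \<le> c * exp (\<mu> * t)"
    and "c \<ge> 0" "\<mu> > 0" "\<xi> \<in> {-1..1}" "t \<le> T"
  shows "\<bar>duhamel h \<xi> t\<bar> \<le> c / \<mu> * exp (\<mu> * t)"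
proof -
  have le: "-(T+2) \<le> \<xi>" using T assms(5) by simp
  note e = exp_integral_le[OF assms(3,4) le, of "t - \<xi>"]
  have "\<bar>duhamel h \<xi> t\<bar> \<le> integral {-(T+2)..\<xi>} (\<lambda>\<eta>. c * exp (\<mu> * ((t - \<xi>) + \<eta>)))"
    unfolding duhamel_def abs_minus_cancel
  proof (rule weighted_integral_bound[OF weight_fold_sgn duhamel_slice_continuous[OF h assms(6)] e(1)])
    fix \<eta> assume "\<eta> \<in> {-(T+2)..\<xi>}"
    then show "\<bar>h (fold_pos \<eta>) (t - \<xi> + \<eta>)\<bar> \<le> c * exp (\<mu> * (t - \<xi> + \<eta>))"
      using assms(6) by (intro b fold_pos_range) auto
  qed
  also have "\<dots> \<le> c / \<mu> * exp (\<mu> * t)" using e(2) by simp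
  finally show ?thesis .
qed

lemma duhamel_zero:
  assumes "\<And>x t. x \<in> {0..1} \<Longrightarrow> t \<le> 0 \<Longrightarrow> h x t = 0" "t \<le> 0"
  shows "duhamel h \<xi> t = 0"
proof -
  have "integral {-(T+2)..\<xi>} (\<lambda>\<eta>. fold_sgn \<eta> * h (fold_pos \<eta>) (t - \<xi> + \<eta>)) = 0"
    by (rule integral_eq_0) (use assms(2) fold_pos_range in \<open>auto intro!: assms(1)\<close>)
  then show ?thesis by (simp add: duhamel_def)
qed

text \<open>Truncating the time at \<open>T\<close> extends the integrand to all positions \<open>\<eta> \<le> 1\<close> without changing the
  integral, so that the integrand is defined on a product set.\<close>

lemma duhamel_continuous:
  assumes h: "continuous_on ({0..1} \<times> {..T}) (\<lambda>(x, t). h x t)"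
  shows "continuous_on ({-1..1} \<times> {..T}) (\<lambda>(\<xi>, t). duhamel h \<xi> t)"
proof -
  let ?F = "\<lambda>(p :: real \<times> real) \<eta>. h (fold_pos \<eta>) (min T (snd p - fst p + \<eta>))"
  have "continuous_on ({-1..1} \<times> {..T}) (\<lambda>p :: real \<times> real. integral {-(T+2)..fst p} (\<lambda>\<eta>. fold_sgn \<eta> * ?F p \<eta>))"
  proof (rule integral_continuous_param_upper[OF weight_fold_sgn, where \<beta> = 1])
    have "continuous_on (({-1..1} \<times> {..T}) \<times> {-(T+2)..1})
        (\<lambda>q. case (fold_pos (snd q), min T (snd (fst q) - fst (fst q) + snd q)) of (x, t) \<Rightarrow> h x t)"
      by (rule continuous_on_compose2[OF h])
        (use fold_pos_range in \<open>auto intro!: continuous_intros continuous_on_compose2[OF fold_pos_continuous]\<close>)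
    then show "continuous_on (({-1..1} \<times> {..T}) \<times> {-(T+2)..1}) (\<lambda>(p, \<eta>). ?F p \<eta>)"
      by (simp add: case_prod_beta)
  qed (use T in \<open>auto intro!: continuous_intros\<close>)
  then have "continuous_on ({-1..1} \<times> {..T}) (\<lambda>p :: real \<times> real. - integral {-(T+2)..fst p} (\<lambda>\<eta>. fold_sgn \<eta> * ?F p \<eta>))"
    by (rule continuous_on_minus)
  then show ?thesis
  proof (rule continuous_on_eq)
    fix p :: "real \<times> real" assume p: "p \<in> {-1..1} \<times> {..T}"
    have "integral {-(T+2)..fst p} (\<lambda>\<eta>. fold_sgn \<eta> * ?F p \<eta>)
        = integral {-(T+2)..fst p} (\<lambda>\<eta>. fold_sgn \<eta> * h (fold_pos \<eta>) (snd p - fst p + \<eta>))"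
    proof (rule integral_cong)
      fix \<eta> assume "\<eta> \<in> {-(T+2)..fst p}"
      then have "snd p - fst p + \<eta> \<le> T" using p by auto
      then show "fold_sgn \<eta> * ?F p \<eta> = fold_sgn \<eta> * h (fold_pos \<eta>) (snd p - fst p + \<eta>)"
        by (simp add: min_absorb2)
    qed
    then show "- integral {-(T+2)..fst p} (\<lambda>\<eta>. fold_sgn \<eta> * ?F p \<eta>) = (case p of (\<xi>, t) \<Rightarrow> duhamel h \<xi> t)"
      by (simp add: duhamel_def case_prod_beta)
  qed
qed

lemma duhamel_admissible:
  assumes "admissible Z" shows "admissible (duhamel (friction_rate Z))"
  unfolding admissible_def
proof (intro conjI ballI allI impI)
  note fr = friction_rate_props[OF assms]
  show "continuous_on ({-1..1} \<times> {..T}) (\<lambda>(\<xi>, t). duhamel (friction_rate Z) \<xi> t)"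
    by (rule duhamel_continuous[OF fr(1)])
  show "duhamel (friction_rate Z) \<xi> t = 0" if "t \<le> 0" for \<xi> t by (rule duhamel_zero[OF fr(2) that])
  show "\<bar>duhamel (friction_rate Z) \<xi> t\<bar> \<le> m * exp (2 * L * t)" if "\<xi> \<in> {-1..1}" "t \<le> T" for \<xi> t
    using duhamel_bound[OF fr(1), of "2 * L * m" "2 * L" \<xi> t] fr(3) that L m by simp
qed

text \<open>The weight \<open>exp (decay * t)\<close> gains a factor \<open>1 / decay\<close> in each time integration. The bracket is a
  Lipschitz constant of \<open>Z \<mapsto> a'(u) u\<^sub>t\<close> on admissible functions, so the factor two makes the map a
  contraction with constant \<open>1/2\<close>.\<close>

definition decay :: real where "decay = 2 * (L + 2 * K * m * exp (2 * L * T)) + 1"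

lemma decay_ge: "decay \<ge> 1" "decay \<ge> 2 * L" "2 * (L + 2 * K * m * exp (2 * L * T)) \<le> decay"
  using L K m by (auto simp: decay_def)

text \<open>In the product \<open>a'(u) u\<^sub>t\<close> the factor \<open>u\<^sub>t\<close> is controlled by the growth bound of admissible functions.
  Without it the map would be only locally Lipschitz.\<close>

lemma duhamel_contraction:
  assumes adm: "admissible Y" "admissible Z" and D: "D \<ge> 0"
    and close: "\<And>\<xi> t. \<xi> \<in> {-1..1} \<Longrightarrow> t \<le> T \<Longrightarrow> \<bar>Y \<xi> t - Z \<xi> t\<bar> \<le> D * exp (decay * t)"
    and "\<xi> \<in> {-1..1}" "t \<le> T"
  shows "\<bar>duhamel (friction_rate Y) \<xi> t - duhamel (friction_rate Z) \<xi> t\<bar> \<le> D / 2 * exp (decay * t)"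
proof -
  have ut: "\<bar>ut_of Y x t - ut_of Z x t\<bar> \<le> D * exp (decay * t)" if "x \<in> {0..1}" "t \<le> T" for x t
    using close[of x t] close[of "-x" t] that unfolding ut_of_def by (auto simp: abs_le_iff field_simps)
  have u: "\<bar>u_of Y x t - u_of Z x t\<bar> \<le> D * exp (decay * t)" if x: "x \<in> {0..1}" "t \<le> T" for x t
  proof (cases "t \<ge> 0")
    case False
    then show ?thesis using u_of_props(2) adm D by simp
  next
    case True
    have c: "continuous_on {0..t} (ut_of W x)" if "admissible W" for W
      by (rule continuous_on_subset[OF continuous_on_slice[OF ut_of_props(1)[OF that] x(1)]]) (use x in auto)
    have e: "u_of Y x t - u_of Z x t = integral {0..t} (\<lambda>\<tau>. ut_of Y x \<tau> - ut_of Z x \<tau>)"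
      unfolding u_of_def by (intro integral_diff[symmetric] integrable_continuous_real c adm)
    have "norm (u_of Y x t - u_of Z x t) \<le> integral {0..t} (\<lambda>\<tau>. D * exp (decay * (0 + \<tau>)))"
      unfolding e using x decay_ge(1) D True
      by (intro integral_norm_bound_integral integrable_continuous_real continuous_intros c adm) (auto intro!: ut)
    also have "\<dots> \<le> D / decay * exp (decay * t)"
      using exp_integral_le(2)[of D decay 0 t 0] D decay_ge(1) True by simp
    also have "\<dots> \<le> D * exp (decay * t)"
      using decay_ge(1) D by (intro mult_right_mono) (auto simp: field_simps mult_le_cancel_left1)
    finally show ?thesis by simp
  qed
  define c where "c = D * (L + 2 * K * m * exp (2 * L * T))"
  have c0: "c \<ge> 0" unfolding c_def using D L K m by simp
  have fr: "\<bar>friction_rate Y x t - friction_rate Z x t\<bar> \<le> c * exp (decay * t)" if x: "x \<in> {0..1}" "t \<le> T" for x t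
  proof -
    have "friction_rate Y x t - friction_rate Z x t
        = b (u_of Y x t) * (ut_of Y x t - ut_of Z x t) + (b (u_of Y x t) - b (u_of Z x t)) * ut_of Z x t"
      by (simp add: friction_rate_def algebra_simps)
    moreover have "\<bar>b (u_of Y x t) * (ut_of Y x t - ut_of Z x t)\<bar> \<le> L * (D * exp (decay * t))"
      unfolding abs_mult using L by (intro mult_mono b_bound ut x) auto
    moreover have "\<bar>(b (u_of Y x t) - b (u_of Z x t)) * ut_of Z x t\<bar> \<le> (K * (D * exp (decay * t))) * (2 * m * exp (2 * L * T))"
      unfolding abs_mult
    proof (rule mult_mono)
      show "\<bar>b (u_of Y x t) - b (u_of Z x t)\<bar> \<le> K * (D * exp (decay * t))"
        using order_trans[OF b_lipschitz mult_left_mono[OF u[OF x] K]] .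
      have "2 * m * exp (2 * L * t) \<le> 2 * m * exp (2 * L * T)"
        using m L x by (intro mult_left_mono) auto
      then show "\<bar>ut_of Z x t\<bar> \<le> 2 * m * exp (2 * L * T)" using ut_of_props(3)[OF adm(2) x] by linarith
    qed (use K D in auto)
    ultimately have "\<bar>friction_rate Y x t - friction_rate Z x t\<bar>
        \<le> L * (D * exp (decay * t)) + (K * (D * exp (decay * t))) * (2 * m * exp (2 * L * T))" by linarith
    then show ?thesis by (simp add: c_def algebra_simps)
  qed
  let ?h = "\<lambda>x t. friction_rate Y x t - friction_rate Z x t"
  have hc: "continuous_on ({0..1} \<times> {..T}) (\<lambda>(x, t). ?h x t)"
    using friction_rate_props(1)[OF adm(1)] friction_rate_props(1)[OF adm(2)] unfolding case_prod_beta
    by (intro continuous_intros)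
  have "duhamel ?h \<xi> t = duhamel (friction_rate Y) \<xi> t - duhamel (friction_rate Z) \<xi> t"
    unfolding duhamel_def right_diff_distrib
    using integral_diff[OF weighted_integrable[OF weight_fold_sgn duhamel_slice_continuous[OF friction_rate_props(1)[OF adm(1)] \<open>t \<le> T\<close>, of "-(T+2)" \<xi>]]
        weighted_integrable[OF weight_fold_sgn duhamel_slice_continuous[OF friction_rate_props(1)[OF adm(2)] \<open>t \<le> T\<close>, of "-(T+2)" \<xi>]]]
    by simp
  moreover have "\<bar>duhamel ?h \<xi> t\<bar> \<le> c / decay * exp (decay * t)"
    using decay_ge(1) assms(5,6) by (intro duhamel_bound[OF hc fr c0]) auto
  moreover have "c / decay \<le> D / 2"
    using mult_left_mono[OF decay_ge(3) D] decay_ge(1) unfolding c_def by (simp add: field_simps)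
  ultimately show ?thesis
    by (smt (verit) exp_gt_zero mult_right_mono)
qed

text \<open>Picard iteration. On \<open>t \<ge> 0\<close> the weight is at least \<open>1\<close> and at most \<open>exp (decay * T)\<close>, and for \<open>t \<le> 0\<close> all
  iterates vanish, so weighted and unweighted uniform convergence agree.\<close>

lemma duhamel_fixpoint:
  obtains Z where "admissible Z"
    "\<And>\<xi> t. \<xi> \<in> {-1..1} \<Longrightarrow> t \<le> T \<Longrightarrow> duhamel (friction_rate Z) \<xi> t = Z \<xi> t"
proof -
  let ?\<Omega> = "{-1..1} \<times> {..T}"
  define S where "S Z = duhamel (friction_rate Z)" for Z
  define zs where "zs n = (S ^^ n) (\<lambda>_ _. 0)" for n
  have zs_Suc: "zs (Suc n) = S (zs n)" for n by (simp add: zs_def)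
  have adm: "admissible (zs n)" for n
  proof (induction n)
    case 0
    have "admissible (\<lambda>_ _. 0)" using m by (auto simp: admissible_def)
    then show ?case by (simp add: zs_def)
  qed (simp add: zs_Suc S_def duhamel_admissible)
  note adm_z = adm[unfolded admissible_def]
  have step: "\<bar>zs (Suc n) \<xi> t - zs n \<xi> t\<bar> \<le> m * (1/2) ^ n * exp (decay * t)" if "\<xi> \<in> {-1..1}" "t \<le> T" for n \<xi> t
    using that
  proof (induction n arbitrary: \<xi> t)
    case 0
    show ?case
    proof (cases "t \<le> 0")
      case True
      then have "zs (Suc 0) \<xi> t = 0" "zs 0 \<xi> t = 0" using adm_z 0 by blast+
      then show ?thesis using m by simp
    next
      case False
      have "\<bar>zs (Suc 0) \<xi> t\<bar> \<le> m * exp (2 * L * t)" using adm_z 0 by blast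
      also have "\<dots> \<le> m * exp (decay * t)"
        using decay_ge(2) False m by (intro mult_left_mono) auto
      finally show ?thesis by (simp add: zs_def)
    qed
  next
    case (Suc n)
    have "\<bar>zs (Suc (Suc n)) \<xi> t - zs (Suc n) \<xi> t\<bar> \<le> m * (1/2) ^ n / 2 * exp (decay * t)"
      unfolding zs_Suc[of "Suc n"] zs_Suc[of n] S_def
      using duhamel_contraction[OF adm[of "Suc n"] adm[of n] _ Suc.IH Suc.prems] m
      unfolding zs_Suc[of n] S_def by simp
    then show ?case by (simp add: field_simps)
  qed
  define M where "M n = m * exp (decay * T) * (1/2) ^ n" for n :: nat
  have lim: "uniform_limit ?\<Omega> (\<lambda>n p. \<Sum>i<n. zs (Suc i) (fst p) (snd p) - zs i (fst p) (snd p))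
      (\<lambda>p. \<Sum>i. zs (Suc i) (fst p) (snd p) - zs i (fst p) (snd p)) sequentially"
  proof (rule Weierstrass_m_test)
    show "norm (zs (Suc n) (fst p) (snd p) - zs n (fst p) (snd p)) \<le> M n" if "p \<in> ?\<Omega>" for n p
    proof -
      have "norm (zs (Suc n) (fst p) (snd p) - zs n (fst p) (snd p)) \<le> m * (1/2) ^ n * exp (decay * snd p)"
        using step[of "fst p" "snd p" n] that by auto
      also have "\<dots> \<le> m * (1/2) ^ n * exp (decay * T)"
        using m decay_ge(1) that by (intro mult_left_mono) auto
      finally show ?thesis by (simp add: M_def mult_ac)
    qed
    show "summable M" unfolding M_def by (intro summable_mult summable_geometric) auto
  qed
  define Z where "Z \<xi> t = (\<Sum>i. zs (Suc i) \<xi> t - zs i \<xi> t)" for \<xi> t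
  have tele: "(\<Sum>i<n. zs (Suc i) \<xi> t - zs i \<xi> t) = zs n \<xi> t" for n \<xi> t
    using sum_lessThan_telescope[of "\<lambda>i. zs i \<xi> t" n] by (simp add: zs_def[of 0])
  have ul: "uniform_limit ?\<Omega> (\<lambda>n p. zs n (fst p) (snd p)) (\<lambda>p. Z (fst p) (snd p)) sequentially"
    using lim unfolding tele Z_def .
  have pw: "(\<lambda>n. zs n \<xi> t) \<longlonglongrightarrow> Z \<xi> t" if "\<xi> \<in> {-1..1}" "t \<le> T" for \<xi> t
    using tendsto_uniform_limitI[OF ul, of "(\<xi>, t)"] that by simp
  have Z0: "Z \<xi> t = 0" if "\<xi> \<in> {-1..1}" "t \<le> 0" for \<xi> t
  proof -
    have "zs n \<xi> t = 0" for n using adm_z that by blast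
    then have "(\<lambda>n. zs n \<xi> t) = (\<lambda>_. 0)" by blast
    moreover have "t \<le> T" using that T by simp
    ultimately have "(\<lambda>_. 0) \<longlonglongrightarrow> Z \<xi> t" using pw[OF that(1)] by metis
    then show ?thesis by (simp add: LIMSEQ_const_iff)
  qed
  have admZ: "admissible Z"
    unfolding admissible_def
  proof (intro conjI ballI allI impI)
    have "continuous_on ?\<Omega> (\<lambda>p. Z (fst p) (snd p))"
    proof (rule uniform_limit_theorem[OF _ ul])
      show "\<forall>\<^sub>F n in sequentially. continuous_on ?\<Omega> (\<lambda>p. zs n (fst p) (snd p))"
        using adm_z by (intro always_eventually allI) (simp add: case_prod_beta)
    qed simp
    then show "continuous_on ?\<Omega> (\<lambda>(\<xi>, t). Z \<xi> t)" by (simp add: case_prod_beta)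
    show "\<bar>Z \<xi> t\<bar> \<le> m * exp (2 * L * t)" if "\<xi> \<in> {-1..1}" "t \<le> T" for \<xi> t
    proof (rule LIMSEQ_le_const2[OF tendsto_rabs[OF pw[OF that]]])
      show "\<exists>N. \<forall>n\<ge>N. \<bar>zs n \<xi> t\<bar> \<le> m * exp (2 * L * t)" using adm_z that by blast
    qed
  qed (use Z0 in auto)
  have "duhamel (friction_rate Z) \<xi> t = Z \<xi> t" if p: "\<xi> \<in> {-1..1}" "t \<le> T" for \<xi> t
  proof (rule LIMSEQ_unique)
    show "(\<lambda>n. zs (Suc n) \<xi> t) \<longlonglongrightarrow> Z \<xi> t" using pw[OF p] by (rule LIMSEQ_Suc)
    show "(\<lambda>n. zs (Suc n) \<xi> t) \<longlonglongrightarrow> duhamel (friction_rate Z) \<xi> t"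
    proof (rule tendstoI)
      fix e :: real assume e: "e > 0"
      define \<epsilon> where "\<epsilon> = e / exp (decay * T)"
      have \<epsilon>: "\<epsilon> > 0" "\<epsilon> * exp (decay * T) = e" using e by (auto simp: \<epsilon>_def)
      have "\<forall>\<^sub>F n in sequentially. \<forall>p\<in>?\<Omega>. dist (zs n (fst p) (snd p)) (Z (fst p) (snd p)) < \<epsilon>"
        by (rule uniform_limitD[OF ul \<epsilon>(1)])
      then show "\<forall>\<^sub>F n in sequentially. dist (zs (Suc n) \<xi> t) (duhamel (friction_rate Z) \<xi> t) < e"
      proof eventually_elim
        case (elim n)
        have close: "\<bar>zs n \<xi> t - Z \<xi> t\<bar> \<le> \<epsilon> * exp (decay * t)" if q: "\<xi> \<in> {-1..1}" "t \<le> T" for \<xi> t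
        proof (cases "t \<le> 0")
          case True
          then have "zs n \<xi> t = 0" "Z \<xi> t = 0" using adm_z Z0 q by blast+
          then show ?thesis using \<epsilon> by simp
        next
          case False
          have "\<bar>zs n \<xi> t - Z \<xi> t\<bar> < \<epsilon>" using elim q by (auto simp: dist_real_def)
          also have "\<epsilon> \<le> \<epsilon> * exp (decay * t)" using False decay_ge(1) \<epsilon>(1) by simp
          finally show ?thesis by simp
        qed
        have "\<bar>zs (Suc n) \<xi> t - duhamel (friction_rate Z) \<xi> t\<bar> \<le> \<epsilon> / 2 * exp (decay * t)"
          unfolding zs_Suc S_def using \<epsilon>(1) by (intro duhamel_contraction adm admZ close p) auto
        also have "\<dots> \<le> \<epsilon> / 2 * exp (decay * T)"
          using \<epsilon>(1) decay_ge(1) p by (intro mult_left_mono) auto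
        also have "\<dots> < e" using \<epsilon>(2) e by simp
        finally show ?case by (simp add: dist_real_def)
      qed
    qed
  qed
  then show ?thesis using that admZ by blast
qed

lemma duhamel_time_deriv:
  assumes h: "continuous_on ({0..1} \<times> {..T}) (\<lambda>(x, t). h x t)" and h': "continuous_on ({0..1} \<times> {..T}) (\<lambda>(x, t). h' x t)"
    and d: "\<And>x t. x \<in> {0..1} \<Longrightarrow> t \<le> T \<Longrightarrow> (h x has_real_derivative h' x t) (at t within {..T})"
    and "\<xi> \<in> {-1..1}" "t \<le> T"
  shows "(duhamel h \<xi> has_real_derivative duhamel h' \<xi> t) (at t within {..T})"
  unfolding duhamel_def[abs_def]
proof (intro DERIV_minus weighted_integral_has_deriv[OF weight_fold_sgn])
  show "-(T+2) \<le> \<xi>" using T assms(4) by auto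
  show "((\<lambda>t. h (fold_pos \<eta>) (t - \<xi> + \<eta>)) has_real_derivative h' (fold_pos \<eta>) (t - \<xi> + \<eta>)) (at t within {..T})"
    if "\<eta> \<in> {-(T+2)..\<xi>}" "t \<le> T" for \<eta> t
  proof -
    have le: "t - \<xi> + \<eta> \<le> T" using that by auto
    have "(h (fold_pos \<eta>) has_real_derivative h' (fold_pos \<eta>) (t - \<xi> + \<eta>)) (at (t - \<xi> + \<eta>) within (\<lambda>t. t - \<xi> + \<eta>) ` {..T})"
      by (rule DERIV_subset[OF d[OF fold_pos_range le]]) (use that in auto)
    moreover have "((\<lambda>t. t - \<xi> + \<eta>) has_real_derivative 1) (at t within {..T})"
      by (auto intro!: derivative_eq_intros)
    ultimately show ?thesis using DERIV_image_chain by (fastforce simp: o_def)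
  qed
  show "continuous_on ({..T} \<times> {-(T+2)..\<xi>}) (\<lambda>(t, \<eta>). h' (fold_pos \<eta>) (t - \<xi> + \<eta>))"
  proof -
    have "continuous_on ({..T} \<times> {-(T+2)..\<xi>}) (\<lambda>q. case (fold_pos (snd q), fst q - \<xi> + snd q) of (x, t) \<Rightarrow> h' x t)"
      by (rule continuous_on_compose2[OF h'])
        (use fold_pos_range in \<open>auto intro!: continuous_intros continuous_on_compose2[OF fold_pos_continuous]\<close>)
    then show ?thesis by (simp add: case_prod_beta)
  qed
  show "continuous_on {-(T+2)..\<xi>} (\<lambda>\<eta>. h (fold_pos \<eta>) (t - \<xi> + \<eta>))" if "t \<le> T" for t
    by (rule duhamel_slice_continuous[OF h that])
qed (use assms in auto)

text \<open>Moving from \<open>(\<xi>0, t)\<close> to \<open>(\<xi>, t)\<close> is moving to \<open>(\<xi>0, t - \<xi> + \<xi>0)\<close>, which lies on the characteristic of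
  \<open>(\<xi>, t)\<close>, and then along this characteristic. The first step gives the time derivative, the second
  an integral \<open>R\<close> over a short piece on which the integrand is nearly constant. For \<open>\<xi> < \<xi>0\<close> the first
  step goes forward in time, hence the assumption \<open>t < T\<close>.\<close>

lemma duhamel_space_deriv:
  assumes h: "continuous_on ({0..1} \<times> {..T}) (\<lambda>(x, t). h x t)"
    and D: "(duhamel h \<xi>0 has_real_derivative D) (at t)"
    and \<xi>0: "\<xi>0 \<in> {-1<..<1}" "\<xi>0 \<noteq> 0" and t: "t < T"
  shows "((\<lambda>\<xi>. duhamel h \<xi> t) has_real_derivative - sgn \<xi>0 * h \<bar>\<xi>0\<bar> t - D) (at \<xi>0)"
proof -
  define k where "k \<xi> \<eta> = fold_sgn \<eta> * h (fold_pos \<eta>) (t - \<xi> + \<eta>)" for \<xi> \<eta>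
  define R where "R \<xi> = (if \<xi> \<ge> \<xi>0 then integral {\<xi>0..\<xi>} (k \<xi>) else - integral {\<xi>..\<xi>0} (k \<xi>))" for \<xi>
  \<comment> \<open>Within this distance \<open>\<eta>\<close> keeps the sign of \<open>\<xi>0\<close> and stays in \<open>(-1, 1)\<close>, and times stay below \<open>T\<close>.\<close>
  define r where "r = min (min \<bar>\<xi>0\<bar> (1 - \<bar>\<xi>0\<bar>)) (T - t)"
  have r: "r > 0" using \<xi>0 t by (auto simp: r_def)
  have ki: "k \<xi> integrable_on {\<alpha>..\<beta>}" if "t - \<xi> + \<beta> \<le> T" for \<xi> \<alpha> \<beta>
  proof -
    have "continuous_on {\<alpha>..\<beta>} (\<lambda>\<eta>. h (fold_pos \<eta>) ((t - \<xi> + \<beta>) - \<beta> + \<eta>))"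
      by (rule duhamel_slice_continuous[OF h that])
    then have "continuous_on {\<alpha>..\<beta>} (\<lambda>\<eta>. h (fold_pos \<eta>) (t - \<xi> + \<eta>))" by simp
    then show ?thesis unfolding k_def by (rule weighted_integrable[OF weight_fold_sgn])
  qed
  have split: "duhamel h \<xi> t = duhamel h \<xi>0 (t - \<xi> + \<xi>0) - R \<xi>" if "\<bar>\<xi> - \<xi>0\<bar> < r" for \<xi>
  proof -
    have b: "-(T+2) \<le> \<xi>" "-(T+2) \<le> \<xi>0" "t - \<xi> + \<xi>0 \<le> T" using that \<xi>0 T t by (auto simp: r_def)
    have e: "duhamel h \<xi> t = - integral {-(T+2)..\<xi>} (k \<xi>)" by (simp add: duhamel_def k_def[abs_def])
    have e0: "duhamel h \<xi>0 (t - \<xi> + \<xi>0) = - integral {-(T+2)..\<xi>0} (k \<xi>)"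
      by (simp add: duhamel_def k_def[abs_def] algebra_simps)
    show ?thesis
    proof (cases "\<xi> \<ge> \<xi>0")
      case True
      then show ?thesis
        using Henstock_Kurzweil_Integration.integral_combine[OF b(2) True ki[of \<xi> \<xi>]] t
        unfolding e e0 R_def by simp
    next
      case False
      then show ?thesis
        using Henstock_Kurzweil_Integration.integral_combine[OF b(1) _ ki[OF b(3)]]
        unfolding e e0 R_def by simp
    qed
  qed
  have fp: "fold_pos \<xi>0 = \<bar>\<xi>0\<bar>" using \<xi>0 by (intro fold_pos_abs) auto
  define h0 where "h0 = h \<bar>\<xi>0\<bar> t"
  have "(R has_real_derivative sgn \<xi>0 * h0) (at \<xi>0 within UNIV)"
  proof (rule deriv_estimateI)
    fix e :: real assume e: "e > 0"
    have "continuous_on ({-1<..<1} \<times> {..<T}) (\<lambda>q. case (fold_pos (fst q), snd q) of (x, t) \<Rightarrow> h x t)"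
      by (rule continuous_on_compose2[OF h])
        (use fold_pos_range in \<open>auto intro!: continuous_intros continuous_on_compose2[OF fold_pos_continuous]\<close>)
    then have "isCont (\<lambda>q. h (fold_pos (fst q)) (snd q)) (\<xi>0, t)"
      using \<xi>0 t by (simp add: continuous_on_eq_continuous_at open_Times)
    then obtain \<delta> where \<delta>: "\<delta> > 0" "\<And>q. dist q (\<xi>0, t) < \<delta> \<Longrightarrow> \<bar>h (fold_pos (fst q)) (snd q) - h0\<bar> < e"
      using e unfolding continuous_at_eps_delta by (auto simp: dist_real_def h0_def fp)
    have est: "\<bar>k \<xi> \<eta> - sgn \<xi>0 * h0\<bar> \<le> e"
      if "\<bar>\<xi> - \<xi>0\<bar> < min r (\<delta>/2)" "\<eta> \<in> {min \<xi> \<xi>0..max \<xi> \<xi>0}" for \<xi> \<eta>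
    proof -
      have "\<bar>\<eta> - \<xi>0\<bar> \<le> \<bar>\<xi> - \<xi>0\<bar>" "\<bar>(t - \<xi> + \<eta>) - t\<bar> \<le> \<bar>\<xi> - \<xi>0\<bar>"
        using that(2) by (auto simp: min_def max_def split: if_splits)
      then have 1: "\<bar>\<eta> - \<xi>0\<bar> < r" "\<bar>\<eta> - \<xi>0\<bar> < \<delta>/2" "\<bar>(t - \<xi> + \<eta>) - t\<bar> < \<delta>/2"
        using that(1) by linarith+
      have s: "fold_sgn \<eta> = sgn \<xi>0"
        using 1(1) \<xi>0 by (cases "\<xi>0 > 0") (auto simp: r_def intro!: fold_sgn_eq)
      have "dist (\<eta>, t - \<xi> + \<eta>) (\<xi>0, t) \<le> \<bar>\<eta> - \<xi>0\<bar> + \<bar>(t - \<xi> + \<eta>) - t\<bar>"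
        unfolding dist_Pair_Pair dist_real_def by (rule sqrt_sum_squares_le_sum_abs[THEN order_trans]) simp
      also have "\<dots> < \<delta>" using 1 by simp
      finally have "\<bar>h (fold_pos \<eta>) (t - \<xi> + \<eta>) - h0\<bar> < e" using \<delta>(2)[of "(\<eta>, t - \<xi> + \<eta>)"] by simp
      moreover have "k \<xi> \<eta> - sgn \<xi>0 * h0 = sgn \<xi>0 * (h (fold_pos \<eta>) (t - \<xi> + \<eta>) - h0)"
        by (simp add: k_def s right_diff_distrib)
      ultimately show ?thesis using \<xi>0(2) by (simp add: abs_mult abs_sgn_eq)
    qed
    have bound: "\<bar>integral {\<alpha>..\<beta>} (k \<xi>) - sgn \<xi>0 * h0 * (\<beta> - \<alpha>)\<bar> \<le> e * (\<beta> - \<alpha>)"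
      if \<xi>: "\<bar>\<xi> - \<xi>0\<bar> < min r (\<delta>/2)" and "\<alpha> = min \<xi> \<xi>0" "\<beta> = max \<xi> \<xi>0" for \<alpha> \<beta> \<xi>
    proof -
      have "\<beta> - \<xi> \<le> \<bar>\<xi> - \<xi>0\<bar>" "r \<le> T - t" unfolding that(3) r_def by (auto simp: max_def)
      then have le: "\<alpha> \<le> \<beta>" "t - \<xi> + \<beta> \<le> T" using that by linarith+
      note ik = ki[OF le(2), of \<alpha>]
      have "integral {\<alpha>..\<beta>} (\<lambda>\<eta>. k \<xi> \<eta> - sgn \<xi>0 * h0) = integral {\<alpha>..\<beta>} (k \<xi>) - sgn \<xi>0 * h0 * (\<beta> - \<alpha>)"
        using integral_diff[OF ik integrable_const_ivl[of "sgn \<xi>0 * h0" \<alpha> \<beta>]] le(1) by (simp add: mult.commute)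
      moreover have "norm (integral {\<alpha>..\<beta>} (\<lambda>\<eta>. k \<xi> \<eta> - sgn \<xi>0 * h0)) \<le> integral {\<alpha>..\<beta>} (\<lambda>_. e)"
        using est[OF \<xi>] that(2,3)
        by (intro integral_norm_bound_integral integrable_diff ik integrable_const_ivl) auto
      ultimately show ?thesis using le(1) by (simp add: mult.commute)
    qed
    have "\<bar>R \<xi> - R \<xi>0 - sgn \<xi>0 * h0 * (\<xi> - \<xi>0)\<bar> \<le> e * \<bar>\<xi> - \<xi>0\<bar>" if "\<bar>\<xi> - \<xi>0\<bar> < min r (\<delta>/2)" for \<xi>
    proof -
      have R0: "R \<xi>0 = 0" by (simp add: R_def)
      show ?thesis
      proof (cases "\<xi> \<ge> \<xi>0")
        case True
        then show ?thesis using bound[OF that, of \<xi>0 \<xi>] R0 by (simp add: R_def)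
      next
        case False
        have "sgn \<xi>0 * h0 * (\<xi> - \<xi>0) = - (sgn \<xi>0 * h0 * (\<xi>0 - \<xi>))" by (simp add: algebra_simps)
        then show ?thesis using False bound[OF that, of \<xi> \<xi>0] R0 by (simp add: R_def)
      qed
    qed
    then show "\<exists>d>0. \<forall>y\<in>UNIV. \<bar>y - \<xi>0\<bar> < d \<longrightarrow> \<bar>R y - R \<xi>0 - sgn \<xi>0 * h0 * (y - \<xi>0)\<bar> \<le> e * \<bar>y - \<xi>0\<bar>"
      using r \<delta>(1) by (intro exI[of _ "min r (\<delta>/2)"]) auto
  qed
  moreover have "((\<lambda>\<xi>. duhamel h \<xi>0 (t - \<xi> + \<xi>0)) has_real_derivative - D) (at \<xi>0)"
  proof -
    have "((\<lambda>\<xi>. t - \<xi> + \<xi>0) has_real_derivative -1) (at \<xi>0)"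
      by (auto intro!: derivative_eq_intros)
    then show ?thesis
      using DERIV_chain2[of "duhamel h \<xi>0" D "\<lambda>\<xi>. t - \<xi> + \<xi>0" \<xi>0 "-1" UNIV] D by simp
  qed
  ultimately have "((\<lambda>\<xi>. duhamel h \<xi>0 (t - \<xi> + \<xi>0) - R \<xi>) has_real_derivative - D - sgn \<xi>0 * h0) (at \<xi>0)"
    by (intro DERIV_diff) auto
  then have "((\<lambda>\<xi>. duhamel h \<xi> t) has_real_derivative - D - sgn \<xi>0 * h0) (at \<xi>0)"
    by (rule has_field_derivative_transform_within[OF _ r]) (use split in \<open>auto simp: dist_real_def\<close>)
  moreover have "- D - sgn \<xi>0 * h0 = - sgn \<xi>0 * h \<bar>\<xi>0\<bar> t - D" by (simp add: h0_def)
  ultimately show ?thesis by (simp only:)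
qed

text \<open>The integrands agree after a shift by the period \<open>2\<close>; the missing stretch \<open>[-(T + 2), -T]\<close> belongs to
  nonpositive times.\<close>

lemma duhamel_periodic:
  assumes h: "continuous_on ({0..1} \<times> {..T}) (\<lambda>(x, t). h x t)"
    and h0: "\<And>x t. x \<in> {0..1} \<Longrightarrow> t \<le> 0 \<Longrightarrow> h x t = 0" and "t \<le> T"
  shows "duhamel h 1 t = duhamel h (-1) t"
proof -
  define k where "k \<eta> = fold_sgn \<eta> * h (fold_pos \<eta>) (t - 1 + \<eta>)" for \<eta>
  have ki: "k integrable_on {-(T+2)..1}"
    unfolding k_def by (rule weighted_integrable[OF weight_fold_sgn duhamel_slice_continuous[OF h \<open>t \<le> T\<close>]])
  have "integral {-(T+2)..-1} (\<lambda>\<eta>. fold_sgn \<eta> * h (fold_pos \<eta>) (t - (-1) + \<eta>)) = integral {-(T+2)..-1} (k \<circ> (+) 2)"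
  proof (rule integral_cong)
    fix \<eta> :: real
    have "k (\<eta> + 2) = fold_sgn \<eta> * h (fold_pos \<eta>) (t - 1 + (\<eta> + 2))"
      by (simp only: k_def fold_periodic)
    then show "fold_sgn \<eta> * h (fold_pos \<eta>) (t - (-1) + \<eta>) = (k \<circ> (+) 2) \<eta>"
      by (simp add: algebra_simps)
  qed
  also have "\<dots> = integral {-T..1} k"
    using integral_shift_Icc_real[of "-(T+2)" "-1" k 2] by simp
  also have "\<dots> = integral {-(T+2)..-T} k + integral {-T..1} k"
  proof -
    have "integral {-(T+2)..-T} k = 0"
      unfolding k_def by (rule integral_eq_0) (use \<open>t \<le> T\<close> fold_pos_range in \<open>auto intro!: h0\<close>)
    then show ?thesis by simp
  qed
  also have "\<dots> = integral {-(T+2)..1} k"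
    using T ki by (intro Henstock_Kurzweil_Integration.integral_combine) auto
  finally show ?thesis by (simp add: duhamel_def k_def[abs_def])
qed

end

text \<open>Apply \<open>duhamel\<close> to \<open>a(u)\<close> for the fixed point \<open>Z\<close>. Differentiation in time gives \<open>w\<^sub>t = Z\<close>, and then the
  velocity reconstructed from \<open>w\<close> is the time integral of the one reconstructed from \<open>Z\<close>, so the friction
  is evaluated at the right velocity.\<close>

lemma (in reflected_wave) wave_solution:
  obtains w Z :: "real \<Rightarrow> real \<Rightarrow> real" where
    "continuous_on ({-1..1} \<times> {..T}) (\<lambda>(\<xi>, t). w \<xi> t)" "continuous_on ({-1..1} \<times> {..T}) (\<lambda>(\<xi>, t). Z \<xi> t)"
    "\<And>\<xi> t. \<xi> \<in> {-1..1} \<Longrightarrow> t \<le> T \<Longrightarrow> (w \<xi> has_real_derivative Z \<xi> t) (at t within {..T})"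
    "\<And>\<xi> t. t \<le> 0 \<Longrightarrow> w \<xi> t = 0" "\<And>t. t \<le> T \<Longrightarrow> w 1 t = w (-1) t"
    "\<And>\<xi> t. \<xi> \<in> {-1..1} \<Longrightarrow> t \<le> T \<Longrightarrow> \<bar>Z \<xi> t\<bar> \<le> m * exp (2 * L * T)"
    "\<And>x t. x \<in> {0<..<1} \<Longrightarrow> t < T \<Longrightarrow>
       ((\<lambda>x. w x t) has_real_derivative - a ((w x t - w (- x) t) / 2 + V x t) - Z x t) (at x)"
    "\<And>x t. x \<in> {0<..<1} \<Longrightarrow> t < T \<Longrightarrow>
       ((\<lambda>x. w (- x) t) has_real_derivative - a ((w x t - w (- x) t) / 2 + V x t) + Z (- x) t) (at x)"
proof -
  obtain Z where adm: "admissible Z" and fp: "\<And>\<xi> t. \<xi> \<in> {-1..1} \<Longrightarrow> t \<le> T \<Longrightarrow> duhamel (friction_rate Z) \<xi> t = Z \<xi> t"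
    using duhamel_fixpoint by blast
  define h where "h x t = a (u_of Z x t)" for x t
  define w where "w = duhamel h"
  have ac: "continuous_on UNIV a"
    using a_deriv by (meson DERIV_continuous continuous_at_imp_continuous_on)
  have "continuous_on ({0..1} \<times> {..T}) (\<lambda>p. a ((\<lambda>(x, t). u_of Z x t) p))"
    by (rule continuous_on_compose2[OF ac u_of_props(3)[OF adm]]) auto
  then have hc: "continuous_on ({0..1} \<times> {..T}) (\<lambda>(x, t). h x t)" by (simp add: h_def case_prod_beta)
  have h0: "h x t = 0" if "t \<le> 0" for x t using u_of_props(2)[OF adm that] a_0 by (simp add: h_def)
  have hd: "(h x has_real_derivative friction_rate Z x t) (at t within {..T})" if "x \<in> {0..1}" "t \<le> T" for x t
    unfolding h_def[abs_def] friction_rate_def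
    by (rule DERIV_chain2[OF a_deriv u_of_props(1)[OF adm that]])
  have wd: "(w \<xi> has_real_derivative Z \<xi> t) (at t within {..T})" if "\<xi> \<in> {-1..1}" "t \<le> T" for \<xi> t
    using duhamel_time_deriv[OF hc friction_rate_props(1)[OF adm] hd that] fp[OF that] by (simp add: w_def)
  have w0: "w \<xi> t = 0" if "t \<le> 0" for \<xi> t
    unfolding w_def by (rule duhamel_zero) (use h0 that in auto)
  have u: "u_of Z x t = (w x t - w (- x) t) / 2 + V x t" if x: "x \<in> {0..1}" and t: "t \<le> T" for x t
  proof -
    have x2: "x \<in> {-1..1}" "- x \<in> {-1..1}" using x by auto
    let ?f = "\<lambda>t. u_of Z x t - ((w x t - w (- x) t) / 2 + V x t)"
    have "(?f has_real_derivative ut_of Z x s - ((Z x s - Z (- x) s) / 2 + Vt x s)) (at s within {..T})" if "s \<le> T" for s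
      by (intro DERIV_diff DERIV_add DERIV_cdivide u_of_props(1)[OF adm x that] wd[OF x2(1) that] wd[OF x2(2) that] V_deriv[OF x that])
    then have "(?f has_real_derivative 0) (at s within {..T})" if "s \<in> {..T}" for s
      using that by (simp add: ut_of_def)
    then obtain c where c: "\<And>s. s \<in> {..T} \<Longrightarrow> ?f s = c"
      using has_field_derivative_zero_constant[of "{..T}" ?f] by auto
    have "?f 0 = 0" using u_of_props(2)[OF adm] w0 V_zero[OF x] by simp
    then have "c = 0" using c[of 0] T by simp
    then show ?thesis using c[of t] t by simp
  qed
  have sd: "((\<lambda>\<xi>. w \<xi> t) has_real_derivative - sgn \<xi> * h \<bar>\<xi>\<bar> t - Z \<xi> t) (at \<xi>)"
    if "\<xi> \<in> {-1<..<1}" "\<xi> \<noteq> 0" "t < T" for \<xi> t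
  proof -
    have "at t within {..T} = at t" by (rule at_within_interior) (use that in \<open>auto simp: interior_real_atMost\<close>)
    then have "(duhamel h \<xi> has_real_derivative Z \<xi> t) (at t)"
      using wd[of \<xi> t] that by (simp add: w_def)
    from duhamel_space_deriv[OF hc this that] show ?thesis by (simp add: w_def)
  qed
  show ?thesis
  proof (rule that[of w Z])
    show "continuous_on ({-1..1} \<times> {..T}) (\<lambda>(\<xi>, t). w \<xi> t)"
      unfolding w_def by (rule duhamel_continuous[OF hc])
    show "continuous_on ({-1..1} \<times> {..T}) (\<lambda>(\<xi>, t). Z \<xi> t)" using adm by (simp add: admissible_def)
    show "w 1 t = w (-1) t" if "t \<le> T" for t
      unfolding w_def by (rule duhamel_periodic[OF hc h0 that])
    show "\<bar>Z \<xi> t\<bar> \<le> m * exp (2 * L * T)" if "\<xi> \<in> {-1..1}" "t \<le> T" for \<xi> t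
    proof -
      have "m * exp (2 * L * t) \<le> m * exp (2 * L * T)" using m L that by (intro mult_left_mono) auto
      moreover have "\<bar>Z \<xi> t\<bar> \<le> m * exp (2 * L * t)" using adm that by (simp add: admissible_def)
      ultimately show ?thesis by linarith
    qed
    fix x t :: real assume x: "x \<in> {0<..<1}" and t: "t < T"
    have hu: "h x t = a ((w x t - w (- x) t) / 2 + V x t)"
      using u[of x t] x t by (simp add: h_def)
    show "((\<lambda>x. w x t) has_real_derivative - a ((w x t - w (- x) t) / 2 + V x t) - Z x t) (at x)"
      using sd[of x t] x t hu by simp
    have "((\<lambda>\<xi>. w \<xi> t) has_real_derivative h x t - Z (- x) t) (at (- x))"
      using sd[of "- x" t] x t by simp
    moreover have "((\<lambda>x :: real. - x) has_real_derivative -1) (at x)" by (auto intro!: derivative_eq_intros)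
    ultimately have "((\<lambda>x. w (- x) t) has_real_derivative (h x t - Z (- x) t) * -1) (at x)"
      by (rule DERIV_chain2[where f = "\<lambda>\<xi>. w \<xi> t" and g = "\<lambda>x. - x"])
    then show "((\<lambda>x. w (- x) t) has_real_derivative - a ((w x t - w (- x) t) / 2 + V x t) + Z (- x) t) (at x)"
      using hu by simp
  qed (use wd w0 in auto)
qed

section \<open>A continuously differentiable solution\<close>

text \<open>The data are continued by \<open>0\<close> to negative times and linearly beyond \<open>T\<close>. A signal leaving one end
  returns after two time units; a sum over enough reflections to cover the time span \<open>T\<close>
  inverts the difference operator \<open>\<Gamma>(t) \<mapsto> \<Gamma>(t) - \<Gamma>(t - 2)\<close>.\<close>

lemma boundary_extension:
  fixes g g' :: "real \<Rightarrow> real" and T M :: real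
  assumes T: "T > 0" and g: "\<And>t. t \<in> {0..T} \<Longrightarrow> (g has_real_derivative g' t) (at t within {0..T})"
    and g'c: "continuous_on {0..T} g'" and g0: "g 0 = 0" "g' 0 = 0" and M: "\<And>t. t \<in> {0..T} \<Longrightarrow> \<bar>g' t\<bar> \<le> M"
  obtains \<Gamma> \<Gamma>' :: "real \<Rightarrow> real" where
    "\<And>t. (\<Gamma> has_real_derivative \<Gamma>' t) (at t)" "continuous_on UNIV \<Gamma>'"
    "\<And>t. t \<le> 0 \<Longrightarrow> \<Gamma> t = 0" "\<And>t. t \<le> 0 \<Longrightarrow> \<Gamma>' t = 0" "\<And>t. \<bar>\<Gamma>' t\<bar> \<le> (\<lceil>T\<rceil> + 1) * M"
    "\<And>t. t \<in> {0..T} \<Longrightarrow> \<Gamma> t - \<Gamma> (t - 2) = g t"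
proof -
  \<comment> \<open>Clamping the argument extends \<open>g'\<close> by its boundary values, which is \<open>g'(0) = 0\<close> on the left.\<close>
  define \<gamma>' where "\<gamma>' t = g' (max 0 (min t T))" for t
  define \<gamma> where "\<gamma> t = integral {0..t} \<gamma>'" for t
  \<comment> \<open>At time \<open>t \<le> T\<close> the term \<open>\<gamma> (t - 2 N)\<close> left over by telescoping vanishes because \<open>T \<le> 2 N\<close>.\<close>
  define N where "N = nat \<lceil>T\<rceil> + 1"
  have N: "real N = real_of_int \<lceil>T\<rceil> + 1" using T by (simp add: N_def)
  have TN: "T \<le> real N" using N by linarith
  have \<gamma>'c: "continuous_on UNIV \<gamma>'"
    unfolding \<gamma>'_def by (rule continuous_on_compose2[OF g'c]) (use T in \<open>auto intro!: continuous_intros\<close>)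
  have \<gamma>'0: "\<gamma>' t = 0" if "t \<le> 0" for t using that T g0 by (simp add: \<gamma>'_def min_def max_def)
  have \<gamma>d: "(\<gamma> has_real_derivative \<gamma>' t) (at t)" for t
    unfolding \<gamma>_def[abs_def] by (rule primitive_has_deriv[OF \<gamma>'c \<gamma>'0])
  have \<gamma>0: "\<gamma> t = 0" if "t \<le> 0" for t
    unfolding \<gamma>_def using that \<gamma>'0 by (intro integral_eq_0) auto
  have M0: "M \<ge> 0" using M[of 0] T by auto
  have \<gamma>'M: "\<bar>\<gamma>' t\<bar> \<le> M" for t unfolding \<gamma>'_def using T by (intro M) auto
  have \<gamma>g: "\<gamma> t = g t" if t: "t \<in> {0..T}" for t
  proof -
    have "(g' has_integral g t - g 0) {0..t}"
      using t by (intro fundamental_theorem_of_calculus)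
        (auto simp: has_real_derivative_iff_has_vector_derivative[symmetric] intro: DERIV_subset[OF g])
    then have "integral {0..t} g' = g t" using g0 by (simp add: has_integral_iff)
    moreover have "integral {0..t} \<gamma>' = integral {0..t} g'"
      by (rule integral_cong) (use t in \<open>auto simp: \<gamma>'_def\<close>)
    ultimately show ?thesis by (simp add: \<gamma>_def)
  qed
  show ?thesis
  proof (rule that[of "\<lambda>t. \<Sum>k<N. \<gamma> (t - 2 * real k)" "\<lambda>t. \<Sum>k<N. \<gamma>' (t - 2 * real k)"])
    show "((\<lambda>t. \<Sum>k<N. \<gamma> (t - 2 * real k)) has_real_derivative (\<Sum>k<N. \<gamma>' (t - 2 * real k))) (at t)" for t
    proof (rule DERIV_sum)
      fix k
      show "((\<lambda>t. \<gamma> (t - 2 * real k)) has_real_derivative \<gamma>' (t - 2 * real k)) (at t)"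
        using DERIV_shift[of \<gamma> "\<gamma>' (t - 2 * real k)" t "- 2 * real k"] \<gamma>d by simp
    qed
    show "continuous_on UNIV (\<lambda>t. \<Sum>k<N. \<gamma>' (t - 2 * real k))"
      by (intro continuous_intros continuous_on_compose2[OF \<gamma>'c]) auto
    show "\<bar>\<Sum>k<N. \<gamma>' (t - 2 * real k)\<bar> \<le> (\<lceil>T\<rceil> + 1) * M" for t
      using sum_bounded_above[of "{..<N}" "\<lambda>k. \<bar>\<gamma>' (t - 2 * real k)\<bar>" M] \<gamma>'M N
      by (intro order_trans[OF sum_abs]) simp
    show "(\<Sum>k<N. \<gamma> (t - 2 * real k)) - (\<Sum>k<N. \<gamma> (t - 2 - 2 * real k)) = g t" if t: "t \<in> {0..T}" for t
    proof -
      have "(\<Sum>k<N. \<gamma> (t - 2 * real k)) - (\<Sum>k<N. \<gamma> (t - 2 - 2 * real k))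
          = (\<Sum>k<N. \<gamma> (t - 2 * real k) - \<gamma> (t - 2 * real (Suc k)))"
        by (simp add: sum_subtractf algebra_simps)
      also have "\<dots> = \<gamma> (t - 2 * real 0) - \<gamma> (t - 2 * real N)"
        using sum_lessThan_telescope'[of "\<lambda>k. \<gamma> (t - 2 * real k)" N] by simp
      also have "\<gamma> (t - 2 * real N) = 0" using t TN by (intro \<gamma>0) auto
      finally show ?thesis using \<gamma>g[OF t] by simp
    qed
  qed (auto intro!: sum.neutral \<gamma>0 \<gamma>'0)
qed

text \<open>The frictionless flow \<open>(Q, V)\<close> is a superposition of travelling waves \<open>\<Gamma>\<^sub>i(t \<plusminus> x)\<close>, arranged so that all
  terms of \<open>V\<close> at an end cancel except \<open>\<Gamma>\<^sub>i(t) - \<Gamma>\<^sub>i(t - 2)\<close>. The reflected problem is solved up to time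
  \<open>T + 1\<close>, since its space derivative is available strictly before the final time.\<close>

lemma smooth_solution:
  fixes a b g0 g0' g1 g1' :: "real \<Rightarrow> real" and T L K M B c :: real
  assumes T: "T > 0" and L: "L > 0" and K: "K \<ge> 0"
    and a: "\<And>y. (a has_real_derivative b y) (at y)" "a 0 = 0"
    and b: "\<And>y. \<bar>b y\<bar> \<le> L" "\<And>y z. \<bar>b y - b z\<bar> \<le> K * \<bar>y - z\<bar>"
    and g0: "\<And>t. t \<in> {0..T} \<Longrightarrow> (g0 has_real_derivative g0' t) (at t within {0..T})" "continuous_on {0..T} g0'"
      "g0 0 = 0" "g0' 0 = 0" "\<And>t. t \<in> {0..T} \<Longrightarrow> \<bar>g0' t\<bar> \<le> M"
    and g1: "\<And>t. t \<in> {0..T} \<Longrightarrow> (g1 has_real_derivative g1' t) (at t within {0..T})" "continuous_on {0..T} g1'"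
      "g1 0 = 0" "g1' 0 = 0" "\<And>t. t \<in> {0..T} \<Longrightarrow> \<bar>g1' t\<bar> \<le> M"
    and B: "B = 8 * ((\<lceil>T\<rceil> + 1) * M) * exp (2 * L * (T + 1))"
  obtains p u pt ut :: "real \<Rightarrow> real \<Rightarrow> real" where
    "continuous_on ({0..T} \<times> {0..1}) (\<lambda>(t, x). p t x)" "continuous_on ({0..T} \<times> {0..1}) (\<lambda>(t, x). u t x)"
    "continuous_on ({0..T} \<times> {0..1}) (\<lambda>(t, x). pt t x)" "continuous_on ({0..T} \<times> {0..1}) (\<lambda>(t, x). ut t x)"
    "\<And>t x. t \<in> {0..T} \<Longrightarrow> x \<in> {0..1} \<Longrightarrow> ((\<lambda>s. p s x) has_real_derivative pt t x) (at t within {0..T})"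
    "\<And>t x. t \<in> {0..T} \<Longrightarrow> x \<in> {0..1} \<Longrightarrow> ((\<lambda>s. u s x) has_real_derivative ut t x) (at t within {0..T})"
    "\<And>t x. t \<in> {0..T} \<Longrightarrow> x \<in> {0<..<1} \<Longrightarrow> (u t has_real_derivative - pt t x) (at x)"
    "\<And>t x. t \<in> {0..T} \<Longrightarrow> x \<in> {0<..<1} \<Longrightarrow> (p t has_real_derivative - ut t x - a (u t x)) (at x)"
    "\<And>t. t \<in> {0..T} \<Longrightarrow> u t 0 = g0 t" "\<And>t. t \<in> {0..T} \<Longrightarrow> u t 1 = g1 t"
    "\<And>x. x \<in> {0..1} \<Longrightarrow> p 0 x = c" "\<And>x. x \<in> {0..1} \<Longrightarrow> u 0 x = 0"
    "\<And>t x. t \<in> {0..T} \<Longrightarrow> x \<in> {0..1} \<Longrightarrow> \<bar>pt t x\<bar> \<le> B" "\<And>t x. t \<in> {0..T} \<Longrightarrow> x \<in> {0..1} \<Longrightarrow> \<bar>ut t x\<bar> \<le> B"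
proof -
  obtain G0 G0' where G0: "\<And>t. (G0 has_real_derivative G0' t) (at t)" "continuous_on UNIV G0'"
    "\<And>t. t \<le> 0 \<Longrightarrow> G0 t = 0" "\<And>t. t \<le> 0 \<Longrightarrow> G0' t = 0" "\<And>t. \<bar>G0' t\<bar> \<le> (\<lceil>T\<rceil> + 1) * M"
    "\<And>t. t \<in> {0..T} \<Longrightarrow> G0 t - G0 (t - 2) = g0 t"
    using boundary_extension[OF T g0] by blast
  obtain G1 G1' where G1: "\<And>t. (G1 has_real_derivative G1' t) (at t)" "continuous_on UNIV G1'"
    "\<And>t. t \<le> 0 \<Longrightarrow> G1 t = 0" "\<And>t. t \<le> 0 \<Longrightarrow> G1' t = 0" "\<And>t. \<bar>G1' t\<bar> \<le> (\<lceil>T\<rceil> + 1) * M"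
    "\<And>t. t \<in> {0..T} \<Longrightarrow> G1 t - G1 (t - 2) = g1 t"
    using boundary_extension[OF T g1] by blast
  \<comment> \<open>Each of the four travelling waves contributes at most \<open>(\<lceil>T\<rceil> + 1) * M\<close>.\<close>
  define m where "m = 4 * ((\<lceil>T\<rceil> + 1) * M)"
  define V where "V x t = G0 (t - x) - G0 (t + x - 2) + G1 (t - 1 + x) - G1 (t - 1 - x)" for x t
  define Vt where "Vt x t = G0' (t - x) - G0' (t + x - 2) + G1' (t - 1 + x) - G1' (t - 1 - x)" for x t
  define Q where "Q x t = G0 (t - x) + G0 (t + x - 2) - G1 (t - 1 + x) - G1 (t - 1 - x)" for x t
  define Qt where "Qt x t = G0' (t - x) + G0' (t + x - 2) - G1' (t - 1 + x) - G1' (t - 1 - x)" for x t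
  have G0c: "continuous_on UNIV G0" and G1c: "continuous_on UNIV G1"
    using G0(1) G1(1) by (meson DERIV_continuous continuous_at_imp_continuous_on)+
  note comp = continuous_on_compose2[OF G0c] continuous_on_compose2[OF G1c]
    continuous_on_compose2[OF G0(2)] continuous_on_compose2[OF G1(2)]
  have cont: "continuous_on S (\<lambda>(x, t). V x t)" "continuous_on S (\<lambda>(x, t). Vt x t)"
    "continuous_on S (\<lambda>(x, t). Q x t)" "continuous_on S (\<lambda>(x, t). Qt x t)" for S
    unfolding V_def Vt_def Q_def Qt_def case_prod_beta by (intro continuous_intros comp; simp)+
  note chain = DERIV_chain2[OF G0(1)] DERIV_chain2[OF G1(1)]
  have Vd: "(V x has_real_derivative Vt x t) (at t within S)" and Qd: "(Q x has_real_derivative Qt x t) (at t within S)" for x t S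
    unfolding V_def[abs_def] Vt_def Q_def[abs_def] Qt_def by (rule derivative_eq_intros chain refl | simp)+
  have Vx: "((\<lambda>x. V x t) has_real_derivative - Qt x t) (at x)" and Qx: "((\<lambda>x. Q x t) has_real_derivative - Vt x t) (at x)" for x t
    unfolding V_def[abs_def] Vt_def Q_def[abs_def] Qt_def by (rule derivative_eq_intros chain refl | simp)+
  have V0: "V x t = 0" "Vt x t = 0" "Q x t = 0" if "x \<in> {0..1}" "t \<le> 0" for x t
    using that by (simp_all add: V_def Vt_def Q_def G0(3,4) G1(3,4))
  have Vb: "\<bar>Vt x t\<bar> \<le> m" "\<bar>Qt x t\<bar> \<le> m" for x t
    using G0(5)[of "t - x"] G0(5)[of "t + x - 2"] G1(5)[of "t - 1 + x"] G1(5)[of "t - 1 - x"]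
    unfolding Vt_def Qt_def m_def by linarith+
  have m0: "m \<ge> 0" using Vb(1)[of 0 0] by simp
  interpret W: reflected_wave "T + 1" L K m a b V Vt
    by unfold_locales (use T L K m0 a b Vd cont V0 Vb in auto)
  obtain w Z where w: "continuous_on ({-1..1} \<times> {..T + 1}) (\<lambda>(\<xi>, t). w \<xi> t)" "continuous_on ({-1..1} \<times> {..T + 1}) (\<lambda>(\<xi>, t). Z \<xi> t)"
    "\<And>\<xi> t. \<xi> \<in> {-1..1} \<Longrightarrow> t \<le> T + 1 \<Longrightarrow> (w \<xi> has_real_derivative Z \<xi> t) (at t within {..T + 1})"
    "\<And>\<xi> t. t \<le> 0 \<Longrightarrow> w \<xi> t = 0" "\<And>t. t \<le> T + 1 \<Longrightarrow> w 1 t = w (-1) t"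
    "\<And>\<xi> t. \<xi> \<in> {-1..1} \<Longrightarrow> t \<le> T + 1 \<Longrightarrow> \<bar>Z \<xi> t\<bar> \<le> m * exp (2 * L * (T + 1))"
    "\<And>x t. x \<in> {0<..<1} \<Longrightarrow> t < T + 1 \<Longrightarrow>
       ((\<lambda>x. w x t) has_real_derivative - a ((w x t - w (- x) t) / 2 + V x t) - Z x t) (at x)"
    "\<And>x t. x \<in> {0<..<1} \<Longrightarrow> t < T + 1 \<Longrightarrow>
       ((\<lambda>x. w (- x) t) has_real_derivative - a ((w x t - w (- x) t) / 2 + V x t) + Z (- x) t) (at x)"
    using W.wave_solution by blast
  define u where "u t x = (w x t - w (- x) t) / 2 + V x t" for t x
  define p where "p t x = c + Q x t + (w x t + w (- x) t) / 2" for t x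
  define ut where "ut t x = (Z x t - Z (- x) t) / 2 + Vt x t" for t x
  define pt where "pt t x = Qt x t + (Z x t + Z (- x) t) / 2" for t x
  have swap: "continuous_on ({0..T} \<times> {0..1}) (\<lambda>q. f (snd q) (fst q))" "continuous_on ({0..T} \<times> {0..1}) (\<lambda>q. f (- snd q) (fst q))"
    if "continuous_on ({-1..1} \<times> {..T + 1}) (\<lambda>(\<xi>, t). f \<xi> t)" for f :: "real \<Rightarrow> real \<Rightarrow> real"
  proof -
    have "continuous_on ({0..T} \<times> {0..1}) (\<lambda>q. case (snd q, fst q) of (\<xi>, t) \<Rightarrow> f \<xi> t)"
      by (rule continuous_on_compose2[OF that]) (auto intro!: continuous_intros)
    then show "continuous_on ({0..T} \<times> {0..1}) (\<lambda>q. f (snd q) (fst q))" by simp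
    have "continuous_on ({0..T} \<times> {0..1}) (\<lambda>q. case (- snd q, fst q) of (\<xi>, t) \<Rightarrow> f \<xi> t)"
      by (rule continuous_on_compose2[OF that]) (auto intro!: continuous_intros)
    then show "continuous_on ({0..T} \<times> {0..1}) (\<lambda>q. f (- snd q) (fst q))" by simp
  qed
  note c' = swap[OF w(1)] swap[OF w(2)] swap(1)[OF cont(1)] swap(1)[OF cont(2)] swap(1)[OF cont(3)] swap(1)[OF cont(4)]
  have e1: "exp (2 * L * (T + 1)) \<ge> 1" using T L by simp
  have B': "B = m * exp (2 * L * (T + 1)) + m * exp (2 * L * (T + 1))"
    by (simp add: B m_def)
  have mB: "m \<le> m * exp (2 * L * (T + 1))" using m0 mult_left_mono[OF e1 m0] by simp
  show ?thesis
  proof (rule that[of p u pt ut])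
    show "continuous_on ({0..T} \<times> {0..1}) (\<lambda>(t, x). p t x)" "continuous_on ({0..T} \<times> {0..1}) (\<lambda>(t, x). u t x)"
      "continuous_on ({0..T} \<times> {0..1}) (\<lambda>(t, x). pt t x)" "continuous_on ({0..T} \<times> {0..1}) (\<lambda>(t, x). ut t x)"
      unfolding p_def u_def pt_def ut_def case_prod_beta by (intro continuous_intros c'; simp)+
    show "u t 0 = g0 t" if "t \<in> {0..T}" for t using G0(6)[OF that] by (simp add: u_def V_def)
    show "u t 1 = g1 t" if "t \<in> {0..T}" for t using G1(6)[OF that] w(5)[of t] that by (simp add: u_def V_def)
    show "p 0 x = c" "u 0 x = 0" if "x \<in> {0..1}" for x using V0[OF that, of 0] w(4) by (simp_all add: p_def u_def)
    fix t x :: real assume t: "t \<in> {0..T}"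
    {
      assume x: "x \<in> {0..1}"
      have x2: "x \<in> {-1..1}" "- x \<in> {-1..1}" "t \<le> T + 1" using x t by auto
      have wd: "(w \<xi> has_real_derivative Z \<xi> t) (at t within {0..T})" if "\<xi> \<in> {-1..1}" for \<xi>
        by (rule DERIV_subset[OF w(3)[OF that x2(3)]]) auto
      show "((\<lambda>s. p s x) has_real_derivative pt t x) (at t within {0..T})"
        unfolding p_def pt_def using wd[OF x2(1)] wd[OF x2(2)] Qd[of x t]
        by (auto intro!: derivative_eq_intros)
      show "((\<lambda>s. u s x) has_real_derivative ut t x) (at t within {0..T})"
        unfolding u_def ut_def using wd[OF x2(1)] wd[OF x2(2)] Vd[of x t]
        by (auto intro!: derivative_eq_intros)
      show "\<bar>pt t x\<bar> \<le> B" "\<bar>ut t x\<bar> \<le> B"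
        using w(6)[OF x2(1,3)] w(6)[OF x2(2,3)] Vb[of x t] mB
        unfolding pt_def ut_def B' abs_le_iff by (simp_all add: field_simps)
    }
    {
      assume x: "x \<in> {0<..<1}"
      have t': "t < T + 1" using t by auto
      show "(u t has_real_derivative - pt t x) (at x)"
        unfolding u_def[abs_def] pt_def using w(7,8)[OF x t'] Vx[of t x]
        by (auto intro!: derivative_eq_intros simp: field_simps)
      show "(p t has_real_derivative - ut t x - a (u t x)) (at x)"
        unfolding p_def[abs_def] ut_def u_def using w(7,8)[OF x t'] Qx[of t x]
        by (auto intro!: derivative_eq_intros simp: field_simps)
    }
  qed
qed

section \<open>From pointwise to square integrable derivatives\<close>

lemma continuous_integrable_unit:
  fixes f :: "real \<Rightarrow> real"
  assumes "continuous_on {0..1} f"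
  shows "integrable (lebesgue_on unit_ivl) f"
  by (rule integrable_lebesgue_on_subset[OF continuous_imp_integrable_real[OF assms]]) auto

lemma L2_continuous:
  assumes "continuous_on {0..1} f" shows "f \<in> L2"
proof -
  have "continuous_on {0..1} (\<lambda>x. (f x)\<^sup>2)" by (intro continuous_intros assms)
  from continuous_integrable_unit[OF this] borel_measurable_integrable[OF continuous_integrable_unit[OF assms]]
  show ?thesis by (simp add: L2_def)
qed

lemma L2_norm_le:
  assumes "f \<in> L2" "\<And>x. x \<in> unit_ivl \<Longrightarrow> \<bar>f x\<bar> \<le> B" "B \<ge> 0"
  shows "L2_norm f \<le> B"
proof -
  have "(LINT x|lebesgue_on unit_ivl. (f x)\<^sup>2) \<le> (LINT x|lebesgue_on unit_ivl. B\<^sup>2)"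
  proof (rule integral_mono_AE)
    show "integrable (lebesgue_on unit_ivl) (\<lambda>_. B\<^sup>2)" by (rule continuous_integrable_unit) simp
    show "AE x in lebesgue_on unit_ivl. (f x)\<^sup>2 \<le> B\<^sup>2"
    proof (rule AE_I2)
      fix x assume "x \<in> space (lebesgue_on unit_ivl)"
      then have "\<bar>f x\<bar> \<le> \<bar>B\<bar>" using assms(2)[of x] assms(3) by simp
      then show "(f x)\<^sup>2 \<le> B\<^sup>2" by (simp add: abs_le_square_iff)
    qed
  qed (rule L2_square_integrable[OF assms(1)])
  also have "\<dots> = B\<^sup>2" by (simp add: measure_restrict_space)
  finally have "(L2_norm f)\<^sup>2 \<le> B\<^sup>2" by (simp add: L2_norm_def)
  then show ?thesis by (rule power2_le_imp_le[OF _ assms(3)])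
qed

text \<open>On an interval of length one the \<open>L\<^sup>2\<close> norm is dominated by the supremum norm.\<close>

lemma L2_norm_tendsto_0:
  assumes "\<And>e. e > 0 \<Longrightarrow> \<forall>\<^sub>F s in F. D s \<in> L2 \<and> (\<forall>x\<in>unit_ivl. \<bar>D s x\<bar> \<le> e)"
  shows "((\<lambda>s. L2_norm (D s)) \<longlongrightarrow> 0) F"
proof (rule tendstoI)
  fix e :: real assume e: "e > 0"
  have "e / 2 > 0" using e by simp
  from assms[OF this] show "\<forall>\<^sub>F s in F. dist (L2_norm (D s)) 0 < e"
  proof eventually_elim
    case (elim s)
    then have "L2_norm (D s) \<le> e / 2" using e by (intro L2_norm_le) auto
    then show ?case using e L2_norm_nonneg[of "D s"] by (simp add: dist_real_def)
  qed
qed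

lemma uniform_in_space:
  fixes w :: "real \<Rightarrow> real \<Rightarrow> real"
  assumes w: "continuous_on ({0..T} \<times> {0..1}) (\<lambda>(t, x). w t x)" and "t \<in> {0..T}" "e > 0"
  obtains X where "open X" "t \<in> X" "\<And>s x. s \<in> X \<Longrightarrow> s \<in> {0..T} \<Longrightarrow> x \<in> {0..1} \<Longrightarrow> \<bar>w s x - w t x\<bar> \<le> e"
proof -
  obtain X where X: "t \<in> X" "open X"
    "\<forall>s\<in>X \<inter> {0..T}. \<forall>x\<in>{0..1}. dist (case (s, x) of (t, x) \<Rightarrow> w t x) (case (t, x) of (t, x) \<Rightarrow> w t x) \<le> e"
    using continuous_on_prod_compactE[OF w compact_Icc assms(2,3)] by metis
  have "\<bar>w s x - w t x\<bar> \<le> e" if "s \<in> X" "s \<in> {0..T}" "x \<in> {0..1}" for s x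
    using X(3) that by (auto simp: dist_real_def)
  then show ?thesis using that X by blast
qed

lemma L2_norm_diff_tendsto_0:
  fixes w :: "real \<Rightarrow> real \<Rightarrow> real"
  assumes w: "continuous_on ({0..T} \<times> {0..1}) (\<lambda>(t, x). w t x)" and t: "t \<in> {0..T}"
  shows "((\<lambda>s. L2_norm (\<lambda>x. w s x - w t x)) \<longlongrightarrow> 0) (at t within {0..T})"
proof (rule L2_norm_tendsto_0)
  fix e :: real assume "e > 0"
  then obtain X where X: "open X" "t \<in> X" "\<And>s x. s \<in> X \<Longrightarrow> s \<in> {0..T} \<Longrightarrow> x \<in> {0..1} \<Longrightarrow> \<bar>w s x - w t x\<bar> \<le> e"
    using uniform_in_space[OF w t] by metis
  have "\<forall>\<^sub>F s in at t within {0..T}. s \<in> X \<and> s \<in> {0..T}"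
    using X(1,2) by (auto simp: eventually_at_topological)
  then show "\<forall>\<^sub>F s in at t within {0..T}. (\<lambda>x. w s x - w t x) \<in> L2 \<and> (\<forall>x\<in>unit_ivl. \<bar>w s x - w t x\<bar> \<le> e)"
  proof eventually_elim
    case (elim s)
    then show ?case
      using X(3) by (auto intro!: L2_continuous continuous_intros continuous_on_slice[OF w] t)
  qed
qed

lemma C0_in_L2_continuous:
  fixes w :: "real \<Rightarrow> real \<Rightarrow> real"
  assumes "continuous_on ({0..T} \<times> {0..1}) (\<lambda>(t, x). w t x)"
  shows "C0_in T L2 L2_norm w"
  unfolding C0_in_def
  using L2_continuous[OF continuous_on_slice[OF assms]] L2_norm_diff_tendsto_0[OF assms] by blast

text \<open>By the mean value inequality the difference quotients converge uniformly in \<open>x\<close>.\<close>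

lemma has_time_deriv_pointwise:
  fixes w w' :: "real \<Rightarrow> real \<Rightarrow> real"
  assumes w: "continuous_on ({0..T} \<times> {0..1}) (\<lambda>(t, x). w t x)"
    and w': "continuous_on ({0..T} \<times> {0..1}) (\<lambda>(t, x). w' t x)"
    and d: "\<And>t x. t \<in> {0..T} \<Longrightarrow> x \<in> {0..1} \<Longrightarrow> ((\<lambda>s. w s x) has_real_derivative w' t x) (at t within {0..T})"
    and t: "t \<in> {0..T}"
  shows "has_time_deriv T L2 L2_norm w t (w' t)"
  unfolding has_time_deriv_def
proof
  show "w' t \<in> L2" by (rule L2_continuous[OF continuous_on_slice[OF w' t]])
  show "((\<lambda>s. L2_norm (\<lambda>x. (w s x - w t x) / (s - t) - w' t x)) \<longlongrightarrow> 0) (at t within {0..T})"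
  proof (rule L2_norm_tendsto_0)
    fix e :: real assume "e > 0"
    then obtain X where X: "open X" "t \<in> X" "\<And>s x. s \<in> X \<Longrightarrow> s \<in> {0..T} \<Longrightarrow> x \<in> {0..1} \<Longrightarrow> \<bar>w' s x - w' t x\<bar> \<le> e"
      using uniform_in_space[OF w' t] by metis
    obtain \<delta> where \<delta>: "\<delta> > 0" "ball t \<delta> \<subseteq> X" using X openE by blast
    have "\<forall>\<^sub>F s in at t within {0..T}. s \<in> ball t \<delta> \<and> s \<in> {0..T} \<and> s \<noteq> t"
      using \<delta>(1) by (auto simp: eventually_at_topological intro!: exI[of _ "ball t \<delta>"])
    then show "\<forall>\<^sub>F s in at t within {0..T}. (\<lambda>x. (w s x - w t x) / (s - t) - w' t x) \<in> L2 \<and>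
        (\<forall>x\<in>unit_ivl. \<bar>(w s x - w t x) / (s - t) - w' t x\<bar> \<le> e)"
    proof eventually_elim
      case (elim s)
      have "(\<lambda>x. (w s x - w t x) / (s - t) - w' t x) \<in> L2"
        using elim t by (intro L2_diff L2_scale L2_continuous continuous_on_slice[OF w] continuous_on_slice[OF w']) auto
      moreover have "\<bar>(w s x - w t x) / (s - t) - w' t x\<bar> \<le> e" if x: "x \<in> unit_ivl" for x
      proof -
        have x1: "x \<in> {0..1}" using x by auto
        let ?S = "closed_segment t s"
        have S: "?S \<subseteq> {0..T}" "?S \<subseteq> X"
        proof -
          show "?S \<subseteq> {0..T}" using elim t by (intro closed_segment_subset) auto
          have "?S \<subseteq> ball t \<delta>" using elim \<delta>(1) by (intro closed_segment_subset) auto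
          then show "?S \<subseteq> X" using \<delta>(2) by blast
        qed
        have "norm ((w s x - w' t x * s) - (w t x - w' t x * t)) \<le> e * norm (s - t)"
        proof (rule field_differentiable_bound[where S = ?S and f = "\<lambda>r. w r x - w' t x * r" and f' = "\<lambda>r. w' r x - w' t x"])
          fix r assume r: "r \<in> ?S"
          have "((\<lambda>s. w s x) has_real_derivative w' r x) (at r within ?S)"
            by (rule DERIV_subset[OF d]) (use r S x1 in auto)
          then show "((\<lambda>r. w r x - w' t x * r) has_real_derivative w' r x - w' t x) (at r within ?S)"
            by (auto intro!: derivative_eq_intros)
          have "r \<in> X" "r \<in> {0..T}" using r S by auto
          then show "norm (w' r x - w' t x) \<le> e" using X(3)[of r x] x1 by simp
        qed auto
        moreover have "(w s x - w t x) / (s - t) - w' t x = ((w s x - w' t x * s) - (w t x - w' t x * t)) / (s - t)"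
          using elim by (simp add: field_simps)
        ultimately show ?thesis using elim by (simp add: pos_divide_le_eq)
      qed
      ultimately show ?case by blast
    qed
  qed
qed

lemma has_time_deriv_unique:
  assumes T: "T > 0" and t: "t \<in> {0..T}" and w: "\<And>s. s \<in> {0..T} \<Longrightarrow> w s \<in> L2"
    and q: "has_time_deriv T L2 L2_norm w t q" "has_time_deriv T L2 L2_norm w t r"
  shows "AE x in lebesgue_on unit_ivl. q x = r x"
proof -
  have qr: "(\<lambda>x. q x - r x) \<in> L2" using q by (intro L2_diff) (auto simp: has_time_deriv_def)
  have "has_time_deriv T L2 L2_norm (\<lambda>t x. w t x - w t x) t (\<lambda>x. q x - r x)"
    by (rule has_time_deriv_diff[OF q w w t])
  then have "((\<lambda>s. L2_norm (\<lambda>x. - (q x - r x))) \<longlongrightarrow> 0) (at t within {0..T})"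
    by (simp add: has_time_deriv_def)
  moreover have "at t within {0..T} \<noteq> bot"
    using T t by (simp add: at_within_Icc_at trivial_limit_within islimpt_Icc)
  ultimately have "L2_norm (\<lambda>x. - (q x - r x)) = 0"
    using tendsto_unique tendsto_const by blast
  then have "L2_norm (\<lambda>x. q x - r x) = 0" by (simp add: L2_norm_def power2_commute)
  from L2_norm_eq_0[OF qr this] show ?thesis by eventually_elim simp
qed

text \<open>The derivative \<open>time_deriv\<close> is an arbitrary choice at every time; uniqueness of derivatives up to null
  sets carries continuity over from \<open>w'\<close>.\<close>

lemma C1_in_pointwise:
  fixes w w' :: "real \<Rightarrow> real \<Rightarrow> real"
  assumes T: "T > 0" and w: "continuous_on ({0..T} \<times> {0..1}) (\<lambda>(t, x). w t x)"
    and w': "continuous_on ({0..T} \<times> {0..1}) (\<lambda>(t, x). w' t x)"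
    and d: "\<And>t x. t \<in> {0..T} \<Longrightarrow> x \<in> {0..1} \<Longrightarrow> ((\<lambda>s. w s x) has_real_derivative w' t x) (at t within {0..T})"
  shows "C1_in T L2 L2_norm w"
    and "\<And>t. t \<in> {0..T} \<Longrightarrow> AE x in lebesgue_on unit_ivl. dt T w t x = w' t x"
    and "\<And>t. t \<in> {0..T} \<Longrightarrow> dt T w t \<in> L2"
proof -
  note htd = has_time_deriv_pointwise[OF w w' d]
  have wL: "w s \<in> L2" if "s \<in> {0..T}" for s by (rule L2_continuous[OF continuous_on_slice[OF w that]])
  have w'L: "w' s \<in> L2" if "s \<in> {0..T}" for s by (rule L2_continuous[OF continuous_on_slice[OF w' that]])
  have htd': "has_time_deriv T L2 L2_norm w t (dt T w t)" if "t \<in> {0..T}" for t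
    unfolding time_deriv_def using htd[OF _ _ that] by (rule someI[of "has_time_deriv T L2 L2_norm w t"])
  show ae: "AE x in lebesgue_on unit_ivl. dt T w t x = w' t x" if "t \<in> {0..T}" for t
    by (rule has_time_deriv_unique[OF T that wL htd'[OF that] htd[OF _ _ that]])
  show dL: "dt T w t \<in> L2" if "t \<in> {0..T}" for t using htd'[OF that] by (simp add: has_time_deriv_def)
  have "((\<lambda>s. L2_norm (\<lambda>x. dt T w s x - dt T w t x)) \<longlongrightarrow> 0) (at t within {0..T})" if t: "t \<in> {0..T}" for t
  proof (rule Lim_transform_eventually[OF L2_norm_diff_tendsto_0[OF w' t]])
    show "\<forall>\<^sub>F s in at t within {0..T}. L2_norm (\<lambda>x. w' s x - w' t x) = L2_norm (\<lambda>x. dt T w s x - dt T w t x)"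
      unfolding eventually_at_filter
    proof (rule always_eventually, intro allI impI)
      fix s assume s: "s \<in> {0..T}"
      have "AE x in lebesgue_on unit_ivl. w' s x - w' t x = dt T w s x - dt T w t x"
        using ae[OF s] ae[OF t] by eventually_elim simp
      then show "L2_norm (\<lambda>x. w' s x - w' t x) = L2_norm (\<lambda>x. dt T w s x - dt T w t x)"
        by (rule L2_norm_cong_AE[OF L2_diff[OF w'L[OF s] w'L[OF t]]])
    qed
  qed
  then show "C1_in T L2 L2_norm w"
    unfolding C1_in_def C0_in_def[of T L2 L2_norm "dt T w"]
    using C0_in_L2_continuous[OF w] htd' dL by blast
qed

lemma has_weak_deriv_pointwise:
  fixes f f' :: "real \<Rightarrow> real"
  assumes f: "continuous_on {0..1} f" and f': "continuous_on {0..1} f'"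
    and d: "\<And>x. x \<in> {0<..<1} \<Longrightarrow> (f has_real_derivative f' x) (at x)"
  shows "has_weak_deriv 1 unit_ivl f f'"
  unfolding has_weak_deriv_1_iff
proof (intro conjI allI impI)
  have L1: "L1_loc unit_ivl h" if "continuous_on {0..1} h" for h
    unfolding L1_loc_def
  proof (intro allI impI)
    fix K :: "real set" assume K: "compact K \<and> K \<subseteq> unit_ivl"
    then show "integrable (lebesgue_on K) h"
      by (intro integrable_lebesgue_on_subset[OF continuous_imp_integrable_real[OF that]])
        (auto simp: lmeasurable_compact fmeasurableD)
  qed
  show "L1_loc unit_ivl f" "L1_loc unit_ivl f'" by (rule L1[OF f] L1[OF f'])+
  fix \<phi> assume "test_fun unit_ivl \<phi>"
  then obtain c d where sm: "smooth \<phi>" and cd: "0 < c" "d < 1" "\<And>x. x \<notin> {c..d} \<Longrightarrow> \<phi> x = 0"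
    using test_fun_Ioo_iff[of 0 1 \<phi>] by auto
  note \<phi>c = smooth_continuous[OF sm] smooth_continuous[OF smooth_deriv[OF sm]]
  have "((\<lambda>x. f' x * \<phi> x + f x * deriv \<phi> x) has_integral f 1 * \<phi> 1 - f 0 * \<phi> 0) {0..1}"
  proof (rule fundamental_theorem_of_calculus_interior)
    show "continuous_on {0..1} (\<lambda>x. f x * \<phi> x)" by (intro continuous_intros f \<phi>c)
    show "((\<lambda>x. f x * \<phi> x) has_vector_derivative f' x * \<phi> x + f x * deriv \<phi> x) (at x)" if "x \<in> {0<..<1}" for x
      unfolding has_real_derivative_iff_has_vector_derivative[symmetric]
      using DERIV_mult[OF d[OF that] smooth_has_deriv[OF sm, of x]] by (simp add: mult.commute add.commute)
  qed simp
  moreover have "\<phi> 1 = 0" "\<phi> 0 = 0" using cd by auto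
  ultimately have z: "integral {0..1} (\<lambda>x. f' x * \<phi> x + f x * deriv \<phi> x) = 0" by (simp add: has_integral_iff)
  have i: "integrable (lebesgue_on unit_ivl) (\<lambda>x. f' x * \<phi> x)" "integrable (lebesgue_on unit_ivl) (\<lambda>x. f x * deriv \<phi> x)"
    by (intro continuous_integrable_unit continuous_intros f f' \<phi>c)+
  have "(LINT x|lebesgue_on unit_ivl. f' x * \<phi> x + f x * deriv \<phi> x) = integral {0<..<1} (\<lambda>x. f' x * \<phi> x + f x * deriv \<phi> x)"
    using i by (intro lebesgue_integral_eq_integral) auto
  also have "\<dots> = 0" using z by (simp add: integral_open_interval_real)
  finally show "(LINT x|lebesgue_on unit_ivl. f x * deriv \<phi> x) = - (LINT x|lebesgue_on unit_ivl. f' x * \<phi> x)"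
    using i by simp
qed

lemma C0_in_H1_pointwise:
  fixes w w' :: "real \<Rightarrow> real \<Rightarrow> real"
  assumes w: "continuous_on ({0..T} \<times> {0..1}) (\<lambda>(t, x). w t x)"
    and w': "continuous_on ({0..T} \<times> {0..1}) (\<lambda>(t, x). w' t x)"
    and d: "\<And>t x. t \<in> {0..T} \<Longrightarrow> x \<in> {0<..<1} \<Longrightarrow> (w t has_real_derivative w' t x) (at x)"
  shows "C0_in T H1 H1_norm w"
    and "\<And>t. t \<in> {0..T} \<Longrightarrow> AE x in lebesgue_on unit_ivl. dx (w t) x = w' t x"
    and "\<And>t. t \<in> {0..T} \<Longrightarrow> w t \<in> H1"
proof -
  note wc = continuous_on_slice[OF w] and w'c = continuous_on_slice[OF w']
  have wd: "has_weak_deriv 1 unit_ivl (w t) (w' t)" if "t \<in> {0..T}" for t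
    by (rule has_weak_deriv_pointwise[OF wc[OF that] w'c[OF that] d[OF that]])
  show H: "w t \<in> H1" if "t \<in> {0..T}" for t
    using wd[OF that] L2_continuous[OF wc[OF that]] L2_continuous[OF w'c[OF that]] by (auto simp: H1_def)
  show ae: "AE x in lebesgue_on unit_ivl. dx (w t) x = w' t x" if "t \<in> {0..T}" for t
    by (rule has_weak_deriv_unique[OF weak_deriv_some[OF wd[OF that]] wd[OF that]])
  have "((\<lambda>s. H1_norm (\<lambda>x. w s x - w t x)) \<longlongrightarrow> 0) (at t within {0..T})" if t: "t \<in> {0..T}" for t
  proof (rule Lim_transform_eventually)
    have "((\<lambda>s. sqrt ((L2_norm (\<lambda>x. w s x - w t x))\<^sup>2 + (L2_norm (\<lambda>x. w' s x - w' t x))\<^sup>2)) \<longlongrightarrow> sqrt (0\<^sup>2 + 0\<^sup>2)) (at t within {0..T})"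
      by (intro tendsto_intros L2_norm_diff_tendsto_0 w w' t)
    then show "((\<lambda>s. sqrt ((L2_norm (\<lambda>x. w s x - w t x))\<^sup>2 + (L2_norm (\<lambda>x. w' s x - w' t x))\<^sup>2)) \<longlongrightarrow> 0) (at t within {0..T})"
      by simp
    show "\<forall>\<^sub>F s in at t within {0..T}. sqrt ((L2_norm (\<lambda>x. w s x - w t x))\<^sup>2 + (L2_norm (\<lambda>x. w' s x - w' t x))\<^sup>2)
        = H1_norm (\<lambda>x. w s x - w t x)"
      unfolding eventually_at_filter
    proof (rule always_eventually, intro allI impI)
      fix s assume s: "s \<in> {0..T}"
      have "AE x in lebesgue_on unit_ivl. w' s x - w' t x = dx (\<lambda>x. w s x - w t x) x"
        using ae[OF s] ae[OF t] H1_diff(2)[OF H[OF s] H[OF t]] by eventually_elim simp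
      then have "L2_norm (\<lambda>x. w' s x - w' t x) = L2_norm (dx (\<lambda>x. w s x - w t x))"
        by (rule L2_norm_cong_AE[OF L2_diff[OF L2_continuous[OF w'c[OF s]] L2_continuous[OF w'c[OF t]]]])
      then show "sqrt ((L2_norm (\<lambda>x. w s x - w t x))\<^sup>2 + (L2_norm (\<lambda>x. w' s x - w' t x))\<^sup>2) = H1_norm (\<lambda>x. w s x - w t x)"
        by (simp add: H1_norm_def)
    qed
  qed
  then show "C0_in T H1 H1_norm w" using H by (auto simp: C0_in_def)
qed

lemma C0_norm_le:
  assumes "T > 0" "\<And>t. t \<in> {0..T} \<Longrightarrow> N (p t) \<le> A" "\<And>t. t \<in> {0..T} \<Longrightarrow> N (u t) \<le> B"
    and "\<And>f. N f \<ge> 0"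
  shows "C0_norm T N p u \<le> A + B"
  unfolding C0_norm_def
proof (rule cSUP_least)
  fix t assume t: "t \<in> {0..T}"
  have "sqrt ((N (p t))\<^sup>2 + (N (u t))\<^sup>2) \<le> \<bar>N (p t)\<bar> + \<bar>N (u t)\<bar>" by (rule sqrt_sum_squares_le_sum_abs)
  then show "sqrt ((N (p t))\<^sup>2 + (N (u t))\<^sup>2) \<le> A + B"
    using assms(2,3)[OF t] assms(4) by (smt (verit))
qed (use assms(1) in auto)

text \<open>On \<open>[0, T]\<close> one has \<open>\<bar>s - t\<bar> \<le> T powr (1 - \<gamma>) * \<bar>s - t\<bar> powr \<gamma>\<close>.\<close>

lemma Lipschitz_Hoelder:
  assumes T: "T > 0" and \<gamma>: "0 \<le> \<gamma>" "\<gamma> \<le> 1" and L: "L \<ge> 0"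
    and lip: "\<And>s t. s \<in> {0..T} \<Longrightarrow> t \<in> {0..T} \<Longrightarrow> \<bar>f s - f t\<bar> \<le> L * \<bar>s - t\<bar>"
    and bd: "\<And>t. t \<in> {0..T} \<Longrightarrow> \<bar>f t\<bar> \<le> A"
  shows "Hoelder \<gamma> T f" and "Hoelder_norm \<gamma> T f \<le> A + L * T powr (1 - \<gamma>)"
proof -
  have "L-lipschitz_on {0..T} f" using L lip by (intro lipschitz_onI) (auto simp: dist_real_def)
  then have c: "continuous_on {0..T} f" by (rule lipschitz_on_continuous_on)
  have h: "\<bar>f s - f t\<bar> \<le> L * T powr (1 - \<gamma>) * \<bar>s - t\<bar> powr \<gamma>" if "s \<in> {0..T}" "t \<in> {0..T}" for s t
  proof (cases "s = t")
    case False
    then have pos: "\<bar>s - t\<bar> > 0" by simp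
    have "\<bar>s - t\<bar> = \<bar>s - t\<bar> powr (1 - \<gamma>) * \<bar>s - t\<bar> powr \<gamma>"
      using pos by (simp add: powr_add[symmetric])
    also have "\<dots> \<le> T powr (1 - \<gamma>) * \<bar>s - t\<bar> powr \<gamma>"
      using that \<gamma> pos by (intro mult_right_mono powr_mono2) auto
    finally have "L * \<bar>s - t\<bar> \<le> L * (T powr (1 - \<gamma>) * \<bar>s - t\<bar> powr \<gamma>)" by (intro mult_left_mono L)
    then show ?thesis using lip[OF that] by simp
  qed simp
  show "Hoelder \<gamma> T f" unfolding Hoelder_def using c h by blast
  have 1: "(SUP t\<in>{0..T}. \<bar>f t\<bar>) \<le> A" using bd T by (intro cSUP_least) auto
  have 2: "(SUP (s, t)\<in>{(s, t). s \<in> {0..T} \<and> t \<in> {0..T} \<and> s \<noteq> t}. \<bar>f s - f t\<bar> / \<bar>s - t\<bar> powr \<gamma>) \<le> L * T powr (1 - \<gamma>)"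
  proof (rule cSUP_least)
    have "(0, T) \<in> {(s, t). s \<in> {0..T} \<and> t \<in> {0..T} \<and> s \<noteq> t}" using T by auto
    then show "{(s, t). s \<in> {0..T} \<and> t \<in> {0..T} \<and> s \<noteq> t} \<noteq> {}" by blast
    fix q assume "q \<in> {(s, t). s \<in> {0..T} \<and> t \<in> {0..T} \<and> s \<noteq> t}"
    then show "(case q of (s, t) \<Rightarrow> \<bar>f s - f t\<bar> / \<bar>s - t\<bar> powr \<gamma>) \<le> L * T powr (1 - \<gamma>)"
      using h by (auto simp: pos_divide_le_eq)
  qed
  have "L * T powr (1 - \<gamma>) \<ge> 0" using L by simp
  then show "Hoelder_norm \<gamma> T f \<le> A + L * T powr (1 - \<gamma>)"
    unfolding Hoelder_norm_def using 1 2 by auto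
qed

section \<open>Existence, uniqueness and bounds\<close>

text \<open>All summands of the \<open>C\<^sup>4\<close> norm are nonnegative, so each of them is bounded by the norm.\<close>

lemma boundary_data_regular:
  assumes T: "T > 0" and g: "boundary_data_assms T g" and M: "Ck_norm 4 T g \<le> M"
  shows "\<And>t. t \<in> {0..T} \<Longrightarrow> (g has_real_derivative ivl_deriv T g t) (at t within {0..T})"
    and "continuous_on {0..T} (ivl_deriv T g)" and "g 0 = 0" and "ivl_deriv T g 0 = 0"
    and "\<And>t. t \<in> {0..T} \<Longrightarrow> \<bar>ivl_deriv T g t\<bar> \<le> M"
proof -
  have diff: "(ivl_deriv T ^^ j) g differentiable_on {0..T}" if "j < 4" for j
    using g that by (auto simp: boundary_data_assms_def Ck_on_def)
  have c: "continuous_on {0..T} ((ivl_deriv T ^^ j) g)" if "j \<le> 4" for j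
    using differentiable_imp_continuous_on[OF diff[of j]] g that
    by (cases "j = 4") (auto simp: boundary_data_assms_def Ck_on_def)
  show "(g has_real_derivative ivl_deriv T g t) (at t within {0..T})" if "t \<in> {0..T}" for t
    using diff[of 0] that unfolding ivl_deriv_def has_real_derivative_iff_has_vector_derivative
    by (auto simp: differentiable_on_def vector_derivative_works)
  show "continuous_on {0..T} (ivl_deriv T g)" using c[of 1] by simp
  show "g 0 = 0" "ivl_deriv T g 0 = 0" using g by (auto simp: boundary_data_assms_def)
  have bdd: "bdd_above ((\<lambda>t. \<bar>(ivl_deriv T ^^ j) g t\<bar>) ` {0..T})" if "j \<le> 4" for j
    by (intro bounded_imp_bdd_above compact_imp_bounded compact_continuous_image continuous_intros c that) auto
  have up: "\<bar>(ivl_deriv T ^^ j) g t\<bar> \<le> (SUP t\<in>{0..T}. \<bar>(ivl_deriv T ^^ j) g t\<bar>)" if "j \<le> 4" "t \<in> {0..T}" for j t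
    by (rule cSUP_upper[OF that(2) bdd[OF that(1)]])
  have nn: "0 \<le> (SUP t\<in>{0..T}. \<bar>(ivl_deriv T ^^ j) g t\<bar>)" if "j \<le> 4" for j
    using up[OF that, of 0] T by (intro order_trans[OF abs_ge_zero]) auto
  show "\<bar>ivl_deriv T g t\<bar> \<le> M" if t: "t \<in> {0..T}" for t
  proof -
    have "\<bar>ivl_deriv T g t\<bar> \<le> (SUP t\<in>{0..T}. \<bar>(ivl_deriv T ^^ 1) g t\<bar>)" using up[of 1 t] t by simp
    also have "\<dots> \<le> Ck_norm 4 T g"
      unfolding Ck_norm_def by (rule member_le_sum) (use nn in auto)
    finally show ?thesis using M by linarith
  qed
qed

lemma abs_diff_le_time_deriv:
  assumes "\<And>s. s \<in> {0..T} \<Longrightarrow> (f has_real_derivative f' s) (at s within {0..T})"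
    and "\<And>s. s \<in> {0..T} \<Longrightarrow> \<bar>f' s\<bar> \<le> B" and "s \<in> {0..T}" "t \<in> {0..T}"
  shows "\<bar>f s - f t\<bar> \<le> B * \<bar>s - t\<bar>"
  using field_differentiable_bound[of "{0..T}" f f' B s t] assms by simp

theorem theorem3p1:
  fixes T a0 a1 a2 a3 Mc M0 M1 :: real
  assumes "T > 0" and "a0 > 0" and "a1 > 0" and "a2 > 0" and "a3 > 0"
  shows "\<exists>(C' :: real) (C\<gamma> :: real \<Rightarrow> real). \<forall>(a :: real \<Rightarrow> real) (c :: real) (p0 :: real \<Rightarrow> real)
      (u0 :: real \<Rightarrow> real) (g0 :: real \<Rightarrow> real) (g1 :: real \<Rightarrow> real).
      coefficient_assms a0 a1 a2 a3 a \<and>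
      u0 = (\<lambda>x. 0) \<and> p0 = (\<lambda>x. c) \<and>
      boundary_data_assms T g0 \<and> boundary_data_assms T g1 \<and>
      \<bar>c\<bar> \<le> Mc \<and> Ck_norm 4 T g0 \<le> M0 \<and> Ck_norm 4 T g1 \<le> M1 \<longrightarrow>
      (\<exists>p u. classical_solution T a g0 g1 p0 u0 p u \<and>
         (\<forall>q v. classical_solution T a g0 g1 p0 u0 q v \<longrightarrow>
            (\<forall>t\<in>{0..T}. AE x in lebesgue_on unit_ivl. q t x = p t x \<and> v t x = u t x)) \<and>
         C0_norm T H1_norm p u + C1_norm T L2 L2_norm p u \<le> C' \<and>
         (\<forall>\<gamma>. 0 \<le> \<gamma> \<and> \<gamma> < 1/2 \<longrightarrow>
            Hoelder \<gamma> T (pressure_drop p) \<and> Hoelder_norm \<gamma> T (pressure_drop p) \<le> C\<gamma> \<gamma>))"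
proof -
  define M where "M = max M0 M1"
  \<comment> \<open>\<open>B\<close> bounds both time derivatives, \<open>P\<close> the pressure and \<open>B * T\<close> the velocity.\<close>
  define B where "B = 8 * ((\<lceil>T\<rceil> + 1) * M) * exp (2 * a1 * (T + 1))"
  define P where "P = Mc + B * T"
  \<comment> \<open>The summands bound \<open>p\<close>, \<open>p\<^sub>x\<close>, \<open>u\<close>, \<open>u\<^sub>x\<close> for the \<open>H\<^sup>1\<close> norm, then \<open>p\<close>, \<open>u\<close>, \<open>p\<^sub>t\<close>, \<open>u\<^sub>t\<close> for the \<open>C\<^sup>1\<close> norm.\<close>
  define C where "C = (P + (B + a1 * (B * T))) + (B * T + B) + ((P + B * T) + (B + B))"
  define H where "H \<gamma> = 2 * P + 2 * B * T powr (1 - \<gamma>)" for \<gamma>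
  show ?thesis
  proof (intro exI[of _ C] exI[of _ H] allI impI)
    fix a p0 u0 g0 g1 :: "real \<Rightarrow> real" and c :: real
    assume "coefficient_assms a0 a1 a2 a3 a \<and>
      u0 = (\<lambda>x. 0) \<and> p0 = (\<lambda>x. c) \<and>
      boundary_data_assms T g0 \<and> boundary_data_assms T g1 \<and>
      \<bar>c\<bar> \<le> Mc \<and> Ck_norm 4 T g0 \<le> M0 \<and> Ck_norm 4 T g1 \<le> M1"
    then have coef: "coefficient_assms a0 a1 a2 a3 a" and u0: "u0 = (\<lambda>x. 0)" and p0: "p0 = (\<lambda>x. c)"
      and bd: "boundary_data_assms T g0" "boundary_data_assms T g1" and c: "\<bar>c\<bar> \<le> Mc"
      and M: "Ck_norm 4 T g0 \<le> M" "Ck_norm 4 T g1 \<le> M"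
      by (auto simp: M_def)
    obtain b where b: "\<And>y. (a has_real_derivative b y) (at y)" "\<And>y. a0 \<le> b y" "\<And>y. b y \<le> a1"
      "\<And>y z. \<bar>b y - b z\<bar> \<le> a2 * \<bar>y - z\<bar>"
      using coefficient_regular[OF coef] by blast
    have b_abs: "\<bar>b y\<bar> \<le> a1" for y using b(2,3)[of y] assms(2) by auto
    have mono: "mono a"
    proof (rule monoI)
      fix x y :: real assume "x \<le> y"
      then show "a x \<le> a y"
        by (rule DERIV_nonneg_imp_nondecreasing) (use b(1,2) assms(2) in \<open>meson less_imp_le order_trans\<close>)
    qed
    have a_0: "a 0 = 0" and ac: "continuous_on UNIV a" using coef by (auto simp: coefficient_assms_def)
    have a_lin: "\<bar>a y\<bar> \<le> a1 * \<bar>y\<bar>" for y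
      using field_differentiable_bound[of UNIV a b a1 y 0] b(1) b_abs a_0 by simp
    note d0 = boundary_data_regular[OF assms(1) bd(1) M(1)] and d1 = boundary_data_regular[OF assms(1) bd(2) M(2)]
    obtain p u pt ut :: "real \<Rightarrow> real \<Rightarrow> real" where
      cont: "continuous_on ({0..T} \<times> {0..1}) (\<lambda>(t, x). p t x)" "continuous_on ({0..T} \<times> {0..1}) (\<lambda>(t, x). u t x)"
        "continuous_on ({0..T} \<times> {0..1}) (\<lambda>(t, x). pt t x)" "continuous_on ({0..T} \<times> {0..1}) (\<lambda>(t, x). ut t x)"
      and td: "\<And>t x. t \<in> {0..T} \<Longrightarrow> x \<in> {0..1} \<Longrightarrow> ((\<lambda>s. p s x) has_real_derivative pt t x) (at t within {0..T})"
        "\<And>t x. t \<in> {0..T} \<Longrightarrow> x \<in> {0..1} \<Longrightarrow> ((\<lambda>s. u s x) has_real_derivative ut t x) (at t within {0..T})"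
      and xd: "\<And>t x. t \<in> {0..T} \<Longrightarrow> x \<in> {0<..<1} \<Longrightarrow> (u t has_real_derivative - pt t x) (at x)"
        "\<And>t x. t \<in> {0..T} \<Longrightarrow> x \<in> {0<..<1} \<Longrightarrow> (p t has_real_derivative - ut t x - a (u t x)) (at x)"
      and bc: "\<And>t. t \<in> {0..T} \<Longrightarrow> u t 0 = g0 t" "\<And>t. t \<in> {0..T} \<Longrightarrow> u t 1 = g1 t"
      and ic: "\<And>x. x \<in> {0..1} \<Longrightarrow> p 0 x = c" "\<And>x. x \<in> {0..1} \<Longrightarrow> u 0 x = 0"
      and bnd: "\<And>t x. t \<in> {0..T} \<Longrightarrow> x \<in> {0..1} \<Longrightarrow> \<bar>pt t x\<bar> \<le> B" "\<And>t x. t \<in> {0..T} \<Longrightarrow> x \<in> {0..1} \<Longrightarrow> \<bar>ut t x\<bar> \<le> B"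
      using smooth_solution[OF assms(1,3) less_imp_le[OF assms(4)] b(1) a_0 b_abs b(4) d0 d1 B_def, of c] by blast
    have zT: "0 \<in> {0..T}" using assms(1) by simp
    have B0: "B \<ge> 0" using bnd(1)[OF zT, of 0] by simp
    have time: "\<bar>p s x - p t x\<bar> \<le> B * \<bar>s - t\<bar>" "\<bar>u s x - u t x\<bar> \<le> B * \<bar>s - t\<bar>"
      if "s \<in> {0..T}" "t \<in> {0..T}" "x \<in> {0..1}" for s t x
      using that by (auto intro!: abs_diff_le_time_deriv[OF td(1) bnd(1)] abs_diff_le_time_deriv[OF td(2) bnd(2)])
    have BT: "B * \<bar>t - 0\<bar> \<le> B * T" if "t \<in> {0..T}" for t
      using that B0 by (intro mult_left_mono) auto
    have pb: "\<bar>p t x\<bar> \<le> P" if "t \<in> {0..T}" "x \<in> {0..1}" for t x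
      using time(1)[OF that(1) zT that(2)] BT[OF that(1)] ic(1)[OF that(2)] c unfolding P_def by linarith
    have ub: "\<bar>u t x\<bar> \<le> B * T" if "t \<in> {0..T}" "x \<in> {0..1}" for t x
      using time(2)[OF that(1) zT that(2)] BT[OF that(1)] ic(2)[OF that(2)] by linarith
    have P0: "P \<ge> 0" using pb[OF zT, of 0] by simp
    have BT0: "B * T \<ge> 0" using B0 assms(1) by simp
    define px where "px t x = - ut t x - a (u t x)" for t x
    define ux where "ux t x = - pt t x" for t x
    have pxb: "\<bar>px t x\<bar> \<le> B + a1 * (B * T)" if "t \<in> {0..T}" "x \<in> {0..1}" for t x
    proof -
      have "\<bar>a (u t x)\<bar> \<le> a1 * (B * T)"
        using a_lin[of "u t x"] mult_left_mono[OF ub[OF that], of a1] assms(3) by linarith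
      then show ?thesis using bnd(2)[OF that] unfolding px_def by linarith
    qed
    have "continuous_on ({0..T} \<times> {0..1}) (\<lambda>q. a ((\<lambda>(t, x). u t x) q))"
      by (rule continuous_on_compose2[OF ac cont(2)]) auto
    then have pxc: "continuous_on ({0..T} \<times> {0..1}) (\<lambda>(t, x). px t x)"
      using cont(4) unfolding px_def case_prod_beta by (intro continuous_intros)
    have uxc: "continuous_on ({0..T} \<times> {0..1}) (\<lambda>(t, x). ux t x)"
      using cont(3) unfolding ux_def case_prod_beta by (intro continuous_intros)
    have C1p: "C1_in T L2 L2_norm p" "\<And>t. t \<in> {0..T} \<Longrightarrow> AE x in lebesgue_on unit_ivl. dt T p t x = pt t x"
      "\<And>t. t \<in> {0..T} \<Longrightarrow> dt T p t \<in> L2"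
      using C1_in_pointwise[OF assms(1) cont(1,3) td(1)] by blast+
    have C1u: "C1_in T L2 L2_norm u" "\<And>t. t \<in> {0..T} \<Longrightarrow> AE x in lebesgue_on unit_ivl. dt T u t x = ut t x"
      "\<And>t. t \<in> {0..T} \<Longrightarrow> dt T u t \<in> L2"
      using C1_in_pointwise[OF assms(1) cont(2,4) td(2)] by blast+
    have Hp: "C0_in T H1 H1_norm p" "\<And>t. t \<in> {0..T} \<Longrightarrow> AE x in lebesgue_on unit_ivl. dx (p t) x = px t x"
      "\<And>t. t \<in> {0..T} \<Longrightarrow> p t \<in> H1"
      using C0_in_H1_pointwise[OF cont(1) pxc xd(2)[folded px_def]] by blast+
    have Hu: "C0_in T H1 H1_norm u" "\<And>t. t \<in> {0..T} \<Longrightarrow> AE x in lebesgue_on unit_ivl. dx (u t) x = ux t x"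
      "\<And>t. t \<in> {0..T} \<Longrightarrow> u t \<in> H1"
      using C0_in_H1_pointwise[OF cont(2) uxc xd(1)[folded ux_def]] by blast+
    have tr: "trace_at e (p t) = p t e" "trace_at e (u t) = u t e" if "t \<in> {0..T}" "e \<in> {0, 1}" for t e
      by (intro trace_at_eq that continuous_on_slice[OF cont(1)] continuous_on_slice[OF cont(2)] AE_I2 refl)+
    have sol: "classical_solution T a g0 g1 p0 u0 p u"
      unfolding classical_solution_def
    proof (intro conjI ballI)
      fix t assume t: "t \<in> {0<..T}"
      then have t': "t \<in> {0..T}" by auto
      show "AE x in lebesgue_on unit_ivl. dt T p t x + dx (u t) x = 0"
        using C1p(2)[OF t'] Hu(2)[OF t'] by eventually_elim (simp add: ux_def)
      show "AE x in lebesgue_on unit_ivl. dt T u t x + dx (p t) x + a (u t x) = 0"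
        using C1u(2)[OF t'] Hp(2)[OF t'] by eventually_elim (simp add: px_def)
      show "trace_at 0 (u t) = g0 t" "trace_at 1 (u t) = g1 t" using tr(2)[OF t'] bc[OF t'] by auto
    next
      show "AE x in lebesgue_on unit_ivl. p 0 x = p0 x" "AE x in lebesgue_on unit_ivl. u 0 x = u0 x"
        using ic by (auto intro!: AE_I2 simp: p0 u0)
    qed (use C1p(1) C1u(1) Hp(1) Hu(1) in auto)
    have pL: "p t \<in> L2" and uL: "u t \<in> L2" if "t \<in> {0..T}" for t
      using L2_continuous[OF continuous_on_slice[OF cont(1) that]] L2_continuous[OF continuous_on_slice[OF cont(2) that]] .
    have sub: "x \<in> {0..1}" if "x \<in> unit_ivl" for x :: real using that by auto
    have nb: "L2_norm (p t) \<le> P" "L2_norm (u t) \<le> B * T"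
      "L2_norm (dt T p t) \<le> B" "L2_norm (dt T u t) \<le> B"
      "L2_norm (dx (p t)) \<le> B + a1 * (B * T)" "L2_norm (dx (u t)) \<le> B" if t: "t \<in> {0..T}" for t
    proof -
      show "L2_norm (p t) \<le> P" "L2_norm (u t) \<le> B * T"
        by (rule L2_norm_le[OF pL[OF t] pb[OF t sub] P0] L2_norm_le[OF uL[OF t] ub[OF t sub] BT0]; simp)+
      have cl: "f t \<in> L2" if "continuous_on ({0..T} \<times> {0..1}) (\<lambda>(t, x). f t x)" for f :: "real \<Rightarrow> real \<Rightarrow> real"
        by (rule L2_continuous[OF continuous_on_slice[OF that t]])
      have "L2_norm (dt T p t) = L2_norm (pt t)" "L2_norm (dt T u t) = L2_norm (ut t)"
        by (rule L2_norm_cong_AE[OF C1p(3)[OF t] C1p(2)[OF t]] L2_norm_cong_AE[OF C1u(3)[OF t] C1u(2)[OF t]]; simp)+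
      moreover have "L2_norm (pt t) \<le> B" "L2_norm (ut t) \<le> B"
        by (rule L2_norm_le[OF cl[OF cont(3)] bnd(1)[OF t sub] B0] L2_norm_le[OF cl[OF cont(4)] bnd(2)[OF t sub] B0]; simp)+
      ultimately show "L2_norm (dt T p t) \<le> B" "L2_norm (dt T u t) \<le> B" by simp_all
      have "L2_norm (dx (p t)) = L2_norm (px t)" "L2_norm (dx (u t)) = L2_norm (ux t)"
        by (rule L2_norm_cong_AE[OF dx_L2[OF Hp(3)[OF t]] Hp(2)[OF t]] L2_norm_cong_AE[OF dx_L2[OF Hu(3)[OF t]] Hu(2)[OF t]]; simp)+
      moreover have "L2_norm (px t) \<le> B + a1 * (B * T)"
        by (rule L2_norm_le[OF cl[OF pxc] pxb[OF t sub]]) (use B0 BT0 assms(3) in auto)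
      moreover have "L2_norm (ux t) \<le> B"
        by (rule L2_norm_le[OF cl[OF uxc]]) (use bnd(1)[OF t sub] B0 in \<open>auto simp: ux_def\<close>)
      ultimately show "L2_norm (dx (p t)) \<le> B + a1 * (B * T)" "L2_norm (dx (u t)) \<le> B" by simp_all
    qed
    have H1_le: "H1_norm f \<le> L2_norm f + L2_norm (dx f)" for f
      unfolding H1_norm_def
      using sqrt_sum_squares_le_sum_abs[of "L2_norm f" "L2_norm (dx f)"] L2_norm_nonneg[of f] L2_norm_nonneg[of "dx f"] by simp
    have "C0_norm T H1_norm p u \<le> (P + (B + a1 * (B * T))) + (B * T + B)"
    proof (rule C0_norm_le[OF assms(1)])
      show "H1_norm (p t) \<le> P + (B + a1 * (B * T))" if "t \<in> {0..T}" for t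
        using H1_le[of "p t"] nb(1,5)[OF that] by linarith
      show "H1_norm (u t) \<le> B * T + B" if "t \<in> {0..T}" for t
        using H1_le[of "u t"] nb(2,6)[OF that] by linarith
    qed (simp add: H1_norm_def)
    moreover have "C0_norm T L2_norm p u \<le> P + B * T"
      by (rule C0_norm_le[OF assms(1)]) (fact nb L2_norm_nonneg)+
    moreover have "C0_norm T L2_norm (dt T p) (dt T u) \<le> B + B"
      by (rule C0_norm_le[OF assms(1)]) (fact nb L2_norm_nonneg)+
    ultimately have norms: "C0_norm T H1_norm p u + C1_norm T L2 L2_norm p u \<le> C"
      unfolding C1_norm_def C_def by linarith
    have drop: "pressure_drop p t = p t 0 - p t 1" if "t \<in> {0..T}" for t
      unfolding pressure_drop_def using tr(1)[OF that] by simp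
    have hoel: "Hoelder \<gamma> T (pressure_drop p) \<and> Hoelder_norm \<gamma> T (pressure_drop p) \<le> H \<gamma>" if "0 \<le> \<gamma> \<and> \<gamma> < 1/2" for \<gamma>
    proof -
      have lip: "\<bar>pressure_drop p s - pressure_drop p t\<bar> \<le> 2 * B * \<bar>s - t\<bar>" if "s \<in> {0..T}" "t \<in> {0..T}" for s t
        using time(1)[OF that, of 0] time(1)[OF that, of 1] drop[OF that(1)] drop[OF that(2)] by simp
      have bdd: "\<bar>pressure_drop p t\<bar> \<le> 2 * P" if "t \<in> {0..T}" for t
        using pb[OF that, of 0] pb[OF that, of 1] drop[OF that] by simp
      show ?thesis
      proof -
        have "0 \<le> \<gamma>" "\<gamma> \<le> 1" "0 \<le> 2 * B" using that B0 by auto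
        from Lipschitz_Hoelder[OF assms(1) this lip bdd] show ?thesis unfolding H_def by blast
      qed
    qed
    show "\<exists>p u. classical_solution T a g0 g1 p0 u0 p u \<and>
         (\<forall>q v. classical_solution T a g0 g1 p0 u0 q v \<longrightarrow>
            (\<forall>t\<in>{0..T}. AE x in lebesgue_on unit_ivl. q t x = p t x \<and> v t x = u t x)) \<and>
         C0_norm T H1_norm p u + C1_norm T L2 L2_norm p u \<le> C \<and>
         (\<forall>\<gamma>. 0 \<le> \<gamma> \<and> \<gamma> < 1/2 \<longrightarrow>
            Hoelder \<gamma> T (pressure_drop p) \<and> Hoelder_norm \<gamma> T (pressure_drop p) \<le> H \<gamma>)"
    proof (rule exI[of _ p], rule exI[of _ u], intro conjI)
      show "\<forall>q v. classical_solution T a g0 g1 p0 u0 q v \<longrightarrow>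
            (\<forall>t\<in>{0..T}. AE x in lebesgue_on unit_ivl. q t x = p t x \<and> v t x = u t x)"
        using classical_solution_unique[OF assms(1) mono sol] by blast
    qed (use sol norms hoel in auto)
  qed
qed

end
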